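(* It is provable in $\mathbf{ZF}$ that each of the following sentences (i)--(v) implies $\mathbf{CMC}_{\omega}$: (i) for every $T_{3\frac12}$-space $\mathbf{X}$, at least one of the families $\mathcal{G}_{\delta}(\mathbf{X})$ and $\mathcal{Z}(\mathbf{X})$ is stable under countable intersections; (ii) for every strongly zero-dimensional $T_1$-space $\mathbf{X}$, the family $\mathcal{CO}_{\delta}(\mathbf{X})$ is stable under countable intersections; (iii) for every $T_{3\frac12}$-space $\mathbf{X}$, the space $(\mathbf{X})_{\delta}$ is a $P$-space; (iv) every countable product of countable, compact metrizable spaces is metrizable; (v) every countable product of countable, compact, first-countable $T_{3\frac12}$-spaces is first-countable.
   Context: The base theory is $\mathbf{ZF}$ (no Axiom of Choice). A set is countable if it is equipotent to a subset of $\omega$, and denumerable if it is infinite and countable. $\mathbf{CMC}_\omega$: every denumerable family of denumerable sets has a multiple choice function, i.e. a function assigning to each member (index) a non-empty finite subset of it. A family $\mathcal{A}$ of subsets of a set is stable under countable intersections if $\bigcap\mathcal{U}\in\mathcal{A}$ for every non-empty countable $\mathcal{U}\subseteq\mathcal{A}$. For a topological space $\mathbf{X}$: $\mathcal{CO}_\delta(\mathbf{X})$ is the family of all intersections of non-empty countable families of clopen sets; $\mathcal{Z}(\mathbf{X})$ is the family of all zero-sets $f^{-1}[\{0\}]$ with $f:\mathbf{X}\to\mathbb{R}$ continuous; $\mathcal{G}_\delta(\mathbf{X})$ is the family of all $G_\delta$-sets. $(\mathbf{X})_\delta$ is the underlying set of $\mathbf{X}$ with the topology having $\mathcal{G}_\delta(\mathbf{X})$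 as a base. A topological space is a $P$-space if all its $G_\delta$-sets are open. $\mathbf{X}$ is completely regular if the complements of zero-sets form a base; a $T_{3\frac12}$-space is a completely regular $T_1$-space. $\mathbf{X}$ is strongly zero-dimensional if it is completely regular and for every pair $Z_1,Z_2$ of disjoint zero-sets there is a clopen set $U$ with $Z_1\subseteq U\subseteq X\setminus Z_2$. Products carry the Tychonoff product topology; a countable space is one whose underlying set is countable. *)

theory Defs
  imports Main
begin

text \<open>
  HOL itself proves the axiom of choice, so a choice-free result cannot be rendered by
  quantifying over HOL sets. The object theory ZF is therefore embedded deeply: formulas of
  the language of set theory, a Hilbert calculus for classical first-order logic with equality,
  and the ZF axioms. The five sentences and \<open>CMC\<^sub>\<omega>\<close> are formulas of that language.
\<close>

section \<open>First-order logic over membership and equality\<close>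

datatype fm = Mem nat nat | Eql nat nat | Fls | Imp fm fm | Forall nat fm

definition Neg :: "fm \<Rightarrow> fm" where "Neg p = Imp p Fls"
definition Conj :: "fm \<Rightarrow> fm \<Rightarrow> fm" where "Conj p q = Neg (Imp p (Neg q))"
definition Disj :: "fm \<Rightarrow> fm \<Rightarrow> fm" where "Disj p q = Imp (Neg p) q"
definition Iff :: "fm \<Rightarrow> fm \<Rightarrow> fm" where "Iff p q = Conj (Imp p q) (Imp q p)"
definition Exists :: "nat \<Rightarrow> fm \<Rightarrow> fm" where "Exists x p = Neg (Forall x (Neg p))"

primrec fv :: "fm \<Rightarrow> nat set" where
  "fv (Mem x y) = {x, y}"
| "fv (Eql x y) = {x, y}"
| "fv Fls = {}"
| "fv (Imp p q) = fv p \<union> fv q"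
| "fv (Forall x p) = fv p - {x}"

text \<open>\<open>subst x y p\<close> replaces the free occurrences of \<open>x\<close> in \<open>p\<close> by \<open>y\<close>, without renaming;
  \<open>free_for x y p\<close> says that this captures no occurrence of \<open>y\<close>.\<close>

primrec subst :: "nat \<Rightarrow> nat \<Rightarrow> fm \<Rightarrow> fm" where
  "subst x y (Mem u v) = Mem (if u = x then y else u) (if v = x then y else v)"
| "subst x y (Eql u v) = Eql (if u = x then y else u) (if v = x then y else v)"
| "subst x y Fls = Fls"
| "subst x y (Imp p q) = Imp (subst x y p) (subst x y q)"
| "subst x y (Forall z p) = Forall z (if z = x then p else subst x y p)"

primrec free_for :: "nat \<Rightarrow> nat \<Rightarrow> fm \<Rightarrow> bool" where
  "free_for x y (Mem u v) \<longleftrightarrow> True"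
| "free_for x y (Eql u v) \<longleftrightarrow> True"
| "free_for x y Fls \<longleftrightarrow> True"
| "free_for x y (Imp p q) \<longleftrightarrow> free_for x y p \<and> free_for x y q"
| "free_for x y (Forall z p) \<longleftrightarrow> x \<notin> fv (Forall z p) \<or> (z \<noteq> y \<and> free_for x y p)"

text \<open>Generalization is unrestricted, so a non-logical axiom with free variables has the
  force of its universal closure.\<close>

inductive derivable :: "fm set \<Rightarrow> fm \<Rightarrow> bool" for A :: "fm set" where
  ax: "p \<in> A \<Longrightarrow> derivable A p"
| weaken: "derivable A (Imp p (Imp q p))"
| distrib: "derivable A (Imp (Imp p (Imp q r)) (Imp (Imp p q) (Imp p r)))"
| double_neg: "derivable A (Imp (Neg (Neg p)) p)"
| inst: "free_for x y p \<Longrightarrow> derivable A (Imp (Forall x p) (subst x y p))"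
| all_imp: "x \<notin> fv p \<Longrightarrow> derivable A (Imp (Forall x (Imp p q)) (Imp p (Forall x q)))"
| eq_refl: "derivable A (Eql x x)"
| eq_eq: "derivable A (Imp (Eql x y) (Imp (Eql x z) (Eql y z)))"
| eq_mem_left: "derivable A (Imp (Eql x y) (Imp (Mem x z) (Mem y z)))"
| eq_mem_right: "derivable A (Imp (Eql x y) (Imp (Mem z x) (Mem z y)))"
| modus_ponens: "derivable A (Imp p q) \<Longrightarrow> derivable A p \<Longrightarrow> derivable A q"
| generalization: "derivable A p \<Longrightarrow> derivable A (Forall x p)"


section \<open>Readable syntax for formulas\<close>

text \<open>
  An element \<open>\<phi>\<close> of \<open>form\<close> yields a formula once the current binding depth \<open>d\<close> is given: the
  variables below \<open>d\<close> may occur free, and a quantifier at depth \<open>d\<close> binds the variable \<open>d\<close>.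
  Thus variables bound by HOL abstraction become distinct object variables and no capture can
  occur. A sentence is read at depth 0.
\<close>

type_synonym form = "nat \<Rightarrow> fm"

definition f_mem :: "nat \<Rightarrow> nat \<Rightarrow> form" (infix "\<^bold>\<in>" 50) where
  "(x \<^bold>\<in> y) = (\<lambda>d. Mem x y)"
definition f_eq :: "nat \<Rightarrow> nat \<Rightarrow> form" (infix "\<^bold>=" 50) where
  "(x \<^bold>= y) = (\<lambda>d. Eql x y)"
definition f_not :: "form \<Rightarrow> form" ("\<^bold>\<not> _" [40] 40) where
  "(\<^bold>\<not> p) = (\<lambda>d. Neg (p d))"
definition f_and :: "form \<Rightarrow> form \<Rightarrow> form" (infixr "\<^bold>\<and>" 35) where
  "(p \<^bold>\<and> q) = (\<lambda>d. Conj (p d) (q d))"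
definition f_or :: "form \<Rightarrow> form \<Rightarrow> form" (infixr "\<^bold>\<or>" 30) where
  "(p \<^bold>\<or> q) = (\<lambda>d. Disj (p d) (q d))"
definition f_imp :: "form \<Rightarrow> form \<Rightarrow> form" (infixr "\<^bold>\<longrightarrow>" 25) where
  "(p \<^bold>\<longrightarrow> q) = (\<lambda>d. Imp (p d) (q d))"
definition f_iff :: "form \<Rightarrow> form \<Rightarrow> form" (infixr "\<^bold>\<longleftrightarrow>" 25) where
  "(p \<^bold>\<longleftrightarrow> q) = (\<lambda>d. Iff (p d) (q d))"
definition f_all :: "(nat \<Rightarrow> form) \<Rightarrow> form" (binder "\<^bold>\<forall>" 10) where
  "f_all P = (\<lambda>d. Forall d (P d (Suc d)))"
definition f_ex :: "(nat \<Rightarrow> form) \<Rightarrow> form" (binder "\<^bold>\<exists>" 10) where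
  "f_ex P = (\<lambda>d. Exists d (P d (Suc d)))"


section \<open>Basic set theory and the axioms of ZF\<close>

definition is_subset :: "nat \<Rightarrow> nat \<Rightarrow> form" (infix "\<^bold>\<subseteq>" 50) where
  "(x \<^bold>\<subseteq> y) = (\<^bold>\<forall>z. z \<^bold>\<in> x \<^bold>\<longrightarrow> z \<^bold>\<in> y)"

definition is_empty :: "nat \<Rightarrow> form" where
  "is_empty x = (\<^bold>\<forall>z. \<^bold>\<not> z \<^bold>\<in> x)"

definition is_upair :: "nat \<Rightarrow> nat \<Rightarrow> nat \<Rightarrow> form" where
  "is_upair p a b = (\<^bold>\<forall>z. z \<^bold>\<in> p \<^bold>\<longleftrightarrow> z \<^bold>= a \<^bold>\<or> z \<^bold>= b)"

definition is_opair :: "nat \<Rightarrow> nat \<Rightarrow> nat \<Rightarrow> form" where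
  "is_opair p a b = (\<^bold>\<exists>u. \<^bold>\<exists>v. is_upair u a a \<^bold>\<and> is_upair v a b \<^bold>\<and> is_upair p u v)"

definition is_succ :: "nat \<Rightarrow> nat \<Rightarrow> form" where
  "is_succ y x = (\<^bold>\<forall>z. z \<^bold>\<in> y \<^bold>\<longleftrightarrow> z \<^bold>\<in> x \<^bold>\<or> z \<^bold>= x)"

definition is_inductive :: "nat \<Rightarrow> form" where
  "is_inductive w = ((\<^bold>\<exists>e. is_empty e \<^bold>\<and> e \<^bold>\<in> w) \<^bold>\<and>
     (\<^bold>\<forall>x. x \<^bold>\<in> w \<^bold>\<longrightarrow> (\<^bold>\<exists>y. is_succ y x \<^bold>\<and> y \<^bold>\<in> w)))"

definition Extensionality :: form where
  "Extensionality = (\<^bold>\<forall>x. \<^bold>\<forall>y. (\<^bold>\<forall>z. z \<^bold>\<in> x \<^bold>\<longleftrightarrow> z \<^bold>\<in> y) \<^bold>\<longrightarrow> x \<^bold>= y)"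

definition Foundation :: form where
  "Foundation = (\<^bold>\<forall>x. \<^bold>\<not> is_empty x \<^bold>\<longrightarrow>
     (\<^bold>\<exists>y. y \<^bold>\<in> x \<^bold>\<and> (\<^bold>\<forall>z. z \<^bold>\<in> y \<^bold>\<longrightarrow> \<^bold>\<not> z \<^bold>\<in> x)))"

definition Pairing :: form where
  "Pairing = (\<^bold>\<forall>a. \<^bold>\<forall>b. \<^bold>\<exists>p. is_upair p a b)"

definition Union_Axiom :: form where
  "Union_Axiom = (\<^bold>\<forall>x. \<^bold>\<exists>u. \<^bold>\<forall>z. z \<^bold>\<in> u \<^bold>\<longleftrightarrow> (\<^bold>\<exists>y. y \<^bold>\<in> x \<^bold>\<and> z \<^bold>\<in> y))"

definition Power_Set :: form where
  "Power_Set = (\<^bold>\<forall>x. \<^bold>\<exists>p. \<^bold>\<forall>z. z \<^bold>\<in> p \<^bold>\<longleftrightarrow> z \<^bold>\<subseteq> x)"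

definition Infinity :: form where
  "Infinity = (\<^bold>\<exists>w. is_inductive w)"

text \<open>In the two schemas the variables of \<open>p\<close> not mentioned are parameters. In the
  replacement schema the premise says that for each \<open>x\<close> in \<open>a\<close> at most one \<open>y\<close> satisfies \<open>p\<close>.\<close>

definition Separation :: "fm set" where
  "Separation = {Forall a (Exists b (Forall x (Iff (Mem x b) (Conj (Mem x a) p)))) | a b x p.
     distinct [a, b, x] \<and> b \<notin> fv p}"

definition Replacement :: "fm set" where
  "Replacement = {Forall a
       (Imp (Forall x (Imp (Mem x a) (Exists w (Forall y (Imp p (Eql y w))))))
            (Exists b (Forall y (Iff (Mem y b) (Exists x (Conj (Mem x a) p))))))
     | a b w x y p. distinct [a, b, w, x, y] \<and> b \<notin> fv p \<and> w \<notin> fv p}"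

definition ZF :: "fm set" where
  "ZF = {Extensionality 0, Foundation 0, Pairing 0, Union_Axiom 0, Power_Set 0, Infinity 0}
        \<union> Separation \<union> Replacement"

definition proves :: "fm set \<Rightarrow> form \<Rightarrow> bool" (infix "\<turnstile>" 20) where
  "(A \<turnstile> \<phi>) \<longleftrightarrow> derivable A (\<phi> 0)"


section \<open>Functions, cardinality and multiple choice\<close>

definition maps :: "nat \<Rightarrow> nat \<Rightarrow> nat \<Rightarrow> form" where
  "maps f x y = (\<^bold>\<exists>p. is_opair p x y \<^bold>\<and> p \<^bold>\<in> f)"

definition fun_on :: "nat \<Rightarrow> nat \<Rightarrow> form" where
  "fun_on f A = ((\<^bold>\<forall>p. p \<^bold>\<in> f \<^bold>\<longrightarrow> (\<^bold>\<exists>x. \<^bold>\<exists>y. x \<^bold>\<in> A \<^bold>\<and> is_opair p x y)) \<^bold>\<and>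
     (\<^bold>\<forall>x. x \<^bold>\<in> A \<^bold>\<longrightarrow> (\<^bold>\<exists>y. maps f x y \<^bold>\<and> (\<^bold>\<forall>y'. maps f x y' \<^bold>\<longrightarrow> y' \<^bold>= y))))"

definition fun_to :: "nat \<Rightarrow> nat \<Rightarrow> nat \<Rightarrow> form" where
  "fun_to f A B = (fun_on f A \<^bold>\<and> (\<^bold>\<forall>x. \<^bold>\<forall>y. maps f x y \<^bold>\<longrightarrow> y \<^bold>\<in> B))"

definition equipotent :: "nat \<Rightarrow> nat \<Rightarrow> form" where
  "equipotent A B = (\<^bold>\<exists>f. fun_to f A B \<^bold>\<and>
     (\<^bold>\<forall>x. \<^bold>\<forall>x'. \<^bold>\<forall>y. maps f x y \<^bold>\<and> maps f x' y \<^bold>\<longrightarrow> x \<^bold>= x') \<^bold>\<and>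
     (\<^bold>\<forall>y. y \<^bold>\<in> B \<^bold>\<longrightarrow> (\<^bold>\<exists>x. maps f x y)))"

definition is_omega :: "nat \<Rightarrow> form" where
  "is_omega w = (is_inductive w \<^bold>\<and> (\<^bold>\<forall>v. is_inductive v \<^bold>\<longrightarrow> w \<^bold>\<subseteq> v))"

definition is_nat :: "nat \<Rightarrow> form" where
  "is_nat n = (\<^bold>\<exists>w. is_omega w \<^bold>\<and> n \<^bold>\<in> w)"

definition is_finite :: "nat \<Rightarrow> form" where
  "is_finite x = (\<^bold>\<exists>n. is_nat n \<^bold>\<and> equipotent x n)"

definition is_countable :: "nat \<Rightarrow> form" where
  "is_countable x = (\<^bold>\<exists>w. \<^bold>\<exists>s. is_omega w \<^bold>\<and> s \<^bold>\<subseteq> w \<^bold>\<and> equipotent x s)"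

definition is_denumerable :: "nat \<Rightarrow> form" where
  "is_denumerable x = (\<^bold>\<not> is_finite x \<^bold>\<and> is_countable x)"

text \<open>Families are indexed, i.e. functions on an index set \<open>I\<close>; multiple choice functions
  are defined on the indices.\<close>

definition CMC_omega :: form where
  "CMC_omega = (\<^bold>\<forall>I. \<^bold>\<forall>A. is_denumerable I \<^bold>\<and> fun_on A I \<^bold>\<and>
       (\<^bold>\<forall>i. \<^bold>\<forall>a. maps A i a \<^bold>\<longrightarrow> is_denumerable a)
     \<^bold>\<longrightarrow> (\<^bold>\<exists>f. fun_on f I \<^bold>\<and>
       (\<^bold>\<forall>i. \<^bold>\<forall>a. \<^bold>\<forall>b. maps A i a \<^bold>\<and> maps f i b \<^bold>\<longrightarrow>
          b \<^bold>\<subseteq> a \<^bold>\<and> \<^bold>\<not> is_empty b \<^bold>\<and> is_finite b)))"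


section \<open>The real numbers\<close>

text \<open>Addition and multiplication on \<open>\<omega>\<close>, by the recursion \<open>m + 0 = m\<close>,
  \<open>m + (k + 1) = (m + k) + 1\<close> and \<open>m * 0 = 0\<close>, \<open>m * (k + 1) = m * k + m\<close>.\<close>

definition nat_add :: "nat \<Rightarrow> nat \<Rightarrow> nat \<Rightarrow> form" where
  "nat_add m n p = (\<^bold>\<exists>w. \<^bold>\<exists>f. is_omega w \<^bold>\<and> fun_to f w w \<^bold>\<and>
     (\<^bold>\<forall>e. is_empty e \<^bold>\<longrightarrow> maps f e m) \<^bold>\<and>
     (\<^bold>\<forall>k. \<^bold>\<forall>k'. \<^bold>\<forall>r. \<^bold>\<forall>r'. maps f k r \<^bold>\<and> is_succ k' k \<^bold>\<and> is_succ r' r \<^bold>\<longrightarrow> maps f k' r') \<^bold>\<and>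
     maps f n p)"

definition nat_mult :: "nat \<Rightarrow> nat \<Rightarrow> nat \<Rightarrow> form" where
  "nat_mult m n p = (is_nat m \<^bold>\<and> (\<^bold>\<exists>w. \<^bold>\<exists>f. is_omega w \<^bold>\<and> fun_to f w w \<^bold>\<and>
     (\<^bold>\<forall>e. is_empty e \<^bold>\<longrightarrow> maps f e e) \<^bold>\<and>
     (\<^bold>\<forall>k. \<^bold>\<forall>k'. \<^bold>\<forall>r. \<^bold>\<forall>r'. maps f k r \<^bold>\<and> is_succ k' k \<^bold>\<and> nat_add r m r' \<^bold>\<longrightarrow> maps f k' r') \<^bold>\<and>
     maps f n p))"

text \<open>The triple \<open>(a, b, c)\<close> of natural numbers with \<open>c \<noteq> 0\<close> represents the rational number
  \<open>(a - b) / c\<close>. No quotient is taken: Dedekind cuts of representatives, being downward closed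
  without greatest element, never separate two representatives of the same rational number.\<close>

definition is_frac :: "nat \<Rightarrow> nat \<Rightarrow> nat \<Rightarrow> nat \<Rightarrow> form" where
  "is_frac q a b c = (is_nat a \<^bold>\<and> is_nat b \<^bold>\<and> is_nat c \<^bold>\<and> \<^bold>\<not> is_empty c \<^bold>\<and>
     (\<^bold>\<exists>p. is_opair p b c \<^bold>\<and> is_opair q a p))"

definition is_rat :: "nat \<Rightarrow> form" where
  "is_rat q = (\<^bold>\<exists>a. \<^bold>\<exists>b. \<^bold>\<exists>c. is_frac q a b c)"

text \<open>\<open>(a - b) / c < (a' - b') / c'\<close> iff \<open>a c' + b' c < a' c + b c'\<close>.\<close>

definition rat_less :: "nat \<Rightarrow> nat \<Rightarrow> form" where
  "rat_less q q' = (\<^bold>\<exists>a. \<^bold>\<exists>b. \<^bold>\<exists>c. \<^bold>\<exists>a'. \<^bold>\<exists>b'. \<^bold>\<exists>c'. is_frac q a b c \<^bold>\<and> is_frac q' a' b' c' \<^bold>\<and>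
     (\<^bold>\<exists>u. \<^bold>\<exists>v. \<^bold>\<exists>u'. \<^bold>\<exists>v'. \<^bold>\<exists>s. \<^bold>\<exists>s'.
        nat_mult a c' u \<^bold>\<and> nat_mult b' c v \<^bold>\<and> nat_add u v s \<^bold>\<and>
        nat_mult a' c u' \<^bold>\<and> nat_mult b c' v' \<^bold>\<and> nat_add u' v' s' \<^bold>\<and> s \<^bold>\<in> s'))"

text \<open>\<open>(a - b) / c + (a' - b') / c' = ((a c' + a' c) - (b c' + b' c)) / (c c')\<close>.\<close>

definition rat_add :: "nat \<Rightarrow> nat \<Rightarrow> nat \<Rightarrow> form" where
  "rat_add q q' t = (\<^bold>\<exists>a. \<^bold>\<exists>b. \<^bold>\<exists>c. \<^bold>\<exists>a'. \<^bold>\<exists>b'. \<^bold>\<exists>c'. is_frac q a b c \<^bold>\<and> is_frac q' a' b' c' \<^bold>\<and>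
     (\<^bold>\<exists>u. \<^bold>\<exists>u'. \<^bold>\<exists>v. \<^bold>\<exists>v'. \<^bold>\<exists>x. \<^bold>\<exists>y. \<^bold>\<exists>z.
        nat_mult a c' u \<^bold>\<and> nat_mult a' c u' \<^bold>\<and> nat_add u u' x \<^bold>\<and>
        nat_mult b c' v \<^bold>\<and> nat_mult b' c v' \<^bold>\<and> nat_add v v' y \<^bold>\<and>
        nat_mult c c' z \<^bold>\<and> is_frac t x y z))"

definition is_real :: "nat \<Rightarrow> form" where
  "is_real D = ((\<^bold>\<forall>q. q \<^bold>\<in> D \<^bold>\<longrightarrow> is_rat q) \<^bold>\<and> \<^bold>\<not> is_empty D \<^bold>\<and>
     (\<^bold>\<exists>q. is_rat q \<^bold>\<and> \<^bold>\<not> q \<^bold>\<in> D) \<^bold>\<and>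
     (\<^bold>\<forall>q. \<^bold>\<forall>q'. q \<^bold>\<in> D \<^bold>\<and> rat_less q' q \<^bold>\<longrightarrow> q' \<^bold>\<in> D) \<^bold>\<and>
     (\<^bold>\<forall>q. q \<^bold>\<in> D \<^bold>\<longrightarrow> (\<^bold>\<exists>q'. q' \<^bold>\<in> D \<^bold>\<and> rat_less q q')))"

definition is_reals :: "nat \<Rightarrow> form" where
  "is_reals R = (\<^bold>\<forall>r. r \<^bold>\<in> R \<^bold>\<longleftrightarrow> is_real r)"

text \<open>The cut of all \<open>(a - b) / c\<close> with \<open>a < b\<close>.\<close>

definition real_zero :: "nat \<Rightarrow> form" where
  "real_zero D = (\<^bold>\<forall>q. q \<^bold>\<in> D \<^bold>\<longleftrightarrow> (\<^bold>\<exists>a. \<^bold>\<exists>b. \<^bold>\<exists>c. is_frac q a b c \<^bold>\<and> a \<^bold>\<in> b))"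

definition real_le :: "nat \<Rightarrow> nat \<Rightarrow> form" where
  "real_le x y = (is_real x \<^bold>\<and> is_real y \<^bold>\<and> x \<^bold>\<subseteq> y)"

definition real_less :: "nat \<Rightarrow> nat \<Rightarrow> form" where
  "real_less x y = (real_le x y \<^bold>\<and> \<^bold>\<not> x \<^bold>= y)"

text \<open>The elements of \<open>x + y\<close> are the \<open>q < q1 + q2\<close> with \<open>q1 \<in> x\<close>, \<open>q2 \<in> y\<close> (not the sums
  \<open>q1 + q2\<close> only, since \<open>rat_add\<close> does not produce all representatives).\<close>

definition real_add :: "nat \<Rightarrow> nat \<Rightarrow> nat \<Rightarrow> form" where
  "real_add x y s = (is_real x \<^bold>\<and> is_real y \<^bold>\<and>
     (\<^bold>\<forall>q. q \<^bold>\<in> s \<^bold>\<longleftrightarrow> (\<^bold>\<exists>q1. \<^bold>\<exists>q2. \<^bold>\<exists>t. q1 \<^bold>\<in> x \<^bold>\<and> q2 \<^bold>\<in> y \<^bold>\<and> rat_add q1 q2 t \<^bold>\<and> rat_less q t)))"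

definition real_positive :: "nat \<Rightarrow> form" where
  "real_positive e = (\<^bold>\<exists>z. real_zero z \<^bold>\<and> real_less z e)"

definition real_open :: "nat \<Rightarrow> form" where
  "real_open U = ((\<^bold>\<forall>x. x \<^bold>\<in> U \<^bold>\<longrightarrow> is_real x) \<^bold>\<and>
     (\<^bold>\<forall>x. x \<^bold>\<in> U \<^bold>\<longrightarrow> (\<^bold>\<exists>a. \<^bold>\<exists>b. real_less a x \<^bold>\<and> real_less x b \<^bold>\<and>
        (\<^bold>\<forall>y. real_less a y \<^bold>\<and> real_less y b \<^bold>\<longrightarrow> y \<^bold>\<in> U))))"


section \<open>Topological spaces\<close>

text \<open>A class of sets, such as the \<open>G\<^sub>\<delta>\<close>-sets of a space, is passed around as a
  formula-valued HOL function \<open>P\<close>; a space is a pair of an underlying set \<open>X\<close> and a topology \<open>T\<close>.\<close>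

definition is_topology :: "nat \<Rightarrow> nat \<Rightarrow> form" where
  "is_topology X T = ((\<^bold>\<forall>U. U \<^bold>\<in> T \<^bold>\<longrightarrow> U \<^bold>\<subseteq> X) \<^bold>\<and> X \<^bold>\<in> T \<^bold>\<and>
     (\<^bold>\<forall>S. S \<^bold>\<subseteq> T \<^bold>\<longrightarrow> (\<^bold>\<exists>U. U \<^bold>\<in> T \<^bold>\<and> (\<^bold>\<forall>x. x \<^bold>\<in> U \<^bold>\<longleftrightarrow> (\<^bold>\<exists>V. V \<^bold>\<in> S \<^bold>\<and> x \<^bold>\<in> V)))) \<^bold>\<and>
     (\<^bold>\<forall>U. \<^bold>\<forall>V. U \<^bold>\<in> T \<^bold>\<and> V \<^bold>\<in> T \<^bold>\<longrightarrow>
        (\<^bold>\<exists>W. W \<^bold>\<in> T \<^bold>\<and> (\<^bold>\<forall>x. x \<^bold>\<in> W \<^bold>\<longleftrightarrow> x \<^bold>\<in> U \<^bold>\<and> x \<^bold>\<in> V))))"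

text \<open>That is, \<open>T\<close> consists of the unions of subfamilies of \<open>P\<close>.\<close>

definition is_base :: "(nat \<Rightarrow> form) \<Rightarrow> nat \<Rightarrow> nat \<Rightarrow> form" where
  "is_base P X T = (\<^bold>\<forall>U. U \<^bold>\<in> T \<^bold>\<longleftrightarrow> U \<^bold>\<subseteq> X \<^bold>\<and>
     (\<^bold>\<forall>x. x \<^bold>\<in> U \<^bold>\<longrightarrow> (\<^bold>\<exists>B. P B \<^bold>\<and> x \<^bold>\<in> B \<^bold>\<and> B \<^bold>\<subseteq> U)))"

definition is_complement :: "nat \<Rightarrow> nat \<Rightarrow> nat \<Rightarrow> form" where
  "is_complement C X A = (\<^bold>\<forall>x. x \<^bold>\<in> C \<^bold>\<longleftrightarrow> x \<^bold>\<in> X \<^bold>\<and> \<^bold>\<not> x \<^bold>\<in> A)"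

definition is_closed :: "nat \<Rightarrow> nat \<Rightarrow> nat \<Rightarrow> form" where
  "is_closed X T A = (A \<^bold>\<subseteq> X \<^bold>\<and> (\<^bold>\<exists>C. is_complement C X A \<^bold>\<and> C \<^bold>\<in> T))"

definition is_clopen :: "nat \<Rightarrow> nat \<Rightarrow> nat \<Rightarrow> form" where
  "is_clopen X T A = (A \<^bold>\<in> T \<^bold>\<and> is_closed X T A)"

definition countable_inter :: "(nat \<Rightarrow> form) \<Rightarrow> nat \<Rightarrow> form" where
  "countable_inter P s = (\<^bold>\<exists>U. \<^bold>\<not> is_empty U \<^bold>\<and> is_countable U \<^bold>\<and> (\<^bold>\<forall>u. u \<^bold>\<in> U \<^bold>\<longrightarrow> P u) \<^bold>\<and>
     (\<^bold>\<forall>x. x \<^bold>\<in> s \<^bold>\<longleftrightarrow> (\<^bold>\<forall>u. u \<^bold>\<in> U \<^bold>\<longrightarrow> x \<^bold>\<in> u)))"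

definition stable_countable_inter :: "(nat \<Rightarrow> form) \<Rightarrow> form" where
  "stable_countable_inter P = (\<^bold>\<forall>s. countable_inter P s \<^bold>\<longrightarrow> P s)"

definition G_delta :: "nat \<Rightarrow> nat \<Rightarrow> form" where
  "G_delta T s = countable_inter (\<lambda>u. u \<^bold>\<in> T) s"

definition CO_delta :: "nat \<Rightarrow> nat \<Rightarrow> nat \<Rightarrow> form" where
  "CO_delta X T s = countable_inter (is_clopen X T) s"

definition continuous_real :: "nat \<Rightarrow> nat \<Rightarrow> nat \<Rightarrow> form" where
  "continuous_real X T f = ((\<^bold>\<exists>R. is_reals R \<^bold>\<and> fun_to f X R) \<^bold>\<and>
     (\<^bold>\<forall>U. real_open U \<^bold>\<longrightarrow>
        (\<^bold>\<exists>V. V \<^bold>\<in> T \<^bold>\<and> (\<^bold>\<forall>x. x \<^bold>\<in> V \<^bold>\<longleftrightarrow> (\<^bold>\<exists>y. y \<^bold>\<in> U \<^bold>\<and> maps f x y)))))"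

definition zero_set :: "nat \<Rightarrow> nat \<Rightarrow> nat \<Rightarrow> form" where
  "zero_set X T Z = (\<^bold>\<exists>f. continuous_real X T f \<^bold>\<and>
     (\<^bold>\<forall>x. x \<^bold>\<in> Z \<^bold>\<longleftrightarrow> (\<^bold>\<exists>y. real_zero y \<^bold>\<and> maps f x y)))"

definition cozero_set :: "nat \<Rightarrow> nat \<Rightarrow> nat \<Rightarrow> form" where
  "cozero_set X T C = (\<^bold>\<exists>Z. zero_set X T Z \<^bold>\<and> is_complement C X Z)"

definition completely_regular :: "nat \<Rightarrow> nat \<Rightarrow> form" where
  "completely_regular X T = (is_topology X T \<^bold>\<and> is_base (cozero_set X T) X T)"

definition T1_space :: "nat \<Rightarrow> nat \<Rightarrow> form" where
  "T1_space X T = (is_topology X T \<^bold>\<and>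
     (\<^bold>\<forall>x. \<^bold>\<forall>s. x \<^bold>\<in> X \<^bold>\<and> is_upair s x x \<^bold>\<longrightarrow> is_closed X T s))"

definition T3_half_space :: "nat \<Rightarrow> nat \<Rightarrow> form" where
  "T3_half_space X T = (completely_regular X T \<^bold>\<and> T1_space X T)"

definition strongly_zero_dimensional :: "nat \<Rightarrow> nat \<Rightarrow> form" where
  "strongly_zero_dimensional X T = (completely_regular X T \<^bold>\<and>
     (\<^bold>\<forall>Z1. \<^bold>\<forall>Z2. zero_set X T Z1 \<^bold>\<and> zero_set X T Z2 \<^bold>\<and> \<^bold>\<not> (\<^bold>\<exists>x. x \<^bold>\<in> Z1 \<^bold>\<and> x \<^bold>\<in> Z2) \<^bold>\<longrightarrow>
        (\<^bold>\<exists>U. \<^bold>\<exists>C. is_clopen X T U \<^bold>\<and> is_complement C X Z2 \<^bold>\<and> Z1 \<^bold>\<subseteq> U \<^bold>\<and> U \<^bold>\<subseteq> C)))"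

definition P_space :: "nat \<Rightarrow> nat \<Rightarrow> form" where
  "P_space X T = (is_topology X T \<^bold>\<and> (\<^bold>\<forall>s. G_delta T s \<^bold>\<longrightarrow> s \<^bold>\<in> T))"

definition is_compact :: "nat \<Rightarrow> nat \<Rightarrow> form" where
  "is_compact X T = (\<^bold>\<forall>C. C \<^bold>\<subseteq> T \<^bold>\<and> (\<^bold>\<forall>x. x \<^bold>\<in> X \<^bold>\<longrightarrow> (\<^bold>\<exists>U. U \<^bold>\<in> C \<^bold>\<and> x \<^bold>\<in> U)) \<^bold>\<longrightarrow>
     (\<^bold>\<exists>F. F \<^bold>\<subseteq> C \<^bold>\<and> is_finite F \<^bold>\<and> (\<^bold>\<forall>x. x \<^bold>\<in> X \<^bold>\<longrightarrow> (\<^bold>\<exists>U. U \<^bold>\<in> F \<^bold>\<and> x \<^bold>\<in> U))))"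

definition first_countable :: "nat \<Rightarrow> nat \<Rightarrow> form" where
  "first_countable X T = (\<^bold>\<forall>x. x \<^bold>\<in> X \<^bold>\<longrightarrow> (\<^bold>\<exists>B. is_countable B \<^bold>\<and>
     (\<^bold>\<forall>V. V \<^bold>\<in> B \<^bold>\<longrightarrow> V \<^bold>\<in> T \<^bold>\<and> x \<^bold>\<in> V) \<^bold>\<and>
     (\<^bold>\<forall>U. U \<^bold>\<in> T \<^bold>\<and> x \<^bold>\<in> U \<^bold>\<longrightarrow> (\<^bold>\<exists>V. V \<^bold>\<in> B \<^bold>\<and> V \<^bold>\<subseteq> U))))"

definition maps2 :: "nat \<Rightarrow> nat \<Rightarrow> nat \<Rightarrow> nat \<Rightarrow> form" where
  "maps2 d x y r = (\<^bold>\<exists>p. is_opair p x y \<^bold>\<and> maps d p r)"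

definition is_metric :: "nat \<Rightarrow> nat \<Rightarrow> form" where
  "is_metric X d = ((\<^bold>\<exists>Q. \<^bold>\<exists>R.
        (\<^bold>\<forall>p. p \<^bold>\<in> Q \<^bold>\<longleftrightarrow> (\<^bold>\<exists>x. \<^bold>\<exists>y. x \<^bold>\<in> X \<^bold>\<and> y \<^bold>\<in> X \<^bold>\<and> is_opair p x y)) \<^bold>\<and>
        is_reals R \<^bold>\<and> fun_to d Q R) \<^bold>\<and>
     (\<^bold>\<forall>x. \<^bold>\<forall>y. \<^bold>\<forall>r. maps2 d x y r \<^bold>\<longrightarrow>
        (\<^bold>\<exists>z. real_zero z \<^bold>\<and> real_le z r \<^bold>\<and> (r \<^bold>= z \<^bold>\<longleftrightarrow> x \<^bold>= y)) \<^bold>\<and> maps2 d y x r) \<^bold>\<and>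
     (\<^bold>\<forall>x. \<^bold>\<forall>y. \<^bold>\<forall>z. \<^bold>\<forall>r. \<^bold>\<forall>s. \<^bold>\<forall>t.
        maps2 d x y r \<^bold>\<and> maps2 d y z s \<^bold>\<and> maps2 d x z t \<^bold>\<longrightarrow>
        (\<^bold>\<exists>u. real_add r s u \<^bold>\<and> real_le t u)))"

definition metrizable :: "nat \<Rightarrow> nat \<Rightarrow> form" where
  "metrizable X T = (\<^bold>\<exists>d. is_metric X d \<^bold>\<and>
     (\<^bold>\<forall>U. U \<^bold>\<in> T \<^bold>\<longleftrightarrow> U \<^bold>\<subseteq> X \<^bold>\<and>
        (\<^bold>\<forall>x. x \<^bold>\<in> U \<^bold>\<longrightarrow> (\<^bold>\<exists>e. real_positive e \<^bold>\<and>
           (\<^bold>\<forall>y. \<^bold>\<forall>r. maps2 d x y r \<^bold>\<and> real_less r e \<^bold>\<longrightarrow> y \<^bold>\<in> U)))))"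

text \<open>A family of spaces is a function \<open>S\<close> on \<open>I\<close> whose values are pairs \<open>(X, T)\<close>. The boxes
  \<open>{f \<in> P. \<forall>j\<in>J. f j \<in> V j}\<close>, with \<open>J \<subseteq> I\<close> finite and \<open>V j\<close> open in the \<open>j\<close>-th space, are the
  canonical base of the Tychonoff topology of the product \<open>P\<close>.\<close>

definition space_at :: "nat \<Rightarrow> nat \<Rightarrow> nat \<Rightarrow> nat \<Rightarrow> form" where
  "space_at S i X T = (\<^bold>\<exists>p. is_opair p X T \<^bold>\<and> maps S i p)"

definition family_of_spaces :: "(nat \<Rightarrow> nat \<Rightarrow> form) \<Rightarrow> nat \<Rightarrow> nat \<Rightarrow> form" where
  "family_of_spaces K S I = (fun_on S I \<^bold>\<and>
     (\<^bold>\<forall>i. i \<^bold>\<in> I \<^bold>\<longrightarrow> (\<^bold>\<exists>X. \<^bold>\<exists>T. space_at S i X T \<^bold>\<and> is_topology X T \<^bold>\<and> K X T)))"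

definition is_product_set :: "nat \<Rightarrow> nat \<Rightarrow> nat \<Rightarrow> form" where
  "is_product_set P S I = (\<^bold>\<forall>f. f \<^bold>\<in> P \<^bold>\<longleftrightarrow> fun_on f I \<^bold>\<and>
     (\<^bold>\<forall>i. \<^bold>\<forall>X. \<^bold>\<forall>T. \<^bold>\<forall>x. space_at S i X T \<^bold>\<and> maps f i x \<^bold>\<longrightarrow> x \<^bold>\<in> X))"

definition is_box :: "nat \<Rightarrow> nat \<Rightarrow> nat \<Rightarrow> nat \<Rightarrow> form" where
  "is_box P S I B = (\<^bold>\<exists>J. \<^bold>\<exists>V. J \<^bold>\<subseteq> I \<^bold>\<and> is_finite J \<^bold>\<and> fun_on V J \<^bold>\<and>
     (\<^bold>\<forall>j. \<^bold>\<forall>X. \<^bold>\<forall>T. \<^bold>\<forall>v. space_at S j X T \<^bold>\<and> maps V j v \<^bold>\<longrightarrow> v \<^bold>\<in> T) \<^bold>\<and>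
     (\<^bold>\<forall>f. f \<^bold>\<in> B \<^bold>\<longleftrightarrow> f \<^bold>\<in> P \<^bold>\<and>
        (\<^bold>\<forall>j. \<^bold>\<forall>v. \<^bold>\<forall>x. maps V j v \<^bold>\<and> maps f j x \<^bold>\<longrightarrow> x \<^bold>\<in> v)))"

definition is_product_space :: "nat \<Rightarrow> nat \<Rightarrow> nat \<Rightarrow> nat \<Rightarrow> form" where
  "is_product_space P TP S I = (is_product_set P S I \<^bold>\<and> is_base (is_box P S I) P TP)"


section \<open>The five sentences\<close>

definition sentence_i :: form where
  "sentence_i = (\<^bold>\<forall>X. \<^bold>\<forall>T. T3_half_space X T \<^bold>\<longrightarrow>
     stable_countable_inter (G_delta T) \<^bold>\<or> stable_countable_inter (zero_set X T))"

definition sentence_ii :: form where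
  "sentence_ii = (\<^bold>\<forall>X. \<^bold>\<forall>T. strongly_zero_dimensional X T \<^bold>\<and> T1_space X T \<^bold>\<longrightarrow>
     stable_countable_inter (CO_delta X T))"

text \<open>\<open>D\<close> is the topology of \<open>(X)\<^sub>\<delta>\<close>.\<close>

definition sentence_iii :: form where
  "sentence_iii = (\<^bold>\<forall>X. \<^bold>\<forall>T. T3_half_space X T \<^bold>\<longrightarrow>
     (\<^bold>\<forall>D. is_base (G_delta T) X D \<^bold>\<longrightarrow> P_space X D))"

definition sentence_iv :: form where
  "sentence_iv = (\<^bold>\<forall>I. \<^bold>\<forall>S. is_countable I \<^bold>\<and>
       family_of_spaces (\<lambda>X T. is_countable X \<^bold>\<and> is_compact X T \<^bold>\<and> metrizable X T) S I \<^bold>\<longrightarrow>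
     (\<^bold>\<forall>P. \<^bold>\<forall>TP. is_product_space P TP S I \<^bold>\<longrightarrow> metrizable P TP))"

definition sentence_v :: form where
  "sentence_v = (\<^bold>\<forall>I. \<^bold>\<forall>S. is_countable I \<^bold>\<and>
       family_of_spaces (\<lambda>X T. is_countable X \<^bold>\<and> is_compact X T \<^bold>\<and>
         first_countable X T \<^bold>\<and> T3_half_space X T) S I \<^bold>\<longrightarrow>
     (\<^bold>\<forall>P. \<^bold>\<forall>TP. is_product_space P TP S I \<^bold>\<longrightarrow> first_countable P TP))"

end

theory Submission
  imports Defs "HOL-Library.Countable_Set" "HOL-Computational_Algebra.Fraction_Field"
begin

text \<open>
  By the completeness theorem it suffices to argue inside an arbitrary model of ZF. There, let
  \<open>(A\<^sub>i)\<close> be a denumerable family of denumerable sets, without loss of generality disjoint, and let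
  \<open>X\<close> be the one-point compactification of the discrete space \<open>\<Union>\<^sub>i A\<^sub>i\<close>. Each \<open>X - A\<^sub>i\<close> is a zero-set
  and the intersection of countably many clopen sets, and the intersection of all of them is
  \<open>{\<infinity>}\<close>; so (i), (ii) and (iii) all make \<open>{\<infinity>}\<close> the intersection of countably many open sets
  \<open>U\<^sub>n\<close>. The sets \<open>A\<^sub>i - U\<^sub>n\<close> are finite, and for each \<open>i\<close> the first non-empty one among them is chosen.
  For (iv) and (v), a countable neighbourhood base \<open>(V\<^sub>n)\<close> at the point \<open>(\<infinity>, \<infinity>, \<dots>)\<close> of the
  product of the one-point compactifications of the \<open>A\<^sub>i\<close> yields in the same way the finite sets of
  those \<open>a \<in> A\<^sub>i\<close> that are the \<open>i\<close>-th coordinate of no point of \<open>V\<^sub>n\<close>.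
\<close>

section \<open>Completeness of the calculus\<close>

text \<open>A HOL set or function of elements of a model need not be represented in the model, and
  HOL has choice while the model may not. So every comprehension, image, recursion and induction
  inside the model has to come from a formula with parameters; the calculus of \<open>Def\<close>
  and \<open>Trm\<close> supplies these formulas. The natural numbers of a model may be nonstandard,
  so HOL's numbers cannot stand for them: arithmetic and cuts are rebuilt over its omega, and a
  field of fractions over that omega serves to settle inequalities. Choice is avoided as follows.
  The hypothesis on the spaces provides one countable set of open sets, and one enumeration of it
  orders the candidate sets for all i simultaneously. Some candidate is non-empty for each i because
  a point of A_i differs from infinity and is therefore missed by some U_n.\<close>

primrec sat :: "'a set \<Rightarrow> ('a \<Rightarrow> 'a \<Rightarrow> bool) \<Rightarrow> (nat \<Rightarrow> 'a) \<Rightarrow> fm \<Rightarrow> bool" where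
  "sat U E \<rho> (Mem x y) \<longleftrightarrow> E (\<rho> x) (\<rho> y)"
| "sat U E \<rho> (Eql x y) \<longleftrightarrow> \<rho> x = \<rho> y"
| "sat U E \<rho> Fls \<longleftrightarrow> False"
| "sat U E \<rho> (Imp p q) \<longleftrightarrow> (sat U E \<rho> p \<longrightarrow> sat U E \<rho> q)"
| "sat U E \<rho> (Forall x p) \<longleftrightarrow> (\<forall>a\<in>U. sat U E (\<rho>(x := a)) p)"

instance fm :: countable
  by countable_datatype

text \<open>Bound variables count too: a variable outside \<open>vars p\<close> can be substituted
  into \<open>p\<close> without capture, and the substitution can be undone.\<close>

primrec vars :: "fm \<Rightarrow> nat set" where
  "vars (Mem x y) = {x, y}"
| "vars (Eql x y) = {x, y}"
| "vars Fls = {}"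
| "vars (Imp p q) = vars p \<union> vars q"
| "vars (Forall x p) = insert x (vars p)"

lemma finite_vars [simp]: "finite (vars p)"
  by (induction p) auto

lemma fv_vars: "fv p \<subseteq> vars p"
  by (induction p) auto

lemma finite_fv [simp]: "finite (fv p)"
  by (rule finite_subset [OF fv_vars]) simp

lemma free_for_fresh: "y \<notin> vars p \<Longrightarrow> free_for x y p"
  by (induction p) auto

lemma subst_id: "x \<notin> vars p \<Longrightarrow> subst x y p = p"
  by (induction p) auto

text \<open>This makes renaming of a bound variable derivable: instantiating the renamed universal
  formula at the old variable returns the original body.\<close>

lemma subst_fresh_inverse: "y \<notin> vars p \<Longrightarrow> subst y x (subst x y p) = p \<and> free_for y x (subst x y p)"
proof (induction p)
  case (Forall z p)
  then have "y \<noteq> z" "y \<notin> vars p" by auto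
  moreover from this have "y \<notin> fv p" using fv_vars by blast
  ultimately show ?case
    using Forall.IH by (cases "z = x") (auto simp: subst_id)
qed auto

lemma size_subst [simp]: "size (subst x y p) = size p"
  by (induction p) auto

lemma sat_cong: "(\<And>x. x \<in> fv p \<Longrightarrow> \<rho> x = \<sigma> x) \<Longrightarrow> sat U E \<rho> p = sat U E \<sigma> p"
proof (induction p arbitrary: \<rho> \<sigma>)
  case (Forall x p)
  have "sat U E (\<rho>(x := a)) p = sat U E (\<sigma>(x := a)) p" for a
    by (rule Forall.IH) (use Forall.prems in auto)
  then show ?case by simp
next
  case (Imp p q)
  have "sat U E \<rho> p = sat U E \<sigma> p" "sat U E \<rho> q = sat U E \<sigma> q"
    by (rule Imp.IH; use Imp.prems in auto)+
  then show ?case by simp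
qed auto

lemma sat_subst: "y \<notin> vars p \<Longrightarrow> sat U E \<rho> (subst x y p) = sat U E (\<rho>(x := \<rho> y)) p"
proof (induction p arbitrary: \<rho>)
  case (Forall z p)
  then have "y \<noteq> z" "y \<notin> vars p" by auto
  show ?case
  proof (cases "z = x")
    case False
    have "(\<rho>(z := a))(x := \<rho> y) = (\<rho>(x := \<rho> y))(z := a)" for a
      using False by auto
    then have "sat U E (\<rho>(z := a)) (subst x y p) = sat U E ((\<rho>(x := \<rho> y))(z := a)) p" for a
      using Forall.IH [OF \<open>y \<notin> vars p\<close>, of "\<rho>(z := a)"] \<open>y \<noteq> z\<close> by (metis fun_upd_other)
    then show ?thesis using False by (simp del: fun_upd_apply)
  qed (simp del: fun_upd_apply)
qed auto

text \<open>Generalization is available for consequences of the theory \<open>A\<close> alone, not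
  for those of the temporary hypotheses \<open>G\<close>; this is what makes the deduction theorem
  hold without a side condition on free variables.\<close>

inductive entails :: "fm set \<Rightarrow> fm set \<Rightarrow> fm \<Rightarrow> bool" for A G where
  drv: "derivable A p \<Longrightarrow> entails A G p"
| hyp: "p \<in> G \<Longrightarrow> entails A G p"
| mp: "entails A G (Imp p q) \<Longrightarrow> entails A G p \<Longrightarrow> entails A G q"

lemma entails_mono: "entails A G p \<Longrightarrow> G \<subseteq> H \<Longrightarrow> entails A H p"
  by (induction rule: entails.induct) (auto intro: entails.intros)

lemma derivable_I: "derivable A (Imp p p)"
  by (meson derivable.distrib derivable.modus_ponens derivable.weaken)

lemma entails_deduct: "entails A (insert p G) q \<Longrightarrow> entails A G (Imp p q)"
proof (induction rule: entails.induct)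
  case (drv q)
  then show ?case by (meson derivable.modus_ponens derivable.weaken entails.drv)
next
  case (hyp q)
  then show ?case
    by (metis derivable.weaken derivable_I entails.hyp entails.mp entails.drv insertE)
next
  case (mp q r)
  then show ?case by (meson derivable.distrib entails.mp entails.drv)
qed

lemma entails_cut: "entails A (insert p G) q \<Longrightarrow> entails A G p \<Longrightarrow> entails A G q"
  by (meson entails.mp entails_deduct)

lemma entails_empty: "entails A {} p \<Longrightarrow> derivable A p"
  by (induction rule: entails.induct) (auto intro: derivable.modus_ponens)

lemma entails_compact: "entails A G p \<Longrightarrow> \<exists>H. finite H \<and> H \<subseteq> G \<and> entails A H p"
proof (induction rule: entails.induct)
  case (drv p)
  then show ?case by (meson entails.drv finite.emptyI empty_subsetI)
next
  case (hyp p)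
  then show ?case by (intro exI [of _ "{p}"]) (auto intro: entails.hyp)
next
  case (mp p q)
  then obtain H K where "finite H" "H \<subseteq> G" "entails A H (Imp p q)" "finite K" "K \<subseteq> G" "entails A K p"
    by blast
  then have "entails A (H \<union> K) (Imp p q)" "entails A (H \<union> K) p"
    by (meson Un_upper1 Un_upper2 entails_mono)+
  then have "entails A (H \<union> K) q" by (rule entails.mp)
  then show ?case
    using \<open>finite H\<close> \<open>finite K\<close> \<open>H \<subseteq> G\<close> \<open>K \<subseteq> G\<close> by (meson Un_least finite_UnI)
qed

text \<open>The finitely many hypotheses are discharged one at a time by the deduction theorem, and
  \<open>all_imp\<close> moves the quantifier past each of them.\<close>

lemma entails_generalize:
  assumes "finite G" "entails A G p" "\<And>q. q \<in> G \<Longrightarrow> x \<notin> fv q"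
  shows "entails A G (Forall x p)"
  using assms
proof (induction G arbitrary: p rule: finite_induct)
  case empty
  then show ?case by (meson derivable.generalization entails.drv entails_empty)
next
  case (insert g G)
  then have "entails A G (Forall x (Imp g p))" by (simp add: entails_deduct)
  then have "entails A G (Imp g (Forall x p))"
    using insert.prems by (meson derivable.all_imp entails.mp entails.drv insertI1)
  then show ?case by (meson entails.hyp entails.mp entails_mono insertI1 subset_insertI)
qed

lemma entails_dn: "entails A G (Neg (Neg p)) \<Longrightarrow> entails A G p"
  by (meson derivable.double_neg entails.mp entails.drv)

lemma entails_contr: "entails A (insert (Neg p) G) Fls \<Longrightarrow> entails A G p"
  by (metis Neg_def entails_dn entails_deduct)

definition cons :: "fm set \<Rightarrow> fm set \<Rightarrow> bool" where
  "cons A G \<longleftrightarrow> \<not> entails A G Fls"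

text \<open>Free variables serve as Henkin constants. If the negated instance were refutable, the
  instance at the fresh \<open>y\<close> would follow, could be generalized over \<open>y\<close>,
  and could be renamed to the universal formula whose negation is assumed.\<close>

lemma cons_witness:
  assumes "finite G" "cons A (insert (Neg (Forall x p)) G)" "y \<notin> vars p"
    "\<And>q. q \<in> G \<Longrightarrow> y \<notin> vars q" "y \<noteq> x"
  shows "cons A (insert (Neg (subst x y p)) (insert (Neg (Forall x p)) G))"
proof (rule ccontr)
  let ?H = "insert (Neg (Forall x p)) G"
  assume "\<not> ?thesis"
  then have "entails A ?H (subst x y p)"
    unfolding cons_def by (simp add: entails_contr)
  then have "entails A ?H (Forall y (subst x y p))"
    by (rule entails_generalize [rotated])
      (use assms fv_vars in \<open>auto simp: Neg_def subset_iff\<close>)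
  moreover have "derivable A (Imp (Forall y (subst x y p)) p)"
    using derivable.inst [of y x "subst x y p"] subst_fresh_inverse [OF assms(3)] by metis
  ultimately have 1: "entails A ?H p"
    by (meson entails.mp entails.drv)
  have xG: "entails A ?H (Forall x p)"
  proof -
    have "derivable A (Imp (Forall y (subst x y p)) (Forall x p))"
    proof -
      have "derivable A (Forall x (Imp (Forall y (subst x y p)) p))"
        by (rule derivable.generalization) fact
      moreover have "x \<notin> fv (Forall y (subst x y p))"
      proof -
        have "x \<noteq> y \<Longrightarrow> x \<notin> fv (subst x y q)" for q by (induction q) auto
        then show ?thesis using assms(5) by auto
      qed
      ultimately show ?thesis by (meson derivable.all_imp derivable.modus_ponens)
    qed
    with \<open>entails A ?H (Forall y (subst x y p))\<close> show ?thesis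
      by (meson entails.mp entails.drv)
  qed
  moreover have "entails A ?H (Imp (Forall x p) Fls)"
    using entails.hyp [of "Neg (Forall x p)" ?H A] by (simp add: Neg_def)
  ultimately have "entails A ?H Fls" by (rule entails.mp [rotated])
  then show False using assms(2) by (simp add: cons_def)
qed

section \<open>Henkin extension of one consistent formula\<close>

definition fresh :: "fm set \<Rightarrow> nat" where
  "fresh G = (SOME y. \<forall>q\<in>G. y \<notin> vars q)"

lemma fresh: "finite G \<Longrightarrow> q \<in> G \<Longrightarrow> fresh G \<notin> vars q"
proof -
  assume "finite G" "q \<in> G"
  then have "finite (\<Union> (vars ` G))" by simp
  then obtain y where "y \<notin> \<Union> (vars ` G)"
    using ex_new_if_finite infinite_UNIV_nat by blast
  then have "\<forall>q\<in>G. y \<notin> vars q" by blast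
  then have "\<forall>q\<in>G. fresh G \<notin> vars q"
    unfolding fresh_def by (rule someI)
  then show ?thesis using \<open>q \<in> G\<close> by blast
qed

definition witness :: "fm set \<Rightarrow> fm \<Rightarrow> fm set" where
  "witness G q = (if \<exists>x p. q = Neg (Forall x p)
     then {Neg (subst x (fresh (insert q G)) p) | x p. q = Neg (Forall x p)} else {})"

text \<open>The witness is added at the very stage that admits a negated universal formula, while
  the set is still finite and a fresh variable is sure to exist.\<close>

definition step :: "fm set \<Rightarrow> fm set \<Rightarrow> fm \<Rightarrow> fm set" where
  "step A G q = (if cons A (insert q G) then insert q G \<union> witness G q else G)"

primrec stage :: "fm set \<Rightarrow> fm \<Rightarrow> nat \<Rightarrow> fm set" where
  "stage A q 0 = {q}"
| "stage A q (Suc n) = step A (stage A q n) (from_nat n)"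

lemma witness_eq: "witness G (Neg (Forall x p)) = {Neg (subst x (fresh (insert (Neg (Forall x p)) G)) p)}"
  unfolding witness_def by (auto simp: Neg_def)

lemma finite_witness: "finite (witness G q)"
proof (cases "\<exists>x p. q = Neg (Forall x p)")
  case True
  then show ?thesis by (auto simp: witness_eq)
qed (simp add: witness_def)

lemma finite_stage: "finite (stage A q n)"
  by (induction n) (auto simp: step_def finite_witness)

lemma cons_step:
  assumes "finite G" "cons A G" shows "cons A (step A G q)"
proof (cases "cons A (insert q G)")
  case True
  show ?thesis
  proof (cases "\<exists>x p. q = Neg (Forall x p)")
    case T: True
    then obtain x p where q: "q = Neg (Forall x p)" by blast
    let ?y = "fresh (insert q G)"
    have "?y \<notin> vars q" "\<And>r. r \<in> G \<Longrightarrow> ?y \<notin> vars r"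
      using fresh [of "insert q G"] assms by auto
    then have "cons A (insert (Neg (subst x ?y p)) (insert q G))"
      unfolding q by (intro cons_witness) (use True assms q in \<open>auto simp: Neg_def\<close>)
    then show ?thesis using True by (simp add: step_def q witness_eq)
  next
    case False
    then have "witness G q = {}" by (simp add: witness_def)
    then show ?thesis using True by (simp add: step_def)
  qed
next
  case False
  then show ?thesis using assms by (simp add: step_def)
qed

lemma cons_stage: "cons A {q} \<Longrightarrow> cons A (stage A q n)"
  by (induction n) (auto intro: cons_step finite_stage)

lemma stage_mono: "m \<le> n \<Longrightarrow> stage A q m \<subseteq> stage A q n"
  by (rule lift_Suc_mono_le) (auto simp: step_def)

definition complete :: "fm set \<Rightarrow> fm \<Rightarrow> fm set" where
  "complete A q = (\<Union>n. stage A q n)"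

context
  fixes A :: "fm set" and q :: fm and G
  assumes q: "cons A {q}"
  defines "G \<equiv> complete A q"
begin

lemma cons_complete: "cons A G"
proof (rule ccontr)
  assume "\<not> cons A G"
  then have "entails A G Fls" by (simp add: cons_def)
  from entails_compact [OF this] obtain H where H: "finite H" "H \<subseteq> G" "entails A H Fls"
    by (elim exE conjE)
  have "\<exists>n. H \<subseteq> stage A q n"
    using H(1,2)
  proof (induction H rule: finite_induct)
    case (insert p H)
    then obtain m n where "H \<subseteq> stage A q m" "p \<in> stage A q n"
      unfolding G_def complete_def by auto
    then have "insert p H \<subseteq> stage A q (max m n)"
      using stage_mono [of m "max m n" A q] stage_mono [of n "max m n" A q] by auto
    then show ?case by blast
  qed simp
  then obtain n where "H \<subseteq> stage A q n" ..
  then have "entails A (stage A q n) Fls" by (rule entails_mono [OF H(3)])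
  then show False using cons_stage [OF q] by (simp add: cons_def)
qed

lemma stage_complete: "stage A q n \<subseteq> G"
  unfolding G_def complete_def by (rule UN_upper) simp

lemma complete_mem: "p \<in> G \<longleftrightarrow> cons A (insert p G)"
proof
  assume "p \<in> G"
  then show "cons A (insert p G)" using cons_complete by (simp add: insert_absorb)
next
  assume p: "cons A (insert p G)"
  have "cons A (insert p (stage A q (to_nat p)))"
    using p entails_mono [OF _ insert_mono [OF stage_complete]] unfolding cons_def by blast
  then have "p \<in> stage A q (Suc (to_nat p))" by (simp add: step_def)
  then show "p \<in> G" using stage_complete by (rule subsetD [rotated])
qed

lemma complete_closed: "entails A G p \<longleftrightarrow> p \<in> G"
proof
  assume "entails A G p"
  then show "p \<in> G"
    using complete_mem [of p] cons_complete entails_cut [of A p G Fls] unfolding cons_def by blast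
qed (rule entails.hyp)

lemma complete_Fls: "Fls \<notin> G"
  using complete_closed cons_complete cons_def by blast

lemma complete_Neg: "Neg p \<in> G \<longleftrightarrow> p \<notin> G"
proof
  assume "Neg p \<in> G"
  then show "p \<notin> G" using complete_Fls complete_closed
    by (metis Neg_def entails.hyp entails.mp)
next
  assume "p \<notin> G"
  then have "entails A (insert p G) Fls" using complete_mem cons_def by blast
  then show "Neg p \<in> G" unfolding Neg_def by (simp add: entails_deduct complete_closed [symmetric])
qed

lemma complete_Imp: "Imp p r \<in> G \<longleftrightarrow> (p \<in> G \<longrightarrow> r \<in> G)"
proof
  assume "Imp p r \<in> G"
  then show "p \<in> G \<longrightarrow> r \<in> G" using complete_closed entails.mp by blast
next
  assume *: "p \<in> G \<longrightarrow> r \<in> G"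
  show "Imp p r \<in> G"
  proof (cases "r \<in> G")
    case True
    then show ?thesis
      by (meson complete_closed derivable.weaken entails.mp entails.drv)
  next
    case False
    then have "Neg p \<in> G" using * complete_Neg by blast
    have "entails A (insert p G) Fls"
      using \<open>Neg p \<in> G\<close> unfolding Neg_def
      by (meson entails.hyp entails.mp insertCI)
    then have "entails A (insert p G) r"
      by (meson entails_contr entails_mono subset_insertI)
    then show ?thesis using complete_closed entails_deduct by blast
  qed
qed

lemma complete_derivable: "derivable A p \<Longrightarrow> p \<in> G"
  using complete_closed entails.drv by blast

lemma complete_witness:
  assumes "Forall x p \<notin> G"
  obtains y where "y \<notin> vars (Forall x p)" "subst x y p \<notin> G"
proof -
  let ?r = "Neg (Forall x p)"
  let ?S = "stage A q (to_nat ?r)"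
  have "?r \<in> G" using assms complete_Neg by blast
  then have "cons A (insert ?r G)" by (simp add: complete_mem [symmetric])
  then have "cons A (insert ?r ?S)"
    using entails_mono [OF _ insert_mono [OF stage_complete]] unfolding cons_def by blast
  then have "witness ?S ?r \<subseteq> stage A q (Suc (to_nat ?r))" by (auto simp: step_def)
  then have "witness ?S ?r \<subseteq> G" using stage_complete by (rule subset_trans)
  then have "Neg (subst x (fresh (insert ?r ?S)) p) \<in> G" by (simp add: witness_eq)
  moreover have "fresh (insert ?r ?S) \<notin> vars ?r"
    by (rule fresh) (auto simp: finite_stage)
  ultimately show thesis using that complete_Neg by (auto simp: Neg_def)
qed

section \<open>The model of variables modulo provable equality\<close>

definition eqv :: "nat \<Rightarrow> nat set" where
  "eqv x = {y. Eql x y \<in> G}"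

lemma Eql_refl: "Eql x x \<in> G"
  by (simp add: complete_derivable derivable.eq_refl)

lemma Eql_eucl: "Eql x y \<in> G \<Longrightarrow> Eql x z \<in> G \<Longrightarrow> Eql y z \<in> G"
  using complete_derivable [OF derivable.eq_eq] complete_Imp by blast

lemma eqv_eq: "eqv x = eqv y \<longleftrightarrow> Eql x y \<in> G"
  unfolding eqv_def using Eql_refl Eql_eucl by blast

lemma Mem_cong: "eqv x = eqv x' \<Longrightarrow> eqv y = eqv y' \<Longrightarrow> Mem x y \<in> G \<longleftrightarrow> Mem x' y' \<in> G"
proof -
  have "Mem x' y' \<in> G" if "Eql x x' \<in> G" "Eql y y' \<in> G" "Mem x y \<in> G" for x x' y y'
    using that complete_derivable [OF derivable.eq_mem_left, of x x' y]
      complete_derivable [OF derivable.eq_mem_right, of y y' x']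
    by (simp add: complete_Imp)
  then show "eqv x = eqv x' \<Longrightarrow> eqv y = eqv y' \<Longrightarrow> ?thesis"
    by (metis eqv_eq)
qed

text \<open>The class of \<open>y\<close> contains variables foreign to \<open>p\<close>: take the Henkin witness of
  \<open>\<exists>z. (p \<longrightarrow> p) \<and> z = y\<close>.\<close>

lemma eqv_fresh:
  obtains y' where "y' \<notin> vars p" "eqv y' = eqv y"
proof -
  obtain z where z: "z \<notin> insert y (vars p)"
    using ex_new_if_finite [of "insert y (vars p)"] infinite_UNIV_nat by auto
  \<comment> \<open>The factor \<open>Imp p p\<close> only puts the variables of \<open>p\<close>
    into the formula, so that the Henkin witness has to avoid them.\<close>
  let ?r = "Imp (Imp p p) (Neg (Eql z y))"
  have "Forall z ?r \<notin> G"
  proof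
    assume "Forall z ?r \<in> G"
    moreover have "free_for z y ?r" using z
    proof -
      have "z \<notin> vars r \<Longrightarrow> free_for z y r" for r
        by (induction r) (use fv_vars in auto)
      then show ?thesis using z by (auto simp: Neg_def)
    qed
    then have "Imp (Forall z ?r) (subst z y ?r) \<in> G"
      by (intro complete_derivable derivable.inst)
    ultimately have "Imp (Imp p p) (Neg (Eql y y)) \<in> G"
      using complete_Imp z subst_id [of z p y] by (simp add: Neg_def)
    then show False using complete_Imp complete_Neg Eql_refl by blast
  qed
  then obtain y' where y': "y' \<notin> vars (Forall z ?r)" "subst z y' ?r \<notin> G"
    by (rule complete_witness)
  then have "Imp (Imp p p) (Neg (Eql y' y)) \<notin> G"
    using z subst_id [of z p y'] by (simp add: Neg_def)
  then have "Eql y' y \<in> G" using complete_Imp complete_Neg by blast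
  then show thesis using that y' eqv_eq by auto
qed

definition term_mem :: "nat set \<Rightarrow> nat set \<Rightarrow> bool" where
  "term_mem a b \<longleftrightarrow> (\<exists>x y. a = eqv x \<and> b = eqv y \<and> Mem x y \<in> G)"

text \<open>Induction is on the size because the universal case passes to
  \<open>subst x y r\<close>, which is not a subformula but has the size of
  \<open>r\<close>.\<close>

lemma truth: "sat (range eqv) term_mem eqv p \<longleftrightarrow> p \<in> G"
proof (induction "size p" arbitrary: p rule: less_induct)
  case less
  show ?case
  proof (cases p)
    case (Mem x y)
    have "term_mem (eqv x) (eqv y) \<longleftrightarrow> Mem x y \<in> G"
      unfolding term_mem_def by (blast dest: Mem_cong)
    with Mem show ?thesis by simp
  next
    case (Eql x y)
    then show ?thesis by (simp add: eqv_eq)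
  next
    case Fls
    then show ?thesis by (simp add: complete_Fls)
  next
    case (Imp p1 p2)
    then show ?thesis using less [of p1] less [of p2] by (simp add: complete_Imp)
  next
    case (Forall x r)
    have sub: "sat (range eqv) term_mem (eqv(x := eqv y)) r \<longleftrightarrow> subst x y r \<in> G"
      if "y \<notin> vars r" for y
      using sat_subst [OF that, of _ _ eqv x] less [of "subst x y r"] Forall by simp
    show ?thesis
    proof
      assume "sat (range eqv) term_mem eqv p"
      then show "p \<in> G"
        using sub Forall complete_witness [of x r] by (metis UnCI insert_iff rangeI sat.simps(5) vars.simps(5))
    next
      assume p: "p \<in> G"
      \<comment> \<open>Instantiation must not capture, so the class of \<open>y\<close> is first
        given a representative foreign to \<open>r\<close>.\<close>
      have "sat (range eqv) term_mem (eqv(x := eqv y)) r" for y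
      proof -
        obtain y' where y': "y' \<notin> vars r" "eqv y' = eqv y" by (rule eqv_fresh)
        have "Imp p (subst x y' r) \<in> G"
          unfolding Forall by (intro complete_derivable derivable.inst free_for_fresh y')
        then show ?thesis using p sub [OF y'(1)] y'(2) complete_Imp by auto
      qed
      then show "sat (range eqv) term_mem eqv p" using Forall by auto
    qed
  qed
qed

text \<open>Truth of an axiom under the environment \<open>eqv\<close> alone is not enough, since
  its free variables stand for arbitrary elements. Generalization makes its universal closure
  derivable, and stripping the quantifiers again gives truth under every environment.\<close>

lemma model_of_theory:
  assumes "p \<in> A" "range \<rho> \<subseteq> range eqv"
  shows "sat (range eqv) term_mem \<rho> p"
proof -
  define close where "close xs = foldr Forall xs p" for xs
  have "derivable A (close xs)" for xs
    by (induction xs) (auto simp: close_def intro: derivable.ax derivable.generalization assms)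
  then have "sat (range eqv) term_mem eqv (close xs)" for xs
    by (simp add: truth complete_derivable)
  then have eqv: "sat (range eqv) term_mem (eqv) (close xs)" for xs .
  have "sat (range eqv) term_mem \<sigma> (close xs) \<Longrightarrow>
      sat (range eqv) term_mem (\<lambda>x. if x \<in> set xs then \<rho> x else \<sigma> x) p" for xs \<sigma>
  proof (induction xs arbitrary: \<sigma>)
    case (Cons x xs)
    have "\<rho> x \<in> range eqv" using assms(2) by auto
    then have "sat (range eqv) term_mem (\<sigma>(x := \<rho> x)) (close xs)"
      using Cons.prems by (auto simp: close_def)
    from Cons.IH [OF this] show ?case
      by (rule iffD1 [OF sat_cong, rotated]) auto
  qed (simp add: close_def)
  from this [OF eqv] obtain xs where "set xs = fv p"
      "sat (range eqv) term_mem (\<lambda>x. if x \<in> set xs then \<rho> x else eqv x) p"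
    using finite_list [OF finite_fv] by metis
  then show ?thesis
    by (simp cong: sat_cong)
qed

end

text \<open>Countability is recorded so that the model can be carried over to the type
  \<open>nat\<close> at the end.\<close>

theorem model_existence:
  assumes "\<not> derivable A p"
  obtains U :: "nat set set" and E \<rho> where
    "countable U" "\<And>q \<sigma>. q \<in> A \<Longrightarrow> range \<sigma> \<subseteq> U \<Longrightarrow> sat U E \<sigma> q"
    "range \<rho> \<subseteq> U" "\<not> sat U E \<rho> p"
proof -
  have c: "cons A {Neg p}"
    using assms entails_contr entails_empty unfolding cons_def by blast
  have "Neg p \<in> complete A (Neg p)"
    unfolding complete_def by (rule UN_I [of 0]) auto
  then have "\<not> sat (range (eqv A (Neg p))) (term_mem A (Neg p)) (eqv A (Neg p)) p"
    using truth [OF c] complete_Neg [OF c] by blast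
  then show thesis
    by (intro that [of "range (eqv A (Neg p))" "term_mem A (Neg p)" "eqv A (Neg p)"])
      (auto intro: model_of_theory [OF c])
qed

section \<open>Definability inside a model of ZF\<close>

named_theorems dfn

text \<open>The universe is a whole type, so that quantifiers of the object language become
  unrestricted quantifiers of HOL.\<close>

locale zf =
  fixes E :: "'a \<Rightarrow> 'a \<Rightarrow> bool" (infix "\<epsilon>" 50)
  assumes model: "q \<in> ZF \<Longrightarrow> sat UNIV E \<rho> q"
begin

abbreviation sem :: "(nat \<Rightarrow> 'a) \<Rightarrow> fm \<Rightarrow> bool" where
  "sem \<equiv> sat UNIV E"

definition extend :: "'a \<Rightarrow> (nat \<Rightarrow> 'a) \<Rightarrow> nat \<Rightarrow> 'a" where
  "extend a \<rho> n = (case n of 0 \<Rightarrow> a | Suc m \<Rightarrow> \<rho> m)"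

definition interleave :: "(nat \<Rightarrow> 'a) \<Rightarrow> (nat \<Rightarrow> 'a) \<Rightarrow> nat \<Rightarrow> 'a" where
  "interleave \<rho> \<sigma> n = (if even n then \<rho> (n div 2) else \<sigma> (n div 2))"

text \<open>\<open>Def P\<close>: the predicate \<open>P\<close> on environments is definable by a formula whose even-numbered
  variables are the environment and whose odd-numbered variables hold parameters \<open>\<sigma>\<close>.
  \<open>Trm t\<close>: the operation \<open>t\<close> has a definable graph. Under a binder, the bound variable is
  \<open>\<rho> 0\<close> and the outer environment is shifted by one.\<close>

definition Def :: "((nat \<Rightarrow> 'a) \<Rightarrow> bool) \<Rightarrow> bool" where
  "Def P \<longleftrightarrow> (\<exists>p \<sigma>. \<forall>\<rho>. P \<rho> = sem (interleave \<rho> \<sigma>) p)"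

definition Trm :: "((nat \<Rightarrow> 'a) \<Rightarrow> 'a) \<Rightarrow> bool" where
  "Trm t \<longleftrightarrow> Def (\<lambda>\<rho>. \<rho> 0 = t (\<lambda>n. \<rho> (Suc n)))"

end

text \<open>Bound variables are renamed along with the free ones, so an injective renaming causes no
  capture.\<close>

primrec rename :: "(nat \<Rightarrow> nat) \<Rightarrow> fm \<Rightarrow> fm" where
  "rename f (Mem x y) = Mem (f x) (f y)"
| "rename f (Eql x y) = Eql (f x) (f y)"
| "rename f Fls = Fls"
| "rename f (Imp p q) = Imp (rename f p) (rename f q)"
| "rename f (Forall x p) = Forall (f x) (rename f p)"

lemma sat_rename: "inj f \<Longrightarrow> sat U E \<rho> (rename f p) = sat U E (\<lambda>n. \<rho> (f n)) p"
proof (induction p arbitrary: \<rho>)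
  case (Forall x p)
  have "(\<lambda>n. (\<rho>(f x := a)) (f n)) = (\<lambda>n. \<rho> (f n))(x := a)" for a
    using Forall.prems by (auto simp: fun_eq_iff inj_eq)
  then show ?case using Forall by (simp del: fun_upd_apply)
qed auto

lemma sat_connectives [simp]:
  "sat U E \<rho> (Neg p) \<longleftrightarrow> \<not> sat U E \<rho> p"
  "sat U E \<rho> (Conj p q) \<longleftrightarrow> sat U E \<rho> p \<and> sat U E \<rho> q"
  "sat U E \<rho> (Disj p q) \<longleftrightarrow> sat U E \<rho> p \<or> sat U E \<rho> q"
  "sat U E \<rho> (Iff p q) \<longleftrightarrow> (sat U E \<rho> p \<longleftrightarrow> sat U E \<rho> q)"
  "sat U E \<rho> (Exists x p) \<longleftrightarrow> (\<exists>a\<in>U. sat U E (\<rho>(x := a)) p)"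
  by (auto simp: Neg_def Conj_def Disj_def Iff_def Exists_def)

context zf
begin

lemma interleave_simps [simp]:
  "interleave \<rho> \<sigma> (2 * n) = \<rho> n" "interleave \<rho> \<sigma> (Suc (2 * n)) = \<sigma> n"
  by (simp_all add: interleave_def)

lemma Def_rename:
  assumes "Def P" "inj f" shows "Def (\<lambda>\<rho>. P (\<lambda>n. \<rho> (f n)))"
proof -
  obtain p \<sigma> where P: "\<And>\<rho>. P \<rho> = sem (interleave \<rho> \<sigma>) p" using assms unfolding Def_def by blast
  \<comment> \<open>Environment entries sit at even variables and are moved by \<open>f\<close>; the
    parameters at odd variables stay.\<close>
  define g where "g n = (if even n then 2 * f (n div 2) else n)" for n
  have "inj g"
    using assms(2) unfolding g_def inj_def
    by (metis dvd_triv_left even_two_times_div_two mult_left_cancel zero_neq_numeral)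
  have "interleave (\<lambda>n. \<rho> (f n)) \<sigma> = (\<lambda>n. interleave \<rho> \<sigma> (g n))" for \<rho>
    by (auto simp: g_def interleave_def)
  then have "P (\<lambda>n. \<rho> (f n)) = sem (interleave \<rho> \<sigma>) (rename g p)" for \<rho>
    by (simp add: P sat_rename [OF \<open>inj g\<close>])
  then show ?thesis unfolding Def_def by blast
qed

lemma Def_const [dfn]: "Def (\<lambda>\<rho>. c)"
proof (cases c)
  case True
  then show ?thesis unfolding Def_def by (intro exI [of _ "Imp Fls Fls"]) simp
next
  case False
  then show ?thesis unfolding Def_def by (intro exI [of _ Fls]) simp
qed

lemma Def_imp [dfn]:
  assumes "Def P" "Def Q" shows "Def (\<lambda>\<rho>. P \<rho> \<longrightarrow> Q \<rho>)"
proof -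
  obtain p \<sigma> q \<tau> where P: "\<And>\<rho>. P \<rho> = sem (interleave \<rho> \<sigma>) p"
    and Q: "\<And>\<rho>. Q \<rho> = sem (interleave \<rho> \<tau>) q"
    using assms unfolding Def_def by blast
  \<comment> \<open>Each formula brings its own parameters. The odd variable \<open>2k+1\<close>
    goes to \<open>4k+1\<close> under \<open>f\<close> and to \<open>4k+3\<close> under
    \<open>g\<close>, where \<open>interleave \<sigma> \<tau>\<close> keeps the two lists
    apart.\<close>
  define f g :: "nat \<Rightarrow> nat"
    where "f n = (if even n then n else 2 * n - 1)" and "g n = (if even n then n else 2 * n + 1)" for n
  have inj: "inj f" "inj g"
    unfolding f_def g_def inj_def by (presburger)+
  have "interleave \<rho> (interleave \<sigma> \<tau>) (f n) = interleave \<rho> \<sigma> n"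
    "interleave \<rho> (interleave \<sigma> \<tau>) (g n) = interleave \<rho> \<tau> n" for \<rho> n
  proof -
    have "f (2 * k) = 2 * k" "g (2 * k) = 2 * k" "f (Suc (2 * k)) = Suc (2 * (2 * k))"
      "g (Suc (2 * k)) = Suc (2 * Suc (2 * k))" for k
      by (simp_all add: f_def g_def)
    moreover have "n = 2 * (n div 2) \<or> n = Suc (2 * (n div 2))" by presburger
    ultimately show "interleave \<rho> (interleave \<sigma> \<tau>) (f n) = interleave \<rho> \<sigma> n"
      "interleave \<rho> (interleave \<sigma> \<tau>) (g n) = interleave \<rho> \<tau> n"
      by (metis interleave_simps)+
  qed
  then have "P \<rho> = sem (interleave \<rho> (interleave \<sigma> \<tau>)) (rename f p)"
    "Q \<rho> = sem (interleave \<rho> (interleave \<sigma> \<tau>)) (rename g q)" for \<rho>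
    by (simp_all add: P Q sat_rename inj)
  then show ?thesis
    unfolding Def_def by (intro exI [of _ "Imp (rename f p) (rename g q)"]) auto
qed

lemma Def_all [dfn]:
  assumes "Def (\<lambda>\<rho>. P (\<lambda>n. \<rho> (Suc n)) (\<rho> 0))" shows "Def (\<lambda>\<rho>. \<forall>x. P \<rho> x)"
proof -
  obtain p \<sigma> where "\<And>\<rho>. P (\<lambda>n. \<rho> (Suc n)) (\<rho> 0) = sem (interleave \<rho> \<sigma>) p"
    using assms unfolding Def_def by blast
  from this [of "extend _ _"]
  have P: "P \<rho> x = sem (interleave (extend x \<rho>) \<sigma>) p" for \<rho> x by (simp add: extend_def)
  \<comment> \<open>Variable 1 is cleared for the bound variable: the parameters move up by one odd
    place, with a dummy \<open>c\<close> in the gap, and the outer environment moves down by one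
    even place.\<close>
  define f :: "nat \<Rightarrow> nat" where "f n = (if n = 0 then 1 else if even n then n - 2 else n + 2)" for n
  have inj: "inj f" unfolding f_def inj_def by presburger
  have "((interleave \<rho> (extend c \<sigma>))(1 := x)) (f n) = interleave (extend x \<rho>) \<sigma> n" for \<rho> x n and c :: 'a
    by (cases n) (auto simp: f_def interleave_def extend_def elim!: evenE oddE split: nat.splits)
  then have "P \<rho> x = sem ((interleave \<rho> (extend c \<sigma>))(1 := x)) (rename f p)" for \<rho> x c
    by (simp add: P sat_rename inj)
  then have "(\<forall>x. P \<rho> x) = sem (interleave \<rho> (extend undefined \<sigma>)) (Forall 1 (rename f p))" for \<rho>
    by (simp del: fun_upd_apply)
  then show ?thesis unfolding Def_def by blast
qed

lemma Trm_const [dfn]: "Trm (\<lambda>\<rho>. c)"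
  unfolding Trm_def Def_def by (intro exI [of _ "Eql 0 1"] exI [of _ "\<lambda>_. c"]) (simp add: interleave_def)

lemma Trm_var [dfn]: "Trm (\<lambda>\<rho>. \<rho> i)"
  unfolding Trm_def Def_def by (intro exI [of _ "Eql 0 (2 * Suc i)"]) (simp add: interleave_def)

lemma Def_not [dfn]: "Def P \<Longrightarrow> Def (\<lambda>\<rho>. \<not> P \<rho>)"
  using Def_imp [of P "\<lambda>_. False"] Def_const by simp

lemma Def_or [dfn]: "Def P \<Longrightarrow> Def Q \<Longrightarrow> Def (\<lambda>\<rho>. P \<rho> \<or> Q \<rho>)"
  using Def_imp [OF Def_not, of P Q] by (simp add: disj_imp)

lemma Def_and [dfn]: "Def P \<Longrightarrow> Def Q \<Longrightarrow> Def (\<lambda>\<rho>. P \<rho> \<and> Q \<rho>)"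
  using Def_not [OF Def_imp [OF _ Def_not], of P Q] by simp

lemma Def_iff [dfn]: "Def P \<Longrightarrow> Def Q \<Longrightarrow> Def (\<lambda>\<rho>. P \<rho> = Q \<rho>)"
  using Def_and [OF Def_imp Def_imp, of P Q Q P] by (simp add: iff_conv_conj_imp)

lemma Def_ex [dfn]:
  assumes "Def (\<lambda>\<rho>. P (\<lambda>n. \<rho> (Suc n)) (\<rho> 0))" shows "Def (\<lambda>\<rho>. \<exists>x. P \<rho> x)"
  using Def_not [OF Def_all, of "\<lambda>\<rho> x. \<not> P \<rho> x"] assms by (simp add: Def_not)

lemma Def_shift: "Def P \<Longrightarrow> Def (\<lambda>\<rho>. P (\<lambda>n. \<rho> (Suc n)))"
  by (rule Def_rename) auto

lemma Trm_shift:
  assumes "Trm t" shows "Trm (\<lambda>\<rho>. t (\<lambda>n. \<rho> (Suc n)))"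
proof -
  have "inj (\<lambda>n. if n = 0 then 0 else Suc n)" by (auto simp: inj_def)
  from Def_rename [OF assms [unfolded Trm_def] this] show ?thesis by (simp add: Trm_def)
qed

lemma Trm_graph: "Trm t \<Longrightarrow> Def (\<lambda>\<rho>. \<rho> 0 = t (\<lambda>n. \<rho> (Suc n)))"
  by (simp add: Trm_def)

lemma Def_mem [dfn]: "Trm t \<Longrightarrow> Trm u \<Longrightarrow> Def (\<lambda>\<rho>. t \<rho> \<epsilon> u \<rho>)"
proof -
  assume t: "Trm t" and u: "Trm u"
  have "Def (\<lambda>\<rho>. \<rho> 1 \<epsilon> \<rho> 0)"
    unfolding Def_def by (intro exI [of _ "Mem 2 0"]) (simp add: interleave_def)
  then have "Def (\<lambda>\<rho>. \<exists>x. x = t \<rho> \<and> (\<exists>y. y = u \<rho> \<and> x \<epsilon> y))"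
    by (intro Def_ex Def_and Trm_graph [OF t] Trm_graph [OF Trm_shift [OF u]]) (simp add: numeral_2_eq_2)
  then show ?thesis by simp
qed

lemma Def_eq [dfn]: "Trm t \<Longrightarrow> Trm u \<Longrightarrow> Def (\<lambda>\<rho>. t \<rho> = u \<rho>)"
proof -
  assume t: "Trm t" and u: "Trm u"
  have "Def (\<lambda>\<rho>. \<rho> 1 = \<rho> 0)"
    unfolding Def_def by (intro exI [of _ "Eql 2 0"]) (simp add: interleave_def)
  then have "Def (\<lambda>\<rho>. \<exists>x. x = t \<rho> \<and> (\<exists>y. y = u \<rho> \<and> x = y))"
    by (intro Def_ex Def_and Trm_graph [OF t] Trm_graph [OF Trm_shift [OF u]]) (simp add: numeral_2_eq_2)
  then show ?thesis by simp
qed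

text \<open>Definable operations may be put in place of the variables of a formula. The composition
  rules below follow, and thanks to them each notion has to be analysed on variables only.\<close>

lemma Def_sem: "(\<And>i. Trm (s i)) \<Longrightarrow> Def (\<lambda>\<rho>. sem (\<lambda>i. s i \<rho>) p)"
proof (induction p arbitrary: s)
  case (Forall x p)
  have "Trm ((\<lambda>i \<rho>. if i = x then \<rho> 0 else s i (\<lambda>n. \<rho> (Suc n))) i)" for i
    using Trm_var [of 0] Trm_shift [OF Forall.prems] by (cases "i = x") auto
  from Forall.IH [OF this] have "Def (\<lambda>\<rho>. \<forall>a. sem (\<lambda>i. if i = x then a else s i \<rho>) p)"
    by (rule Def_all)
  moreover have "(\<lambda>i. if i = x then a else s i \<rho>) = (\<lambda>i. s i \<rho>)(x := a)" for a \<rho> by auto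
  ultimately show ?case by (simp del: fun_upd_apply)
qed (simp_all add: dfn)

lemma Def_comp:
  assumes "Def P" "\<And>i. Trm (s i)" shows "Def (\<lambda>\<rho>. P (\<lambda>i. s i \<rho>))"
proof -
  obtain p \<sigma> where P: "\<And>\<rho>. P \<rho> = sem (interleave \<rho> \<sigma>) p" using assms unfolding Def_def by blast
  have "Trm ((\<lambda>i. if even i then s (i div 2) else (\<lambda>_. \<sigma> (i div 2))) i)" for i
    using assms(2) Trm_const by auto
  from Def_sem [where s = "\<lambda>i. if even i then s (i div 2) else (\<lambda>_. \<sigma> (i div 2))" and p = p, OF this] show ?thesis
    by (simp add: P interleave_def [abs_def] if_distrib [where f = "\<lambda>f. f _"] cong: if_cong)
qed

lemma Trm_comp:
  assumes "Trm t" "\<And>i. Trm (s i)" shows "Trm (\<lambda>\<rho>. t (\<lambda>i. s i \<rho>))"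
proof -
  let ?s = "\<lambda>i \<rho>. case i of 0 \<Rightarrow> \<rho> 0 | Suc j \<Rightarrow> s j (\<lambda>n. \<rho> (Suc n))"
  have "Trm (?s i)" for i
    using Trm_var [of 0] Trm_shift [OF assms(2)] by (cases i) auto
  from Def_comp [where s = ?s, OF assms(1) [unfolded Trm_def] this] show ?thesis by (simp add: Trm_def)
qed

text \<open>Environments enter through their first few entries only; \<open>args\<close> supplies these.\<close>

definition args :: "((nat \<Rightarrow> 'a) \<Rightarrow> 'a) list \<Rightarrow> nat \<Rightarrow> (nat \<Rightarrow> 'a) \<Rightarrow> 'a" where
  "args ts i = (if i < length ts then ts ! i else (\<lambda>\<rho>. \<rho> 0))"

lemma Trm_args: "(\<And>t. t \<in> set ts \<Longrightarrow> Trm t) \<Longrightarrow> Trm (args ts i)"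
  by (simp add: args_def Trm_var)

lemma args_simps [simp]: "args (t # ts) 0 = t" "args (t # ts) (Suc i) = args ts i"
  by (simp_all add: args_def)

lemma Def_app1: "Def (\<lambda>\<rho>. P (\<rho> 0)) \<Longrightarrow> Trm t \<Longrightarrow> Def (\<lambda>\<rho>. P (t \<rho>))"
  using Def_comp [of _ "args [t]"] Trm_args [of "[t]"] by fastforce

lemma Def_app2: "Def (\<lambda>\<rho>. P (\<rho> 0) (\<rho> (Suc 0))) \<Longrightarrow> Trm t \<Longrightarrow> Trm u \<Longrightarrow> Def (\<lambda>\<rho>. P (t \<rho>) (u \<rho>))"
  using Def_comp [of "\<lambda>\<rho>. P (\<rho> 0) (\<rho> (Suc 0))" "args [t, u]"] Trm_args [of "[t, u]"] by auto

lemma Def_app3: "Def (\<lambda>\<rho>. P (\<rho> 0) (\<rho> (Suc 0)) (\<rho> (Suc (Suc 0)))) \<Longrightarrow> Trm t \<Longrightarrow> Trm u \<Longrightarrow> Trm v \<Longrightarrow>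
    Def (\<lambda>\<rho>. P (t \<rho>) (u \<rho>) (v \<rho>))"
  using Def_comp [of "\<lambda>\<rho>. P (\<rho> 0) (\<rho> (Suc 0)) (\<rho> (Suc (Suc 0)))" "args [t, u, v]"]
    Trm_args [of "[t, u, v]"] by auto

lemma Trm_app1: "Trm (\<lambda>\<rho>. f (\<rho> 0)) \<Longrightarrow> Trm t \<Longrightarrow> Trm (\<lambda>\<rho>. f (t \<rho>))"
  using Trm_comp [of "\<lambda>\<rho>. f (\<rho> 0)" "args [t]"] Trm_args [of "[t]"] by auto

lemma Trm_app2: "Trm (\<lambda>\<rho>. f (\<rho> 0) (\<rho> (Suc 0))) \<Longrightarrow> Trm t \<Longrightarrow> Trm u \<Longrightarrow> Trm (\<lambda>\<rho>. f (t \<rho>) (u \<rho>))"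
  using Trm_comp [of "\<lambda>\<rho>. f (\<rho> 0) (\<rho> (Suc 0))" "args [t, u]"] Trm_args [of "[t, u]"] by auto

lemma Def_ex1 [dfn]:
  assumes "Def (\<lambda>\<rho>. P (\<lambda>n. \<rho> (Suc n)) (\<rho> 0))" shows "Def (\<lambda>\<rho>. \<exists>!x. P \<rho> x)"
proof -
  have "inj (\<lambda>n. if n = 0 then 0 else Suc n)" by (auto simp: inj_def)
  from Def_rename [OF assms this]
  have *: "Def (\<lambda>\<rho>. P (\<lambda>n. \<rho> (Suc (Suc n))) (\<rho> 0))" by simp
  show ?thesis unfolding Ex1_def by (intro dfn assms *)
qed

lemma Trm_if [dfn]: "Def P \<Longrightarrow> Trm t \<Longrightarrow> Trm u \<Longrightarrow> Trm (\<lambda>\<rho>. if P \<rho> then t \<rho> else u \<rho>)"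
proof -
  assume P: "Def P" and t: "Trm t" and u: "Trm u"
  have "Def (\<lambda>\<rho>. P (\<lambda>n. \<rho> (Suc n)) \<and> \<rho> 0 = t (\<lambda>n. \<rho> (Suc n))
      \<or> \<not> P (\<lambda>n. \<rho> (Suc n)) \<and> \<rho> 0 = u (\<lambda>n. \<rho> (Suc n)))"
    by (intro dfn Def_shift [OF P] Trm_shift [OF t] Trm_shift [OF u])
  then show ?thesis unfolding Trm_def by (rule back_subst [of Def]) auto
qed


section \<open>Basic set theory in the model\<close>

lemma ext: "(\<And>z. z \<epsilon> x \<longleftrightarrow> z \<epsilon> y) \<Longrightarrow> x = y"
  using model [of "Extensionality 0" "\<lambda>_. x"]
  by (auto simp: ZF_def Extensionality_def f_all_def f_imp_def f_iff_def f_mem_def f_eq_def)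

text \<open>By extensionality the graph of a set-valued operation is determined by its membership
  relation, so definability of the latter suffices.\<close>

lemma Trm_ext:
  assumes "Def (\<lambda>\<rho>. P (\<lambda>n. \<rho> (Suc n)) (\<rho> 0))" "\<And>\<rho> x. x \<epsilon> t \<rho> \<longleftrightarrow> P \<rho> x"
  shows "Trm t"
proof -
  have "inj (\<lambda>n. if n = 0 then 0 else Suc n)" by (auto simp: inj_def)
  from Def_rename [OF assms(1) this]
  have *: "Def (\<lambda>\<rho>. P (\<lambda>n. \<rho> (Suc (Suc n))) (\<rho> 0))" by simp
  have "Def (\<lambda>\<rho>. \<forall>x. x \<epsilon> \<rho> 0 \<longleftrightarrow> P (\<lambda>n. \<rho> (Suc n)) x)"
    by (intro dfn *)
  moreover have "y = t \<rho> \<longleftrightarrow> (\<forall>x. x \<epsilon> y \<longleftrightarrow> P \<rho> x)" for y \<rho>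
    using ext assms(2) by metis
  ultimately show ?thesis by (simp add: Trm_def)
qed


lemma interleave_extend:
  "interleave (extend x \<rho>) \<sigma> = (interleave (extend y \<rho>) \<sigma>)(0 := x)"
  "interleave (extend z (extend x \<rho>)) \<sigma> = (interleave (extend z (extend y \<rho>)) \<sigma>)(2 := x)"
proof -
  have n: "n = Suc (2 * (n div 2)) \<or> n = 0 \<or> n = 2 \<or> (\<exists>k. n = 2 * Suc (Suc k))" for n :: nat
    by presburger
  show "interleave (extend x \<rho>) \<sigma> = (interleave (extend y \<rho>) \<sigma>)(0 := x)"
    "interleave (extend z (extend x \<rho>)) \<sigma> = (interleave (extend z (extend y \<rho>)) \<sigma>)(2 := x)"
  proof (rule_tac [!] HOL.ext)
    fix n
    show "interleave (extend x \<rho>) \<sigma> n = ((interleave (extend y \<rho>) \<sigma>)(0 := x)) n"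
      "interleave (extend z (extend x \<rho>)) \<sigma> n = ((interleave (extend z (extend y \<rho>)) \<sigma>)(2 := x)) n"
      using n [of n] by (auto simp: interleave_def extend_def)
  qed
qed

lemma fresh_vars:
  fixes S :: "nat set" assumes "finite S"
  obtains a b w where "distinct [a, b, w]" "a \<notin> S" "b \<notin> S" "w \<notin> S"
proof -
  define m where "m = Max (insert 0 S)"
  have "x \<le> m" if "x \<in> S" for x using that assms by (simp add: m_def)
  then show thesis using that [of "m + 1" "m + 2" "m + 3"] by fastforce
qed

text \<open>Here definability pays off, as the schema supplies sets for formulas only. The variables
  for the given and the new set are chosen outside \<open>fv p\<close>, so that their values do not
  disturb that of \<open>p\<close>.\<close>

lemma separation:
  assumes "Def (\<lambda>\<rho>. P (\<rho> 0))"
  shows "\<exists>b. \<forall>x. x \<epsilon> b \<longleftrightarrow> x \<epsilon> A \<and> P x"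
proof -
  obtain p \<sigma> where "\<And>\<rho>. P (\<rho> 0) = sem (interleave \<rho> \<sigma>) p" using assms unfolding Def_def by blast
  from this [of "extend _ (\<lambda>_. undefined)"]
  have P: "P x = sem (interleave (extend x (\<lambda>_. undefined)) \<sigma>) p" for x by (simp add: extend_def)
  obtain a b w where ab: "distinct [a, b, w]" "a \<notin> insert 0 (fv p)" "b \<notin> insert 0 (fv p)" "w \<notin> insert 0 (fv p)"
    by (rule fresh_vars [of "insert 0 (fv p)"]) auto
  define \<tau> where "\<tau> = interleave (extend undefined (\<lambda>_. undefined)) \<sigma>"
  have p: "sem (\<tau>(a := u, b := v, 0 := x)) p = P x" for u v x
    unfolding P \<tau>_def interleave_extend(1) [of x _ _ undefined]
    by (rule sat_cong) (use ab in auto)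
  have "Forall a (Exists b (Forall 0 (Iff (Mem 0 b) (Conj (Mem 0 a) p)))) \<in> ZF"
    unfolding ZF_def Separation_def using ab by fastforce
  from model [OF this, of \<tau>] show ?thesis
    unfolding sat.simps sat_connectives p using ab by auto
qed

lemma replacement:
  assumes "Def (\<lambda>\<rho>. P (\<rho> 0) (\<rho> (Suc 0)))" "\<And>x y z. x \<epsilon> A \<Longrightarrow> P x y \<Longrightarrow> P x z \<Longrightarrow> y = z"
  shows "\<exists>b. \<forall>y. y \<epsilon> b \<longleftrightarrow> (\<exists>x. x \<epsilon> A \<and> P x y)"
proof -
  obtain p \<sigma> where "\<And>\<rho>. P (\<rho> 0) (\<rho> (Suc 0)) = sem (interleave \<rho> \<sigma>) p" using assms(1) unfolding Def_def by blast
  from this [of "extend _ (extend _ (\<lambda>_. undefined))"]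
  have P: "P x y = sem (interleave (extend x (extend y (\<lambda>_. undefined))) \<sigma>) p" for x y by (simp add: extend_def)
  obtain a b w where ab: "distinct [a, b, w]" "a \<notin> {0, 2} \<union> fv p" "b \<notin> {0, 2} \<union> fv p" "w \<notin> {0, 2} \<union> fv p"
    by (rule fresh_vars [of "{0, 2} \<union> fv p"]) auto
  define \<tau> where "\<tau> = interleave (extend undefined (extend undefined (\<lambda>_. undefined))) \<sigma>"
  have \<tau>: "interleave (extend x (extend y (\<lambda>_. undefined))) \<sigma> = \<tau>(0 := x, 2 := y)" for x y
    unfolding \<tau>_def by (metis interleave_extend)
  have eq: "\<upsilon> i = interleave (extend x (extend y (\<lambda>_. undefined))) \<sigma> i"
    if "\<upsilon> = \<tau>(a := u, b := v, w := t, 0 := x, 2 := y)" "i \<in> fv p" for u v t x y \<upsilon> i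
    using that ab unfolding \<tau> by auto
  have p: "sem \<upsilon> p = P x y" if "\<upsilon> = \<tau>(a := u, b := v, w := t, 0 := x, 2 := y)" for u v t x y \<upsilon>
    unfolding P by (rule sat_cong) (rule eq [OF that])
  have p1: "sem (\<tau>(a := u, 0 := x, w := t, 2 := y)) p = P x y" for u t x y
    by (rule p [of _ u "\<tau> b" t]) (use ab in auto)
  have p2: "sem (\<tau>(a := u, b := v, 2 := y, 0 := x)) p = P x y" for u v x y
    by (rule p [of _ u v "\<tau> w"]) (use ab in auto)
  have "Forall a (Imp (Forall 0 (Imp (Mem 0 a) (Exists w (Forall 2 (Imp p (Eql 2 w))))))
      (Exists b (Forall 2 (Iff (Mem 2 b) (Exists 0 (Conj (Mem 0 a) p)))))) \<in> ZF"
    unfolding ZF_def Replacement_def using ab by fastforce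
  from model [OF this, of \<tau>]
  have "(\<forall>x. x \<epsilon> A \<longrightarrow> (\<exists>w. \<forall>y. P x y \<longrightarrow> y = w)) \<longrightarrow> (\<exists>c. \<forall>y. y \<epsilon> c \<longleftrightarrow> (\<exists>x. x \<epsilon> A \<and> P x y))"
    unfolding sat.simps sat_connectives p1 p2 using ab by auto
  moreover have "\<forall>x. x \<epsilon> A \<longrightarrow> (\<exists>w. \<forall>y. P x y \<longrightarrow> y = w)" using assms(2) by blast
  ultimately show ?thesis by blast
qed

text \<open>A total operation of HOL whose value is unspecified when no such set exists; hence the
  definability premise of \<open>mem_Sep\<close>.\<close>

definition Sep :: "'a \<Rightarrow> ('a \<Rightarrow> bool) \<Rightarrow> 'a" where
  "Sep A P = (THE b. \<forall>x. x \<epsilon> b \<longleftrightarrow> x \<epsilon> A \<and> P x)"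

lemma the_ext: "(\<And>x. x \<epsilon> b \<longleftrightarrow> P x) \<Longrightarrow> (THE b. \<forall>x. x \<epsilon> b \<longleftrightarrow> P x) = b"
  by (rule the_equality) (auto intro: ext)

lemma mem_Sep: "Def (\<lambda>\<rho>. P (\<rho> 0)) \<Longrightarrow> x \<epsilon> Sep A P \<longleftrightarrow> x \<epsilon> A \<and> P x"
proof -
  assume "Def (\<lambda>\<rho>. P (\<rho> 0))"
  from separation [OF this] obtain b where b: "\<And>x. x \<epsilon> b \<longleftrightarrow> x \<epsilon> A \<and> P x" by blast
  from the_ext [of b, OF b] b show ?thesis unfolding Sep_def by simp
qed

text \<open>Freezing the outer environment turns its entries into parameters. This reduces a
  predicate under binders to the one-variable form that \<open>mem_Sep\<close> expects.\<close>

lemma Def_fix: "Def (\<lambda>\<rho>. P (\<lambda>n. \<rho> (Suc n)) (\<rho> 0)) \<Longrightarrow> Def (\<lambda>\<rho>. P \<rho>' (\<rho> 0))"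
proof -
  let ?s = "\<lambda>i \<rho>. case i of 0 \<Rightarrow> \<rho> 0 | Suc j \<Rightarrow> \<rho>' j"
  have "Trm (?s i)" for i by (cases i) (simp_all add: Trm_var Trm_const)
  then show "Def (\<lambda>\<rho>. P (\<lambda>n. \<rho> (Suc n)) (\<rho> 0)) \<Longrightarrow> ?thesis"
    using Def_comp [of "\<lambda>\<rho>. P (\<lambda>n. \<rho> (Suc n)) (\<rho> 0)" ?s] by simp
qed

lemma Trm_fix: "Trm (\<lambda>\<rho>. f (\<lambda>n. \<rho> (Suc n)) (\<rho> 0)) \<Longrightarrow> Trm (\<lambda>\<rho>. f \<rho>' (\<rho> 0))"
proof -
  let ?s = "\<lambda>i \<rho>. case i of 0 \<Rightarrow> \<rho> 0 | Suc j \<Rightarrow> \<rho>' j"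
  have "Trm (?s i)" for i by (cases i) (simp_all add: Trm_var Trm_const)
  then show "Trm (\<lambda>\<rho>. f (\<lambda>n. \<rho> (Suc n)) (\<rho> 0)) \<Longrightarrow> ?thesis"
    using Trm_comp [of "\<lambda>\<rho>. f (\<lambda>n. \<rho> (Suc n)) (\<rho> 0)" ?s] by simp
qed

lemma Trm_Sep [dfn]:
  assumes "Trm A" "Def (\<lambda>\<rho>. P (\<lambda>n. \<rho> (Suc n)) (\<rho> 0))"
  shows "Trm (\<lambda>\<rho>. Sep (A \<rho>) (\<lambda>x. P \<rho> x))"
  by (rule Trm_ext [of "\<lambda>\<rho> x. x \<epsilon> A \<rho> \<and> P \<rho> x"])
    (auto simp: mem_Sep Def_fix [OF assms(2)] intro!: Def_and Def_mem Trm_shift [OF assms(1)] Trm_var assms(2))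

definition RepFun :: "'a \<Rightarrow> ('a \<Rightarrow> 'a) \<Rightarrow> 'a" where
  "RepFun A f = (THE b. \<forall>y. y \<epsilon> b \<longleftrightarrow> (\<exists>x. x \<epsilon> A \<and> y = f x))"

lemma mem_RepFun: "Trm (\<lambda>\<rho>. f (\<rho> 0)) \<Longrightarrow> y \<epsilon> RepFun A f \<longleftrightarrow> (\<exists>x. x \<epsilon> A \<and> y = f x)"
proof -
  assume f: "Trm (\<lambda>\<rho>. f (\<rho> 0))"
  have "Def (\<lambda>\<rho>. \<rho> (Suc 0) = f (\<rho> 0))" by (intro dfn f)
  from replacement [OF this, of A] obtain b where "\<And>y. y \<epsilon> b \<longleftrightarrow> (\<exists>x. x \<epsilon> A \<and> y = f x)"
    by auto
  from the_ext [of b, OF this] this show ?thesis unfolding RepFun_def by simp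
qed

lemma Trm_RepFun [dfn]:
  assumes "Trm A" "Trm (\<lambda>\<rho>. f (\<lambda>n. \<rho> (Suc n)) (\<rho> 0))"
  shows "Trm (\<lambda>\<rho>. RepFun (A \<rho>) (\<lambda>x. f \<rho> x))"
proof (rule Trm_ext [of "\<lambda>\<rho> y. \<exists>x. x \<epsilon> A \<rho> \<and> y = f \<rho> x"])
  let ?s = "\<lambda>i \<rho>. case i of 0 \<Rightarrow> \<rho> 0 | Suc j \<Rightarrow> \<rho> (Suc (Suc j))"
  have "Trm (?s i)" for i
    by (cases i) (auto simp: Trm_var)
  from Trm_comp [where s = ?s, OF assms(2) this]
  have "Trm (\<lambda>\<rho>. f (\<lambda>n. \<rho> (Suc (Suc n))) (\<rho> 0))" by simp
  then show "Def (\<lambda>\<rho>. \<exists>x. x \<epsilon> A (\<lambda>n. \<rho> (Suc n)) \<and> \<rho> 0 = f (\<lambda>n. \<rho> (Suc n)) x)"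
    by (intro dfn) (use Trm_shift [OF Trm_shift [OF assms(1)]] in auto)
qed (simp add: mem_RepFun Trm_fix [OF assms(2)])

definition upair :: "'a \<Rightarrow> 'a \<Rightarrow> 'a" where
  "upair a b = (THE p. \<forall>z. z \<epsilon> p \<longleftrightarrow> z = a \<or> z = b)"

definition Union :: "'a \<Rightarrow> 'a" where
  "Union x = (THE u. \<forall>z. z \<epsilon> u \<longleftrightarrow> (\<exists>y. y \<epsilon> x \<and> z \<epsilon> y))"

definition Sub :: "'a \<Rightarrow> 'a \<Rightarrow> bool" where
  "Sub x y \<longleftrightarrow> (\<forall>z. z \<epsilon> x \<longrightarrow> z \<epsilon> y)"

definition Pow :: "'a \<Rightarrow> 'a" where
  "Pow x = (THE p. \<forall>z. z \<epsilon> p \<longleftrightarrow> Sub z x)"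

lemma mem_upair [simp]: "z \<epsilon> upair a b \<longleftrightarrow> z = a \<or> z = b"
proof -
  have "\<exists>p. \<forall>z. z \<epsilon> p \<longleftrightarrow> z = a \<or> z = b"
    using model [of "Pairing 0" "\<lambda>_. a"]
    by (auto simp: ZF_def Pairing_def is_upair_def f_all_def f_ex_def f_or_def f_iff_def f_mem_def f_eq_def)
  then obtain p where p: "\<And>z. z \<epsilon> p \<longleftrightarrow> z = a \<or> z = b" by blast
  from the_ext [of p, OF p] p show ?thesis unfolding upair_def by simp
qed

lemma mem_Union [simp]: "z \<epsilon> Union x \<longleftrightarrow> (\<exists>y. y \<epsilon> x \<and> z \<epsilon> y)"
proof -
  have "\<exists>p. \<forall>z. z \<epsilon> p \<longleftrightarrow> (\<exists>y. y \<epsilon> x \<and> z \<epsilon> y)"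
    using model [of "Union_Axiom 0" "\<lambda>_. x"]
    by (auto simp: ZF_def Union_Axiom_def f_all_def f_ex_def f_and_def f_iff_def f_mem_def)
  then obtain p where "\<And>z. z \<epsilon> p \<longleftrightarrow> (\<exists>y. y \<epsilon> x \<and> z \<epsilon> y)" by blast
  from the_ext [of p, OF this] this show ?thesis unfolding Union_def by simp
qed

lemma mem_Pow [simp]: "z \<epsilon> Pow x \<longleftrightarrow> Sub z x"
proof -
  have "\<exists>p. \<forall>z. z \<epsilon> p \<longleftrightarrow> Sub z x"
    using model [of "Power_Set 0" "\<lambda>_. x"]
    by (auto simp: ZF_def Power_Set_def Sub_def is_subset_def f_all_def f_ex_def f_imp_def f_iff_def f_mem_def)
  then obtain p where "\<And>z. z \<epsilon> p \<longleftrightarrow> Sub z x" by blast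
  from the_ext [of p, OF this] this show ?thesis unfolding Pow_def by simp
qed

lemma Def_Sub [dfn]: "Trm t \<Longrightarrow> Trm u \<Longrightarrow> Def (\<lambda>\<rho>. Sub (t \<rho>) (u \<rho>))"
  by (rule Def_app2) (unfold Sub_def, intro dfn)

lemma Trm_upair [dfn]: "Trm t \<Longrightarrow> Trm u \<Longrightarrow> Trm (\<lambda>\<rho>. upair (t \<rho>) (u \<rho>))"
  by (rule Trm_app2, rule Trm_ext [of "\<lambda>\<rho> x. x = \<rho> 0 \<or> x = \<rho> (Suc 0)"]) (simp_all, intro dfn)

lemma Trm_Union [dfn]: "Trm t \<Longrightarrow> Trm (\<lambda>\<rho>. Union (t \<rho>))"
  by (rule Trm_app1, rule Trm_ext [of "\<lambda>\<rho> z. \<exists>y. y \<epsilon> \<rho> 0 \<and> z \<epsilon> y"]) (simp_all, intro dfn)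

lemma Trm_Pow [dfn]: "Trm t \<Longrightarrow> Trm (\<lambda>\<rho>. Pow (t \<rho>))"
  by (rule Trm_app1, rule Trm_ext [of "\<lambda>\<rho> z. Sub z (\<rho> 0)"]) (simp_all, intro dfn)

definition Empty :: 'a ("\<emptyset>") where "\<emptyset> = Sep undefined (\<lambda>_. False)"

lemma not_mem_Empty [simp]: "\<not> x \<epsilon> \<emptyset>"
  by (simp add: Empty_def mem_Sep Def_const)

lemma ex_mem: "x \<noteq> \<emptyset> \<longleftrightarrow> (\<exists>y. y \<epsilon> x)"
  using ext [of x \<emptyset>] by auto

definition un :: "'a \<Rightarrow> 'a \<Rightarrow> 'a" where "un a b = Union (upair a b)"
definition diff :: "'a \<Rightarrow> 'a \<Rightarrow> 'a" where "diff a b = Sep a (\<lambda>x. \<not> x \<epsilon> b)"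
definition inter :: "'a \<Rightarrow> 'a \<Rightarrow> 'a" where "inter a b = Sep a (\<lambda>x. x \<epsilon> b)"
definition ins :: "'a \<Rightarrow> 'a \<Rightarrow> 'a" where "ins x a = un a (upair x x)"
definition sing :: "'a \<Rightarrow> 'a" where "sing x = upair x x"
definition succ :: "'a \<Rightarrow> 'a" where "succ x = ins x x"
definition pair :: "'a \<Rightarrow> 'a \<Rightarrow> 'a" where "pair a b = upair (sing a) (upair a b)"

lemma Trm_un [dfn]: "Trm t \<Longrightarrow> Trm u \<Longrightarrow> Trm (\<lambda>\<rho>. un (t \<rho>) (u \<rho>))"
  unfolding un_def by (intro dfn)
lemma Trm_diff [dfn]: "Trm t \<Longrightarrow> Trm u \<Longrightarrow> Trm (\<lambda>\<rho>. diff (t \<rho>) (u \<rho>))"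
  by (rule Trm_app2) (unfold diff_def, intro dfn)
lemma Trm_inter [dfn]: "Trm t \<Longrightarrow> Trm u \<Longrightarrow> Trm (\<lambda>\<rho>. inter (t \<rho>) (u \<rho>))"
  by (rule Trm_app2) (unfold inter_def, intro dfn)
lemma Trm_ins [dfn]: "Trm t \<Longrightarrow> Trm u \<Longrightarrow> Trm (\<lambda>\<rho>. ins (t \<rho>) (u \<rho>))"
  unfolding ins_def by (intro dfn)
lemma Trm_sing [dfn]: "Trm t \<Longrightarrow> Trm (\<lambda>\<rho>. sing (t \<rho>))"
  unfolding sing_def by (intro dfn)
lemma Trm_succ [dfn]: "Trm t \<Longrightarrow> Trm (\<lambda>\<rho>. succ (t \<rho>))"
  unfolding succ_def by (intro dfn)
lemma Trm_pair [dfn]: "Trm t \<Longrightarrow> Trm u \<Longrightarrow> Trm (\<lambda>\<rho>. pair (t \<rho>) (u \<rho>))"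
  unfolding pair_def by (intro dfn)

lemma mem_un [simp]: "x \<epsilon> un a b \<longleftrightarrow> x \<epsilon> a \<or> x \<epsilon> b"
  by (auto simp: un_def)

lemma mem_diff [simp]: "x \<epsilon> diff a b \<longleftrightarrow> x \<epsilon> a \<and> \<not> x \<epsilon> b"
  unfolding diff_def by (rule mem_Sep) (intro dfn)

lemma mem_inter [simp]: "x \<epsilon> inter a b \<longleftrightarrow> x \<epsilon> a \<and> x \<epsilon> b"
  unfolding inter_def by (rule mem_Sep) (intro dfn)

lemma mem_ins [simp]: "x \<epsilon> ins y a \<longleftrightarrow> x = y \<or> x \<epsilon> a"
  by (auto simp: ins_def)

lemma mem_sing [simp]: "x \<epsilon> sing y \<longleftrightarrow> x = y"
  by (auto simp: sing_def)

lemma mem_succ [simp]: "x \<epsilon> succ y \<longleftrightarrow> x \<epsilon> y \<or> x = y"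
  by (auto simp: succ_def)

lemma mem_irrefl: "\<not> x \<epsilon> x"
  using model [of "Foundation 0" "\<lambda>_. sing x"] mem_sing
  by (auto simp: ZF_def Foundation_def is_empty_def f_all_def f_ex_def f_not_def f_and_def f_imp_def f_mem_def)
    (metis mem_sing)

lemma mem_asym: "x \<epsilon> y \<Longrightarrow> \<not> y \<epsilon> x"
  using model [of "Foundation 0" "\<lambda>_. upair x y"] mem_upair
  by (auto simp: ZF_def Foundation_def is_empty_def f_all_def f_ex_def f_not_def f_and_def f_imp_def f_mem_def)
    (metis mem_upair)

lemma upair_eq: "upair a b = upair c d \<longleftrightarrow> a = c \<and> b = d \<or> a = d \<and> b = c"
proof
  assume eq: "upair a b = upair c d"
  have "z = a \<or> z = b \<longleftrightarrow> z = c \<or> z = d" for z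
    unfolding mem_upair [symmetric] eq ..
  then show "a = c \<and> b = d \<or> a = d \<and> b = c" by metis
qed (auto intro: ext)

lemma pair_eq [simp]: "pair a b = pair c d \<longleftrightarrow> a = c \<and> b = d"
  by (auto simp: pair_def sing_def upair_eq)

text \<open>The union of a one-element set is that element. Separating the wanted object from a
  bounding set and taking the union therefore acts as a definite description inside the
  model.\<close>

definition fst' :: "'a \<Rightarrow> 'a" where
  "fst' p = Union (Sep (Union p) (\<lambda>x. \<exists>y. p = pair x y))"
definition snd' :: "'a \<Rightarrow> 'a" where
  "snd' p = Union (Sep (Union p) (\<lambda>y. \<exists>x. p = pair x y))"
definition app :: "'a \<Rightarrow> 'a \<Rightarrow> 'a" where
  "app f x = Union (Sep (Union (Union f)) (\<lambda>y. pair x y \<epsilon> f))"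
definition prod :: "'a \<Rightarrow> 'a \<Rightarrow> 'a" where
  "prod A B = Sep (Pow (Pow (un A B))) (\<lambda>p. \<exists>x y. x \<epsilon> A \<and> y \<epsilon> B \<and> p = pair x y)"
definition lam :: "'a \<Rightarrow> ('a \<Rightarrow> 'a) \<Rightarrow> 'a" where
  "lam A f = RepFun A (\<lambda>x. pair x (f x))"

lemma Trm_fst' [dfn]: "Trm t \<Longrightarrow> Trm (\<lambda>\<rho>. fst' (t \<rho>))"
  by (rule Trm_app1) (unfold fst'_def, intro dfn)
lemma Trm_snd' [dfn]: "Trm t \<Longrightarrow> Trm (\<lambda>\<rho>. snd' (t \<rho>))"
  by (rule Trm_app1) (unfold snd'_def, intro dfn)
lemma Trm_app [dfn]: "Trm t \<Longrightarrow> Trm u \<Longrightarrow> Trm (\<lambda>\<rho>. app (t \<rho>) (u \<rho>))"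
  by (rule Trm_app2) (unfold app_def, intro dfn)
lemma Trm_prod [dfn]: "Trm t \<Longrightarrow> Trm u \<Longrightarrow> Trm (\<lambda>\<rho>. prod (t \<rho>) (u \<rho>))"
  by (rule Trm_app2) (unfold prod_def, intro dfn)
lemma Trm_lam [dfn]:
  "Trm A \<Longrightarrow> Trm (\<lambda>\<rho>. f (\<lambda>n. \<rho> (Suc n)) (\<rho> 0)) \<Longrightarrow> Trm (\<lambda>\<rho>. lam (A \<rho>) (\<lambda>x. f \<rho> x))"
  unfolding lam_def by (intro dfn)

lemma Union_sing: "(\<And>z. z \<epsilon> s \<longleftrightarrow> z = y) \<Longrightarrow> Union s = y"
  by (rule ext) auto

lemma fst'_pair [simp]: "fst' (pair a b) = a"
  unfolding fst'_def
  by (rule Union_sing, subst mem_Sep, intro dfn) (auto simp: pair_def sing_def upair_eq)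

lemma snd'_pair [simp]: "snd' (pair a b) = b"
  unfolding snd'_def
  by (rule Union_sing, subst mem_Sep, intro dfn) (auto simp: pair_def sing_def upair_eq)

lemma mem_prod [simp]: "p \<epsilon> prod A B \<longleftrightarrow> (\<exists>x y. x \<epsilon> A \<and> y \<epsilon> B \<and> p = pair x y)"
  unfolding prod_def by (subst mem_Sep, intro dfn) (auto simp: pair_def sing_def Sub_def)

lemma app_eq:
  assumes "\<And>z. pair x z \<epsilon> f \<longleftrightarrow> z = y"
  shows "app f x = y"
  unfolding app_def
proof (rule Union_sing, subst mem_Sep, intro dfn)
  fix z
  have "pair x y \<epsilon> f" "upair x y \<epsilon> pair x y" "y \<epsilon> upair x y"
    using assms by (simp_all add: pair_def)
  then have "y \<epsilon> Union (Union f)" unfolding mem_Union by blast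
  then show "z \<epsilon> Union (Union f) \<and> pair x z \<epsilon> f \<longleftrightarrow> z = y"
    unfolding assms by blast
qed

definition FunOn :: "'a \<Rightarrow> 'a \<Rightarrow> bool" where
  "FunOn f A \<longleftrightarrow> (\<forall>p. p \<epsilon> f \<longrightarrow> (\<exists>x y. x \<epsilon> A \<and> p = pair x y)) \<and>
     (\<forall>x. x \<epsilon> A \<longrightarrow> (\<exists>!y. pair x y \<epsilon> f))"

lemma Def_FunOn [dfn]: "Trm t \<Longrightarrow> Trm u \<Longrightarrow> Def (\<lambda>\<rho>. FunOn (t \<rho>) (u \<rho>))"
  by (rule Def_app2) (unfold FunOn_def, intro dfn)

lemma FunOn_iff:
  assumes "FunOn f A" shows "pair x y \<epsilon> f \<longleftrightarrow> x \<epsilon> A \<and> y = app f x"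
proof (cases "x \<epsilon> A")
  case True
  then obtain y' where "\<And>z. pair x z \<epsilon> f \<longleftrightarrow> z = y'" using assms unfolding FunOn_def by blast
  with True show ?thesis using app_eq [of x f y'] by simp
next
  case False
  then show ?thesis using assms unfolding FunOn_def by auto
qed

lemma pair_lam: "Trm (\<lambda>\<rho>. f (\<rho> 0)) \<Longrightarrow> pair x y \<epsilon> lam A f \<longleftrightarrow> x \<epsilon> A \<and> y = f x"
  unfolding lam_def by (subst mem_RepFun, intro dfn) auto

lemma FunOn_lam: "Trm (\<lambda>\<rho>. f (\<rho> 0)) \<Longrightarrow> FunOn (lam A f) A"
  unfolding FunOn_def lam_def by (subst (1 2) mem_RepFun, (intro dfn, assumption)+) auto

lemma app_lam: "Trm (\<lambda>\<rho>. f (\<rho> 0)) \<Longrightarrow> x \<epsilon> A \<Longrightarrow> app (lam A f) x = f x"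
  by (rule app_eq) (simp add: pair_lam)

end

section \<open>Reading formulas in the model\<close>

named_theorems sem_eq

context zf
begin

lemma sem_connectives [sem_eq]:
  "sem \<rho> ((x \<^bold>\<in> y) d) \<longleftrightarrow> \<rho> x \<epsilon> \<rho> y"
  "sem \<rho> ((x \<^bold>= y) d) \<longleftrightarrow> \<rho> x = \<rho> y"
  "sem \<rho> ((\<^bold>\<not> p) d) \<longleftrightarrow> \<not> sem \<rho> (p d)"
  "sem \<rho> ((p \<^bold>\<and> q) d) \<longleftrightarrow> sem \<rho> (p d) \<and> sem \<rho> (q d)"
  "sem \<rho> ((p \<^bold>\<or> q) d) \<longleftrightarrow> sem \<rho> (p d) \<or> sem \<rho> (q d)"
  "sem \<rho> ((p \<^bold>\<longrightarrow> q) d) \<longleftrightarrow> (sem \<rho> (p d) \<longrightarrow> sem \<rho> (q d))"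
  "sem \<rho> ((p \<^bold>\<longleftrightarrow> q) d) \<longleftrightarrow> (sem \<rho> (p d) \<longleftrightarrow> sem \<rho> (q d))"
  "sem \<rho> (f_all P d) \<longleftrightarrow> (\<forall>a. sem (\<rho>(d := a)) (P d (Suc d)))"
  "sem \<rho> (f_ex P d) \<longleftrightarrow> (\<exists>a. sem (\<rho>(d := a)) (P d (Suc d)))"
  by (simp_all add: f_mem_def f_eq_def f_not_def f_and_def f_or_def f_imp_def f_iff_def f_all_def f_ex_def)

text \<open>A quantifier at depth \<open>d\<close> overwrites only the entry \<open>d\<close>, while
  all outer variables lie below. The rules in \<open>sem_eq\<close> therefore carry premises
  \<open>x < d\<close>, and updates are resolved by these comparisons instead of by case
  splits.\<close>

lemma upd_less: "(x :: nat) < d \<Longrightarrow> (\<rho>(d := a)) x = \<rho> x"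
  by simp

lemmas upd = upd_less fun_upd_same less_SucI lessI

lemma sem_is_subset [sem_eq]: "x < d \<Longrightarrow> y < d \<Longrightarrow> sem \<rho> ((x \<^bold>\<subseteq> y) d) \<longleftrightarrow> Sub (\<rho> x) (\<rho> y)"
  by (simp add: is_subset_def Sub_def sem_eq upd del: fun_upd_apply)

lemma sem_is_empty [sem_eq]: "x < d \<Longrightarrow> sem \<rho> (is_empty x d) \<longleftrightarrow> \<rho> x = \<emptyset>"
  using ex_mem by (simp add: is_empty_def sem_eq upd del: fun_upd_apply) blast

lemma sem_is_upair [sem_eq]:
  "p < d \<Longrightarrow> a < d \<Longrightarrow> b < d \<Longrightarrow> sem \<rho> (is_upair p a b d) \<longleftrightarrow> \<rho> p = upair (\<rho> a) (\<rho> b)"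
  by (simp add: is_upair_def sem_eq upd del: fun_upd_apply) (auto intro: ext)

lemma sem_is_opair [sem_eq]:
  "p < d \<Longrightarrow> a < d \<Longrightarrow> b < d \<Longrightarrow> sem \<rho> (is_opair p a b d) \<longleftrightarrow> \<rho> p = pair (\<rho> a) (\<rho> b)"
  by (simp add: is_opair_def pair_def sing_def sem_eq upd del: fun_upd_apply)

lemma sem_is_succ [sem_eq]: "x < d \<Longrightarrow> y < d \<Longrightarrow> sem \<rho> (is_succ y x d) \<longleftrightarrow> \<rho> y = succ (\<rho> x)"
  by (simp add: is_succ_def sem_eq upd del: fun_upd_apply) (auto intro: ext)

definition Inductive :: "'a \<Rightarrow> bool" where
  "Inductive w \<longleftrightarrow> \<emptyset> \<epsilon> w \<and> (\<forall>x. x \<epsilon> w \<longrightarrow> succ x \<epsilon> w)"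

lemma Def_Inductive [dfn]: "Trm t \<Longrightarrow> Def (\<lambda>\<rho>. Inductive (t \<rho>))"
  by (rule Def_app1) (unfold Inductive_def, intro dfn)

lemma sem_is_inductive [sem_eq]: "w < d \<Longrightarrow> sem \<rho> (is_inductive w d) \<longleftrightarrow> Inductive (\<rho> w)"
  by (simp add: is_inductive_def Inductive_def sem_eq upd del: fun_upd_apply)

lemma sem_maps [sem_eq]:
  "f < d \<Longrightarrow> x < d \<Longrightarrow> y < d \<Longrightarrow> sem \<rho> (maps f x y d) \<longleftrightarrow> pair (\<rho> x) (\<rho> y) \<epsilon> \<rho> f"
  by (simp add: maps_def sem_eq upd del: fun_upd_apply)

lemma sem_fun_on [sem_eq]: "f < d \<Longrightarrow> A < d \<Longrightarrow> sem \<rho> (fun_on f A d) \<longleftrightarrow> FunOn (\<rho> f) (\<rho> A)"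
  by (simp add: fun_on_def FunOn_def Ex1_def sem_eq upd del: fun_upd_apply)

definition FunTo :: "'a \<Rightarrow> 'a \<Rightarrow> 'a \<Rightarrow> bool" where
  "FunTo f A B \<longleftrightarrow> FunOn f A \<and> (\<forall>x. x \<epsilon> A \<longrightarrow> app f x \<epsilon> B)"

lemma Def_FunTo [dfn]: "Trm t \<Longrightarrow> Trm u \<Longrightarrow> Trm v \<Longrightarrow> Def (\<lambda>\<rho>. FunTo (t \<rho>) (u \<rho>) (v \<rho>))"
  by (rule Def_app3) (unfold FunTo_def, intro dfn)

lemma sem_fun_to [sem_eq]:
  "f < d \<Longrightarrow> A < d \<Longrightarrow> B < d \<Longrightarrow> sem \<rho> (fun_to f A B d) \<longleftrightarrow> FunTo (\<rho> f) (\<rho> A) (\<rho> B)"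
  by (auto simp add: fun_to_def FunTo_def FunOn_iff sem_eq upd simp del: fun_upd_apply)

definition El :: "'a \<Rightarrow> 'a set" where "El A = {x. x \<epsilon> A}"

lemma El_iff [simp]: "x \<in> El A \<longleftrightarrow> x \<epsilon> A" by (simp add: El_def)

definition Eqp :: "'a \<Rightarrow> 'a \<Rightarrow> bool" where
  "Eqp A B \<longleftrightarrow> (\<exists>f. FunTo f A B \<and> (\<forall>x x'. x \<epsilon> A \<and> x' \<epsilon> A \<and> app f x = app f x' \<longrightarrow> x = x') \<and>
     (\<forall>y. y \<epsilon> B \<longrightarrow> (\<exists>x. x \<epsilon> A \<and> app f x = y)))"

lemma Def_Eqp [dfn]: "Trm t \<Longrightarrow> Trm u \<Longrightarrow> Def (\<lambda>\<rho>. Eqp (t \<rho>) (u \<rho>))"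
  by (rule Def_app2) (unfold Eqp_def, intro dfn)

lemma sem_equipotent [sem_eq]: "A < d \<Longrightarrow> B < d \<Longrightarrow> sem \<rho> (equipotent A B d) \<longleftrightarrow> Eqp (\<rho> A) (\<rho> B)"
proof -
  have "FunTo f A B \<and> (\<forall>x x' y. pair x y \<epsilon> f \<and> pair x' y \<epsilon> f \<longrightarrow> x = x') \<and>
     (\<forall>y. y \<epsilon> B \<longrightarrow> (\<exists>x. pair x y \<epsilon> f)) \<longleftrightarrow>
     FunTo f A B \<and> (\<forall>x x'. x \<epsilon> A \<and> x' \<epsilon> A \<and> app f x = app f x' \<longrightarrow> x = x') \<and>
     (\<forall>y. y \<epsilon> B \<longrightarrow> (\<exists>x. x \<epsilon> A \<and> app f x = y))" for f A B
  proof (cases "FunOn f A")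
    case True
    show ?thesis unfolding FunOn_iff [OF True] by (intro conj_cong refl; blast)
  qed (simp add: FunTo_def)
  then show "A < d \<Longrightarrow> B < d \<Longrightarrow> ?thesis"
    by (simp add: equipotent_def Eqp_def sem_eq upd del: fun_upd_apply)
qed

definition omega :: 'a ("\<omega>") where
  "\<omega> = Sep (SOME w. Inductive w) (\<lambda>n. \<forall>w. Inductive w \<longrightarrow> n \<epsilon> w)"

lemma mem_omega: "n \<epsilon> \<omega> \<longleftrightarrow> (\<forall>w. Inductive w \<longrightarrow> n \<epsilon> w)"
proof -
  have "\<exists>w. Inductive w"
    using model [of "Infinity 0"] by (simp add: ZF_def Infinity_def sem_eq upd del: fun_upd_apply)
  then have "Inductive (SOME w. Inductive w)" by (rule someI_ex)
  then show ?thesis unfolding omega_def by (subst mem_Sep, intro dfn) blast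
qed

lemma Inductive_omega: "Inductive \<omega>"
  by (auto simp: Inductive_def mem_omega)

lemma zero_omega [simp]: "\<emptyset> \<epsilon> \<omega>" and succ_omega [simp]: "n \<epsilon> \<omega> \<Longrightarrow> succ n \<epsilon> \<omega>"
  using Inductive_omega by (auto simp: Inductive_def)

lemma sem_is_omega [sem_eq]: "w < d \<Longrightarrow> sem \<rho> (is_omega w d) \<longleftrightarrow> \<rho> w = \<omega>"
proof -
  have "Inductive w \<and> (\<forall>v. Inductive v \<longrightarrow> Sub w v) \<longleftrightarrow> w = \<omega>" for w
    using Inductive_omega unfolding Sub_def by (auto intro!: ext simp: mem_omega)
  then show "w < d \<Longrightarrow> ?thesis"
    by (simp add: is_omega_def sem_eq upd del: fun_upd_apply)
qed

lemma sem_is_nat [sem_eq]: "n < d \<Longrightarrow> sem \<rho> (is_nat n d) \<longleftrightarrow> \<rho> n \<epsilon> \<omega>"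
  by (simp add: is_nat_def sem_eq upd del: fun_upd_apply)

definition Finite :: "'a \<Rightarrow> bool" where
  "Finite x \<longleftrightarrow> (\<exists>n. n \<epsilon> \<omega> \<and> Eqp x n)"

definition Countable :: "'a \<Rightarrow> bool" where
  "Countable A \<longleftrightarrow> (\<exists>s. Sub s \<omega> \<and> Eqp A s)"

definition Denumerable :: "'a \<Rightarrow> bool" where
  "Denumerable A \<longleftrightarrow> \<not> Finite A \<and> Countable A"

lemma Def_Finite [dfn]: "Trm t \<Longrightarrow> Def (\<lambda>\<rho>. Finite (t \<rho>))"
  by (rule Def_app1) (unfold Finite_def, intro dfn)

lemma Def_Countable [dfn]: "Trm t \<Longrightarrow> Def (\<lambda>\<rho>. Countable (t \<rho>))"
  by (rule Def_app1) (unfold Countable_def, intro dfn)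

lemma sem_cardinality [sem_eq]:
  "x < d \<Longrightarrow> sem \<rho> (is_finite x d) \<longleftrightarrow> Finite (\<rho> x)"
  "x < d \<Longrightarrow> sem \<rho> (is_countable x d) \<longleftrightarrow> Countable (\<rho> x)"
  "x < d \<Longrightarrow> sem \<rho> (is_denumerable x d) \<longleftrightarrow> Denumerable (\<rho> x)"
  by (simp_all add: is_finite_def is_countable_def is_denumerable_def Finite_def Countable_def
      Denumerable_def sem_eq upd del: fun_upd_apply)

definition CMC :: bool where
  "CMC \<longleftrightarrow> (\<forall>I A. Denumerable I \<and> FunOn A I \<and> (\<forall>i. i \<epsilon> I \<longrightarrow> Denumerable (app A i)) \<longrightarrow>
     (\<exists>f. FunOn f I \<and> (\<forall>i. i \<epsilon> I \<longrightarrow>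
        Sub (app f i) (app A i) \<and> app f i \<noteq> \<emptyset> \<and> Finite (app f i))))"

lemma sem_CMC_omega [sem_eq]: "sem \<rho> (CMC_omega d) \<longleftrightarrow> CMC"
proof -
  have "sem \<rho> (CMC_omega d) \<longleftrightarrow> (\<forall>I A. Denumerable I \<and> FunOn A I \<and>
       (\<forall>i a. pair i a \<epsilon> A \<longrightarrow> Denumerable a) \<longrightarrow>
     (\<exists>f. FunOn f I \<and> (\<forall>i a b. pair i a \<epsilon> A \<and> pair i b \<epsilon> f \<longrightarrow>
        Sub b a \<and> b \<noteq> \<emptyset> \<and> Finite b)))"
    by (simp add: CMC_omega_def sem_eq upd del: fun_upd_apply)
  also have "\<dots> \<longleftrightarrow> CMC"
    unfolding CMC_def
  proof (intro iff_allI)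
    fix I A
    show "(Denumerable I \<and> FunOn A I \<and> (\<forall>i a. pair i a \<epsilon> A \<longrightarrow> Denumerable a) \<longrightarrow>
     (\<exists>f. FunOn f I \<and> (\<forall>i a b. pair i a \<epsilon> A \<and> pair i b \<epsilon> f \<longrightarrow>
        Sub b a \<and> b \<noteq> \<emptyset> \<and> Finite b))) \<longleftrightarrow>
      (Denumerable I \<and> FunOn A I \<and> (\<forall>i. i \<epsilon> I \<longrightarrow> Denumerable (app A i)) \<longrightarrow>
     (\<exists>f. FunOn f I \<and> (\<forall>i. i \<epsilon> I \<longrightarrow>
        Sub (app f i) (app A i) \<and> app f i \<noteq> \<emptyset> \<and> Finite (app f i))))"
      by (cases "FunOn A I") (auto simp: FunOn_iff cong: conj_cong)
  qed
  finally show ?thesis .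
qed


section \<open>Natural numbers, recursion and cardinality in the model\<close>

text \<open>Restricted to definable predicates, because \<open>\<omega>\<close> may have nonstandard
  elements when seen from outside. The case \<open>def\<close> collects the definability
  obligation.\<close>

lemma omega_induct [consumes 1, case_names def zero succ]:
  assumes "n \<epsilon> \<omega>" "Def (\<lambda>\<rho>. P (\<rho> 0))" "P \<emptyset>" "\<And>n. n \<epsilon> \<omega> \<Longrightarrow> P n \<Longrightarrow> P (succ n)"
  shows "P n"
proof -
  have "Inductive (Sep \<omega> P)"
    unfolding Inductive_def using assms by (simp add: mem_Sep)
  then have "n \<epsilon> Sep \<omega> P" using assms(1) mem_omega by blast
  then show ?thesis using assms(2) by (simp add: mem_Sep)
qed

lemma succ_ne_zero [simp]: "succ n \<noteq> \<emptyset>" "\<emptyset> \<noteq> succ n"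
  using mem_succ not_mem_Empty by metis+

lemma succ_inj [simp]: "succ m = succ n \<longleftrightarrow> m = n"
  using mem_asym mem_succ by metis

lemma omega_trans: "n \<epsilon> \<omega> \<Longrightarrow> m \<epsilon> n \<Longrightarrow> m \<epsilon> \<omega>"
proof -
  have "\<forall>m. m \<epsilon> n \<longrightarrow> m \<epsilon> \<omega>" if "n \<epsilon> \<omega>" for n
    using that by (induction rule: omega_induct) (intro dfn, auto)
  then show "n \<epsilon> \<omega> \<Longrightarrow> m \<epsilon> n \<Longrightarrow> m \<epsilon> \<omega>" by blast
qed

lemma nat_trans: "n \<epsilon> \<omega> \<Longrightarrow> k \<epsilon> m \<Longrightarrow> m \<epsilon> n \<Longrightarrow> k \<epsilon> n"
proof -
  have "\<forall>m. m \<epsilon> n \<longrightarrow> (\<forall>k. k \<epsilon> m \<longrightarrow> k \<epsilon> n)" if "n \<epsilon> \<omega>" for n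
    using that by (induction rule: omega_induct) (intro dfn, auto)
  then show "n \<epsilon> \<omega> \<Longrightarrow> k \<epsilon> m \<Longrightarrow> m \<epsilon> n \<Longrightarrow> k \<epsilon> n" by blast
qed

lemma zero_mem_succ: "n \<epsilon> \<omega> \<Longrightarrow> n = \<emptyset> \<or> \<emptyset> \<epsilon> n"
  by (induction rule: omega_induct) (intro dfn, auto)

lemma succ_mem_succ: "n \<epsilon> \<omega> \<Longrightarrow> m \<epsilon> n \<Longrightarrow> succ m \<epsilon> succ n"
proof -
  have "\<forall>m. m \<epsilon> n \<longrightarrow> succ m \<epsilon> succ n" if "n \<epsilon> \<omega>" for n
    using that by (induction rule: omega_induct) (intro dfn, auto)
  then show "n \<epsilon> \<omega> \<Longrightarrow> m \<epsilon> n \<Longrightarrow> succ m \<epsilon> succ n" by blast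
qed

lemma nat_linear: "m \<epsilon> \<omega> \<Longrightarrow> n \<epsilon> \<omega> \<Longrightarrow> m \<epsilon> n \<or> m = n \<or> n \<epsilon> m"
proof (induction m rule: omega_induct)
  case def show ?case by (intro dfn)
next
  case zero then show ?case using zero_mem_succ by blast
next
  case (succ m)
  then show ?case using succ_mem_succ [of n m] by auto
qed

lemma nat_cases: "n \<epsilon> \<omega> \<Longrightarrow> n = \<emptyset> \<or> (\<exists>m. m \<epsilon> \<omega> \<and> n = succ m)"
  by (induction rule: omega_induct) (intro dfn, auto)

definition Least' :: "('a \<Rightarrow> bool) \<Rightarrow> 'a" where
  "Least' P = Union (Sep \<omega> (\<lambda>n. P n \<and> (\<forall>k. k \<epsilon> n \<longrightarrow> \<not> P k)))"

lemma Trm_Least' [dfn]: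
  assumes "Def (\<lambda>\<rho>. P (\<lambda>n. \<rho> (Suc n)) (\<rho> 0))"
  shows "Trm (\<lambda>\<rho>. Least' (P \<rho>))"
proof -
  let ?s = "\<lambda>i \<rho>. case i of 0 \<Rightarrow> \<rho> 0 | Suc j \<Rightarrow> \<rho> (Suc (Suc j))"
  have "Trm (?s i)" for i
    by (cases i) (auto simp: Trm_var)
  from Def_comp [where s = ?s, OF assms this]
  have "Def (\<lambda>\<rho>. P (\<lambda>n. \<rho> (Suc (Suc n))) (\<rho> 0))" by simp
  then show ?thesis unfolding Least'_def by (intro dfn assms)
qed

lemma Least'_props:
  assumes P: "Def (\<lambda>\<rho>. P (\<rho> 0))" and n: "n \<epsilon> \<omega>" "P n"
  shows "Least' P \<epsilon> \<omega>" "P (Least' P)" "\<And>k. k \<epsilon> Least' P \<Longrightarrow> \<not> P k"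
proof -
  \<comment> \<open>This alternative is inductive: if no element of \<open>n\<close> satisfies
    \<open>P\<close>, then either \<open>n\<close> is itself the least witness or no element of
    \<open>succ n\<close> satisfies \<open>P\<close>.\<close>
  have "(\<exists>m. m \<epsilon> \<omega> \<and> P m \<and> (\<forall>k. k \<epsilon> m \<longrightarrow> \<not> P k)) \<or> (\<forall>k. k \<epsilon> n \<longrightarrow> \<not> P k)" if "n \<epsilon> \<omega>" for n
    using that
  proof (induction rule: omega_induct)
    case def show ?case by (intro dfn P Def_app1 [OF P])
  qed auto
  then obtain m where m: "m \<epsilon> \<omega>" "P m" "\<And>k. k \<epsilon> m \<Longrightarrow> \<not> P k" using n by blast
  have "Def (\<lambda>\<rho>. P (\<rho> 0) \<and> (\<forall>k. k \<epsilon> \<rho> 0 \<longrightarrow> \<not> P k))" by (intro dfn P Def_app1 [OF P])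
  note Sep = mem_Sep [OF this]
  have "z \<epsilon> Sep \<omega> (\<lambda>n. P n \<and> (\<forall>k. k \<epsilon> n \<longrightarrow> \<not> P k)) \<longleftrightarrow> z = m" for z
    unfolding Sep using nat_linear [of z m] m by blast
  then have "Least' P = m"
    unfolding Least'_def by (rule Union_sing)
  with m show "Least' P \<epsilon> \<omega>" "P (Least' P)" "\<And>k. k \<epsilon> Least' P \<Longrightarrow> \<not> P k" by auto
qed

text \<open>The function is the smallest set that contains the initial pair and is closed under the
  step. A second value at some argument could be deleted without spoiling closure, against
  minimality.\<close>

lemma recursion:
  assumes "a \<epsilon> B" "Trm (\<lambda>\<rho>. g (\<rho> 0))" "\<And>x. x \<epsilon> B \<Longrightarrow> g x \<epsilon> B"
  obtains f where "FunTo f \<omega> B" "app f \<emptyset> = a" "\<And>n. n \<epsilon> \<omega> \<Longrightarrow> app f (succ n) = g (app f n)"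
proof -
  define C where "C S \<longleftrightarrow> pair \<emptyset> a \<epsilon> S \<and>
    (\<forall>n y. n \<epsilon> \<omega> \<and> y \<epsilon> B \<and> pair n y \<epsilon> S \<longrightarrow> pair (succ n) (g y) \<epsilon> S)" for S
  have DC: "Def (\<lambda>\<rho>. C (\<rho> 0))" unfolding C_def by (intro dfn Trm_app1 [OF assms(2)])
  define R where "R = Sep (prod \<omega> B) (\<lambda>p. \<forall>S. C S \<longrightarrow> p \<epsilon> S)"
  have R: "p \<epsilon> R \<longleftrightarrow> p \<epsilon> prod \<omega> B \<and> (\<forall>S. C S \<longrightarrow> p \<epsilon> S)" for p
    unfolding R_def by (rule mem_Sep) (intro dfn Def_app1 [OF DC])
  have CR: "C R" using assms unfolding C_def R by auto
  have min: "C S \<Longrightarrow> p \<epsilon> R \<Longrightarrow> p \<epsilon> S" for p S using R by blast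
  have uniq: "\<exists>!y. pair n y \<epsilon> R" if "n \<epsilon> \<omega>" for n
    using that
  proof (induction rule: omega_induct)
    case def show ?case by (intro dfn)
  next
    case zero
    have "y = a" if "pair \<emptyset> y \<epsilon> R" for y
    proof (rule ccontr)
      assume "y \<noteq> a"
      then have "C (diff R (sing (pair \<emptyset> y)))" using CR unfolding C_def by auto
      from min [OF this that] show False by simp
    qed
    moreover have "pair \<emptyset> a \<epsilon> R" using CR C_def by blast
    ultimately show ?case by blast
  next
    case (succ n)
    then obtain y0 where y0: "pair n y0 \<epsilon> R" "\<And>y. pair n y \<epsilon> R \<Longrightarrow> y = y0" by blast
    then have "y0 \<epsilon> B" using R by auto
    then have 1: "pair (succ n) (g y0) \<epsilon> R" using CR y0 succ(1) C_def by blast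
    have "y = g y0" if "pair (succ n) y \<epsilon> R" for y
    proof (rule ccontr)
      assume "y \<noteq> g y0"
      then have "C (diff R (sing (pair (succ n) y)))" using CR y0(2) unfolding C_def by auto
      from min [OF this that] show False by simp
    qed
    with 1 show ?case by blast
  qed
  have "FunOn R \<omega>" unfolding FunOn_def using uniq R by auto
  then have app: "app R n = y" if "pair n y \<epsilon> R" for n y using that FunOn_iff by simp
  have 0: "app R \<emptyset> = a" using CR app C_def by blast
  have B: "pair n (app R n) \<epsilon> R" "app R n \<epsilon> B" if "n \<epsilon> \<omega>" for n
    using that FunOn_iff [OF \<open>FunOn R \<omega>\<close>] R [of "pair n (app R n)"] by auto
  show thesis
    by (rule that [of R]) (use CR B app 0 \<open>FunOn R \<omega>\<close> in \<open>auto simp: FunTo_def C_def\<close>)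
qed

lemma EqpI:
  assumes "Trm (\<lambda>\<rho>. h (\<rho> 0))" "\<And>x. x \<epsilon> A \<Longrightarrow> h x \<epsilon> B" "\<And>x y. x \<epsilon> A \<Longrightarrow> y \<epsilon> A \<Longrightarrow> h x = h y \<Longrightarrow> x = y"
    "\<And>y. y \<epsilon> B \<Longrightarrow> \<exists>x. x \<epsilon> A \<and> h x = y"
  shows "Eqp A B"
proof -
  have app: "app (lam A h) x = h x" if "x \<epsilon> A" for x
    using assms(1) that by (rule app_lam)
  have "FunTo (lam A h) A B" using assms(1,2) by (simp add: FunTo_def FunOn_lam app)
  moreover have "x = x'" if "x \<epsilon> A" "x' \<epsilon> A" "app (lam A h) x = app (lam A h) x'" for x x'
    using that assms(3) by (simp add: app)
  moreover have "\<exists>x. x \<epsilon> A \<and> app (lam A h) x = y" if "y \<epsilon> B" for y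
    using assms(4) [OF that] app by auto
  ultimately show ?thesis unfolding Eqp_def by blast
qed

lemma CountableI:
  assumes h: "Trm (\<lambda>\<rho>. h (\<rho> 0))" and "\<And>x. x \<epsilon> A \<Longrightarrow> h x \<epsilon> \<omega>" "\<And>x y. x \<epsilon> A \<Longrightarrow> y \<epsilon> A \<Longrightarrow> h x = h y \<Longrightarrow> x = y"
  shows "Countable A"
proof -
  have "Eqp A (RepFun A h)"
    by (rule EqpI [OF h]) (use assms in \<open>auto simp: mem_RepFun\<close>)
  moreover have "Sub (RepFun A h) \<omega>" using assms by (auto simp: Sub_def mem_RepFun)
  ultimately show ?thesis unfolding Countable_def by blast
qed

lemma CountableE:
  assumes "Countable A"
  shows "\<exists>e. (\<forall>x. x \<epsilon> A \<longrightarrow> app e x \<epsilon> \<omega>) \<and> (\<forall>x y. x \<epsilon> A \<and> y \<epsilon> A \<and> app e x = app e y \<longrightarrow> x = y)"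
  using assms unfolding Countable_def Eqp_def FunTo_def Sub_def by blast

lemma Countable_omega: "Countable \<omega>"
  by (rule CountableI [of "\<lambda>x. x"]) (intro dfn)

text \<open>Preimages are not chosen: a point of the image is coded by the least code of its
  preimages, and two points with the same code share a preimage.\<close>

lemma Countable_image:
  assumes "Countable A" and h: "Trm (\<lambda>\<rho>. h (\<rho> 0))"
  shows "Countable (RepFun A h)"
proof -
  obtain e where e: "\<And>x. x \<epsilon> A \<Longrightarrow> app e x \<epsilon> \<omega>"
    "\<And>x y. x \<epsilon> A \<Longrightarrow> y \<epsilon> A \<Longrightarrow> app e x = app e y \<Longrightarrow> x = y"
    using CountableE [OF assms(1)] by blast
  define P where "P y n \<longleftrightarrow> (\<exists>x. x \<epsilon> A \<and> h x = y \<and> app e x = n)" for y n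
  have PU: "P y n \<Longrightarrow> P z n \<Longrightarrow> y = z" for y z n
    using e(2) unfolding P_def by blast
  have DP: "Def (\<lambda>\<rho>. P (\<rho> 0) (\<rho> (Suc 0)))" unfolding P_def by (intro dfn Trm_app1 [OF h])
  have D1: "Def (\<lambda>\<rho>. P y (\<rho> 0))" for y by (rule Def_app2 [OF DP]) (intro dfn)+
  have L: "Least' (P y) \<epsilon> \<omega>" "P y (Least' (P y))" if "y \<epsilon> RepFun A h" for y
  proof -
    obtain x where "x \<epsilon> A" "h x = y" using \<open>y \<epsilon> RepFun A h\<close> by (auto simp: mem_RepFun h)
    then show "Least' (P y) \<epsilon> \<omega>" "P y (Least' (P y))"
      using Least'_props [OF D1, of "app e x" y] e(1) unfolding P_def by blast+
  qed
  show ?thesis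
  proof (rule CountableI [of "\<lambda>y. Least' (P y)"])
    show "Trm (\<lambda>\<rho>. Least' (P (\<rho> 0)))" by (intro dfn Def_app2 [OF DP])
    show "x = y" if "x \<epsilon> RepFun A h" "y \<epsilon> RepFun A h" "Least' (P x) = Least' (P y)" for x y
    proof -
      have "P x (Least' (P x))" "P y (Least' (P x))" using L(2) [OF that(1)] L(2) [OF that(2)] that(3) by simp_all
      then show ?thesis by (rule PU)
    qed
  qed (rule L)
qed

lemma Countable_ins: "Countable A \<Longrightarrow> Countable (ins x A)"
proof -
  assume "Countable A"
  then obtain e where e: "\<And>x. x \<epsilon> A \<Longrightarrow> app e x \<epsilon> \<omega>"
    "\<And>x y. x \<epsilon> A \<Longrightarrow> y \<epsilon> A \<Longrightarrow> app e x = app e y \<Longrightarrow> x = y"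
    using CountableE [OF \<open>Countable A\<close>] by blast
  show ?thesis
    by (rule CountableI [of "\<lambda>y. if y = x then \<emptyset> else succ (app e y)"]; (intro dfn)?)
      (use e in \<open>auto split: if_splits\<close>)
qed

lemma Countable_succ: "Countable A \<Longrightarrow> Countable (succ A)"
  unfolding succ_def by (rule Countable_ins)

lemma Finite_empty [simp]: "Finite \<emptyset>"
  unfolding Finite_def
  by (rule exI [of _ \<emptyset>]) (auto intro: EqpI [of "\<lambda>x. x"] Trm_var)

lemma Finite_ins: "Finite A \<Longrightarrow> Finite (ins x A)"
proof (cases "x \<epsilon> A")
  case True
  then have "ins x A = A" by (auto intro: ext)
  then show "Finite A \<Longrightarrow> ?thesis" by simp
next
  case False
  assume "Finite A"
  then obtain n f where n: "n \<epsilon> \<omega>" and f: "\<And>x. x \<epsilon> A \<Longrightarrow> app f x \<epsilon> n"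
    "\<And>x x'. x \<epsilon> A \<Longrightarrow> x' \<epsilon> A \<Longrightarrow> app f x = app f x' \<Longrightarrow> x = x'"
    "\<And>y. y \<epsilon> n \<Longrightarrow> \<exists>x. x \<epsilon> A \<and> app f x = y"
    unfolding Finite_def Eqp_def FunTo_def by blast
  have "Eqp (ins x A) (succ n)"
  proof (rule EqpI [of "\<lambda>y. if y = x then n else app f y"])
    show "(if y = x then n else app f y) \<epsilon> succ n" if "y \<epsilon> ins x A" for y
      using that f(1) by auto
    show "y = z" if "y \<epsilon> ins x A" "z \<epsilon> ins x A"
      "(if y = x then n else app f y) = (if z = x then n else app f z)" for y z
    proof -
      have ne: "w \<epsilon> A \<Longrightarrow> app f w \<noteq> n" for w using f(1) [of w] mem_irrefl [of n] by auto
      show ?thesis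
        using that f(2) [of y z] ne [of y] ne [of z] by (cases "y = x"; cases "z = x") simp_all
    qed
    show "\<exists>z. z \<epsilon> ins x A \<and> (if z = x then n else app f z) = y" if y: "y \<epsilon> succ n" for y
    proof (cases "y = n")
      case True
      then show ?thesis by auto
    next
      case F: False
      then obtain z where "z \<epsilon> A" "app f z = y" using y f(3) [of y] by auto
      then show ?thesis using False by (intro exI [of _ z]) auto
    qed
  qed (intro dfn)
  then show ?thesis using n unfolding Finite_def by (meson succ_omega)
qed

lemma Finite_inj:
  assumes n: "n \<epsilon> \<omega>" and h: "Trm (\<lambda>\<rho>. h (\<rho> 0))" "\<And>x. x \<epsilon> A \<Longrightarrow> h x \<epsilon> n"
    "\<And>x y. x \<epsilon> A \<Longrightarrow> y \<epsilon> A \<Longrightarrow> h x = h y \<Longrightarrow> x = y"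
  shows "Finite A"
proof -
  \<comment> \<open>Quantifying over all \<open>A\<close> for one fixed \<open>f\<close> lets the
    induction step remove the point sent to \<open>n\<close> and continue with the rest.\<close>
  have "\<forall>A. (\<forall>x. x \<epsilon> A \<longrightarrow> app f x \<epsilon> n) \<and> (\<forall>x y. x \<epsilon> A \<and> y \<epsilon> A \<and> app f x = app f y \<longrightarrow> x = y) \<longrightarrow> Finite A"
    for f
    using n
  proof (induction rule: omega_induct)
    case def show ?case by (intro dfn)
  next
    case zero
    have "Finite A" if "\<forall>x. x \<epsilon> A \<longrightarrow> app f x \<epsilon> \<emptyset>" for A
      using that ex_mem [of A] by (cases "A = \<emptyset>") auto
    then show ?case by blast
  next
    case (succ n)
    show ?case
    proof (intro allI impI)
      fix A assume A: "(\<forall>x. x \<epsilon> A \<longrightarrow> app f x \<epsilon> succ n) \<and> (\<forall>x y. x \<epsilon> A \<and> y \<epsilon> A \<and> app f x = app f y \<longrightarrow> x = y)"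
      show "Finite A"
      proof (cases "\<exists>x. x \<epsilon> A \<and> app f x = n")
        case True
        then obtain x where x: "x \<epsilon> A" "app f x = n" by blast
        have "Finite (diff A (sing x))"
          by (rule succ.IH [rule_format]) (use A x in auto)
        then have "Finite (ins x (diff A (sing x)))" by (rule Finite_ins)
        moreover have "ins x (diff A (sing x)) = A" using x by (auto intro: ext)
        ultimately show ?thesis by simp
      next
        case False
        then show ?thesis by (intro succ.IH [rule_format]) (use A in auto)
      qed
    qed
  qed
  note fin = this [of "lam A h"]
  have app: "app (lam A h) x = h x" if "x \<epsilon> A" for x
    using h(1) that by (rule app_lam)
  have "\<forall>x. x \<epsilon> A \<longrightarrow> app (lam A h) x \<epsilon> n"
    "\<forall>x y. x \<epsilon> A \<and> y \<epsilon> A \<and> app (lam A h) x = app (lam A h) y \<longrightarrow> x = y"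
    using h(2,3) by (auto simp: app)
  then show ?thesis using fin by blast
qed

text \<open>As for countable images, the least code of a preimage injects the image into the same
  natural number.\<close>

lemma Finite_image:
  assumes "Finite A" and h: "Trm (\<lambda>\<rho>. h (\<rho> 0))"
  shows "Finite (RepFun A h)"
proof -
  obtain n f where n: "n \<epsilon> \<omega>" and f: "\<And>x. x \<epsilon> A \<Longrightarrow> app f x \<epsilon> n"
    "\<And>x x'. x \<epsilon> A \<Longrightarrow> x' \<epsilon> A \<Longrightarrow> app f x = app f x' \<Longrightarrow> x = x'"
    using assms(1) unfolding Finite_def Eqp_def FunTo_def by blast
  define P where "P y n \<longleftrightarrow> (\<exists>x. x \<epsilon> A \<and> h x = y \<and> app f x = n)" for y n
  have PU: "P y n \<Longrightarrow> P z n \<Longrightarrow> y = z" for y z n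
    using f(2) unfolding P_def by blast
  have DP: "Def (\<lambda>\<rho>. P (\<rho> 0) (\<rho> (Suc 0)))" unfolding P_def by (intro dfn Trm_app1 [OF h])
  have D1: "Def (\<lambda>\<rho>. P y (\<rho> 0))" for y by (rule Def_app2 [OF DP]) (intro dfn)+
  have L: "P y (Least' (P y))" if "y \<epsilon> RepFun A h" for y
  proof -
    obtain x where "x \<epsilon> A" "h x = y" using \<open>y \<epsilon> RepFun A h\<close> by (auto simp: mem_RepFun h)
    then show "P y (Least' (P y))"
      using Least'_props(2) [OF D1, of "app f x" y] f(1) n omega_trans unfolding P_def by blast
  qed
  show ?thesis
  proof (rule Finite_inj [OF n, of "\<lambda>y. Least' (P y)"])
    show "Trm (\<lambda>\<rho>. Least' (P (\<rho> 0)))" by (intro dfn Def_app2 [OF DP])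
    show "Least' (P x) \<epsilon> n" if x: "x \<epsilon> RepFun A h" for x
    proof -
      obtain z where "z \<epsilon> A" "app f z = Least' (P x)" using L [OF x] P_def by blast
      then show ?thesis using f(1) [of z] by simp
    qed
    show "x = y" if "x \<epsilon> RepFun A h" "y \<epsilon> RepFun A h" "Least' (P x) = Least' (P y)" for x y
    proof -
      have "P x (Least' (P x))" "P y (Least' (P x))" using L [OF that(1)] L [OF that(2)] that(3) by simp_all
      then show ?thesis by (rule PU)
    qed
  qed
qed

lemma Finite_subset: "Finite A \<Longrightarrow> Sub B A \<Longrightarrow> Finite B"
proof -
  assume "Finite A" "Sub B A"
  then obtain n f where n: "n \<epsilon> \<omega>" and f: "\<And>x. x \<epsilon> A \<Longrightarrow> app f x \<epsilon> n"
    "\<And>x x'. x \<epsilon> A \<Longrightarrow> x' \<epsilon> A \<Longrightarrow> app f x = app f x' \<Longrightarrow> x = x'"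
    unfolding Finite_def Eqp_def FunTo_def by blast
  show ?thesis
    by (rule Finite_inj [OF n, of "app f"]) (intro dfn, use f \<open>Sub B A\<close> in \<open>auto simp: Sub_def\<close>)
qed

lemma Finite_sing [simp]: "Finite (sing x)"
proof -
  have "sing x = ins x \<emptyset>" by (auto intro: ext)
  then show ?thesis using Finite_ins by simp
qed

text \<open>Induction on the number of elements; the step removes the point numbered
  \<open>n\<close>.\<close>

lemma Finite_induct [consumes 1, case_names def empty ins]:
  assumes "Finite A" and P: "Def (\<lambda>\<rho>. P (\<rho> 0))" and "P \<emptyset>" "\<And>x A. Finite A \<Longrightarrow> P A \<Longrightarrow> P (ins x A)"
  shows "P A"
proof -
  have "\<forall>A. Eqp A n \<longrightarrow> P A" if "n \<epsilon> \<omega>" for n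
    using that
  proof (induction rule: omega_induct)
    case def show ?case by (intro dfn Def_app1 [OF P])
  next
    case zero
    have "A = \<emptyset>" if "Eqp A \<emptyset>" for A
      using that ex_mem [of A] unfolding Eqp_def FunTo_def by auto
    then show ?case using assms(3) by blast
  next
    case (succ n)
    show ?case
    proof (intro allI impI)
      fix A assume "Eqp A (succ n)"
      then obtain f where f: "\<And>x. x \<epsilon> A \<Longrightarrow> app f x \<epsilon> succ n"
        "\<And>x x'. x \<epsilon> A \<Longrightarrow> x' \<epsilon> A \<Longrightarrow> app f x = app f x' \<Longrightarrow> x = x'"
        "\<And>y. y \<epsilon> succ n \<Longrightarrow> \<exists>x. x \<epsilon> A \<and> app f x = y"
        unfolding Eqp_def FunTo_def by blast
      obtain x where x: "x \<epsilon> A" "app f x = n" using f(3) [of n] by auto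
      have "Eqp (diff A (sing x)) n"
        by (rule EqpI [of "app f"]; (intro dfn)?) (use f x mem_irrefl in \<open>auto, metis+\<close>)
      then have "P (diff A (sing x))" "Finite (diff A (sing x))"
        using succ unfolding Finite_def by auto
      then have "P (ins x (diff A (sing x)))" using assms(4) by blast
      moreover have "ins x (diff A (sing x)) = A" using x by (auto intro: ext)
      ultimately show "P A" by simp
    qed
  qed
  then show ?thesis using assms(1) unfolding Finite_def by blast
qed

lemma Finite_un: "Finite A \<Longrightarrow> Finite B \<Longrightarrow> Finite (un A B)"
proof (induction A rule: Finite_induct)
  case def show ?case by (intro dfn)
next
  case empty
  have "un \<emptyset> B = B" by (auto intro: ext)
  then show ?case using empty by simp
next
  case (ins x A)
  have "un (ins x A) B = ins x (un A B)" by (auto intro: ext)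
  then show ?case using ins Finite_ins by simp
qed

end

section \<open>Arithmetic in the model\<close>

context zf
begin

text \<open>Addition with a fixed left argument as an element of the model. Its uniqueness on
  \<open>\<omega>\<close> makes the description in \<open>add\<close> denote a single
  number.\<close>

definition AddFun :: "'a \<Rightarrow> 'a \<Rightarrow> bool" where
  "AddFun m f \<longleftrightarrow> FunTo f \<omega> \<omega> \<and> app f \<emptyset> = m \<and> (\<forall>k. k \<epsilon> \<omega> \<longrightarrow> app f (succ k) = succ (app f k))"

definition add :: "'a \<Rightarrow> 'a \<Rightarrow> 'a" where
  "add m n = Union (Sep \<omega> (\<lambda>p. \<exists>f. AddFun m f \<and> p = app f n))"

lemma Def_AddFun [dfn]: "Trm t \<Longrightarrow> Trm u \<Longrightarrow> Def (\<lambda>\<rho>. AddFun (t \<rho>) (u \<rho>))"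
  by (rule Def_app2) (unfold AddFun_def, intro dfn)

lemma Trm_add [dfn]: "Trm t \<Longrightarrow> Trm u \<Longrightarrow> Trm (\<lambda>\<rho>. add (t \<rho>) (u \<rho>))"
  by (rule Trm_app2) (unfold add_def, intro dfn)

lemma AddFun_unique:
  assumes "AddFun m f" "AddFun m g" "n \<epsilon> \<omega>" shows "app f n = app g n"
  using assms(3)
proof (induction rule: omega_induct)
  case def show ?case by (intro dfn)
qed (use assms(1,2) in \<open>simp_all add: AddFun_def\<close>)

lemma add_eq: "AddFun m f \<Longrightarrow> n \<epsilon> \<omega> \<Longrightarrow> add m n = app f n"
proof -
  assume f: "AddFun m f" and n: "n \<epsilon> \<omega>"
  then have "app f n \<epsilon> \<omega>" by (simp add: AddFun_def FunTo_def)
  then have "z \<epsilon> \<omega> \<and> (\<exists>g. AddFun m g \<and> z = app g n) \<longleftrightarrow> z = app f n" for z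
    using f AddFun_unique [OF _ f n] by metis
  then show ?thesis
    unfolding add_def by (intro Union_sing) (subst mem_Sep, intro dfn, assumption)
qed

lemma AddFun_ex: "m \<epsilon> \<omega> \<Longrightarrow> \<exists>f. AddFun m f"
proof -
  assume "m \<epsilon> \<omega>"
  moreover have "Trm (\<lambda>\<rho>. succ (\<rho> 0))" by (intro dfn)
  ultimately obtain f where "FunTo f \<omega> \<omega>" "app f \<emptyset> = m" "\<And>n. n \<epsilon> \<omega> \<Longrightarrow> app f (succ n) = succ (app f n)"
    using recursion [of m \<omega> succ] succ_omega by metis
  then show ?thesis unfolding AddFun_def by blast
qed

lemma
  assumes "m \<epsilon> \<omega>"
  shows add_zero [simp]: "add m \<emptyset> = m"
    and add_succ [simp]: "n \<epsilon> \<omega> \<Longrightarrow> add m (succ n) = succ (add m n)"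
    and add_omega [simp]: "n \<epsilon> \<omega> \<Longrightarrow> add m n \<epsilon> \<omega>"
proof -
  obtain f where f: "AddFun m f" using AddFun_ex [OF assms] by blast
  show "add m \<emptyset> = m" "n \<epsilon> \<omega> \<Longrightarrow> add m (succ n) = succ (add m n)"
    "n \<epsilon> \<omega> \<Longrightarrow> add m n \<epsilon> \<omega>"
    using f by (simp_all add: add_eq [OF f]) (simp_all add: AddFun_def FunTo_def)
qed

definition MulFun :: "'a \<Rightarrow> 'a \<Rightarrow> bool" where
  "MulFun m f \<longleftrightarrow> FunTo f \<omega> \<omega> \<and> app f \<emptyset> = \<emptyset> \<and> (\<forall>k. k \<epsilon> \<omega> \<longrightarrow> app f (succ k) = add (app f k) m)"

definition mul :: "'a \<Rightarrow> 'a \<Rightarrow> 'a" where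
  "mul m n = Union (Sep \<omega> (\<lambda>p. \<exists>f. MulFun m f \<and> p = app f n))"

lemma Def_MulFun [dfn]: "Trm t \<Longrightarrow> Trm u \<Longrightarrow> Def (\<lambda>\<rho>. MulFun (t \<rho>) (u \<rho>))"
  by (rule Def_app2) (unfold MulFun_def, intro dfn)

lemma Trm_mul [dfn]: "Trm t \<Longrightarrow> Trm u \<Longrightarrow> Trm (\<lambda>\<rho>. mul (t \<rho>) (u \<rho>))"
  by (rule Trm_app2) (unfold mul_def, intro dfn)

lemma MulFun_unique:
  assumes "MulFun m f" "MulFun m g" "n \<epsilon> \<omega>" shows "app f n = app g n"
  using assms(3)
proof (induction rule: omega_induct)
  case def show ?case by (intro dfn)
qed (use assms(1,2) in \<open>simp_all add: MulFun_def\<close>)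

lemma mul_eq: "MulFun m f \<Longrightarrow> n \<epsilon> \<omega> \<Longrightarrow> mul m n = app f n"
proof -
  assume f: "MulFun m f" and n: "n \<epsilon> \<omega>"
  then have "app f n \<epsilon> \<omega>" by (simp add: MulFun_def FunTo_def)
  then have "z \<epsilon> \<omega> \<and> (\<exists>g. MulFun m g \<and> z = app g n) \<longleftrightarrow> z = app f n" for z
    using f MulFun_unique [OF _ f n] by metis
  then show ?thesis
    unfolding mul_def by (intro Union_sing) (subst mem_Sep, intro dfn, assumption)
qed

lemma MulFun_ex: "m \<epsilon> \<omega> \<Longrightarrow> \<exists>f. MulFun m f"
proof -
  assume m: "m \<epsilon> \<omega>"
  have "Trm (\<lambda>\<rho>. add (\<rho> 0) m)" by (intro dfn)
  then obtain f where "FunTo f \<omega> \<omega>" "app f \<emptyset> = \<emptyset>" "\<And>n. n \<epsilon> \<omega> \<Longrightarrow> app f (succ n) = add (app f n) m"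
    using recursion [of \<emptyset> \<omega> "\<lambda>k. add k m"] add_omega [OF _ m] zero_omega by metis
  then show ?thesis unfolding MulFun_def by blast
qed

lemma
  assumes "m \<epsilon> \<omega>"
  shows mul_zero [simp]: "mul m \<emptyset> = \<emptyset>"
    and mul_succ [simp]: "n \<epsilon> \<omega> \<Longrightarrow> mul m (succ n) = add (mul m n) m"
    and mul_omega [simp]: "n \<epsilon> \<omega> \<Longrightarrow> mul m n \<epsilon> \<omega>"
proof -
  obtain f where f: "MulFun m f" using MulFun_ex [OF assms] by blast
  show "mul m \<emptyset> = \<emptyset>" "n \<epsilon> \<omega> \<Longrightarrow> mul m (succ n) = add (mul m n) m"
    "n \<epsilon> \<omega> \<Longrightarrow> mul m n \<epsilon> \<omega>"
    using f by (simp_all add: mul_eq [OF f]) (simp_all add: MulFun_def FunTo_def)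
qed

lemma sem_nat_add [sem_eq]:
  assumes "m < d" "n < d" "p < d"
  shows "sem \<rho> (nat_add m n p d) \<longleftrightarrow> \<rho> m \<epsilon> \<omega> \<and> \<rho> n \<epsilon> \<omega> \<and> \<rho> p = add (\<rho> m) (\<rho> n)"
proof -
  have "FunTo f \<omega> \<omega> \<and> pair \<emptyset> x \<epsilon> f \<and> (\<forall>k r. pair k r \<epsilon> f \<longrightarrow> pair (succ k) (succ r) \<epsilon> f) \<and> pair y z \<epsilon> f
    \<longleftrightarrow> AddFun x f \<and> y \<epsilon> \<omega> \<and> z = app f y" for f x y z
  proof (cases "FunTo f \<omega> \<omega>")
    case True
    then have "FunOn f \<omega>" by (simp add: FunTo_def)
    then show ?thesis using True by (auto simp: AddFun_def FunOn_iff)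
  qed (simp add: AddFun_def)
  moreover have "(\<exists>f. AddFun x f \<and> y \<epsilon> \<omega> \<and> z = app f y) \<longleftrightarrow> x \<epsilon> \<omega> \<and> y \<epsilon> \<omega> \<and> z = add x y" for x y z
    using add_eq AddFun_ex by (auto simp: AddFun_def FunTo_def) metis
  ultimately show ?thesis
    using assms by (simp add: nat_add_def sem_eq upd del: fun_upd_apply)
qed

text \<open>The formula must demand separately that \<open>m\<close> is a natural number, since its
  recursion starts from 0. For addition this follows, because there the recursion starts from
  \<open>m\<close>.\<close>

lemma sem_nat_mult [sem_eq]:
  assumes "m < d" "n < d" "p < d"
  shows "sem \<rho> (nat_mult m n p d) \<longleftrightarrow> \<rho> m \<epsilon> \<omega> \<and> \<rho> n \<epsilon> \<omega> \<and> \<rho> p = mul (\<rho> m) (\<rho> n)"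
proof -
  have 1: "x \<epsilon> \<omega> \<and> FunTo f \<omega> \<omega> \<and> pair \<emptyset> \<emptyset> \<epsilon> f \<and>
      (\<forall>k r. pair k r \<epsilon> f \<and> r \<epsilon> \<omega> \<and> x \<epsilon> \<omega> \<longrightarrow> pair (succ k) (add r x) \<epsilon> f) \<and> pair y z \<epsilon> f
    \<longleftrightarrow> x \<epsilon> \<omega> \<and> MulFun x f \<and> y \<epsilon> \<omega> \<and> z = app f y" for f x y z
  proof (cases "FunTo f \<omega> \<omega>")
    case True
    then have "FunOn f \<omega>" by (simp add: FunTo_def)
    then show ?thesis using True by (auto simp: MulFun_def FunOn_iff) (auto simp: FunTo_def)
  qed (simp add: MulFun_def)
  have 2: "(\<exists>f. x \<epsilon> \<omega> \<and> MulFun x f \<and> y \<epsilon> \<omega> \<and> z = app f y) \<longleftrightarrow> x \<epsilon> \<omega> \<and> y \<epsilon> \<omega> \<and> z = mul x y" for x y z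
    using mul_eq MulFun_ex by auto metis
  have "x \<epsilon> \<omega> \<and> (\<exists>f. FunTo f \<omega> \<omega> \<and> pair \<emptyset> \<emptyset> \<epsilon> f \<and>
      (\<forall>k r. pair k r \<epsilon> f \<and> r \<epsilon> \<omega> \<and> x \<epsilon> \<omega> \<longrightarrow> pair (succ k) (add r x) \<epsilon> f) \<and> pair y z \<epsilon> f)
    \<longleftrightarrow> x \<epsilon> \<omega> \<and> y \<epsilon> \<omega> \<and> z = mul x y" for x y z
    using 1 [of x _ y z] 2 [of x y z] by blast
  then show ?thesis
    using assms by (simp add: nat_mult_def sem_eq upd del: fun_upd_apply)
qed

lemma zero_add [simp]: "m \<epsilon> \<omega> \<Longrightarrow> add \<emptyset> m = m"
  by (induction rule: omega_induct) (intro dfn, auto)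

lemma succ_add [simp]: "n \<epsilon> \<omega> \<Longrightarrow> m \<epsilon> \<omega> \<Longrightarrow> add (succ m) n = succ (add m n)"
  by (induction rule: omega_induct) (intro dfn, auto)

lemma add_comm: "n \<epsilon> \<omega> \<Longrightarrow> m \<epsilon> \<omega> \<Longrightarrow> add m n = add n m"
  by (induction rule: omega_induct) (intro dfn, auto)

lemma add_assoc: "k \<epsilon> \<omega> \<Longrightarrow> m \<epsilon> \<omega> \<Longrightarrow> n \<epsilon> \<omega> \<Longrightarrow> add (add m n) k = add m (add n k)"
  by (induction rule: omega_induct) (intro dfn, auto)

lemma add_cancel: "k \<epsilon> \<omega> \<Longrightarrow> m \<epsilon> \<omega> \<Longrightarrow> n \<epsilon> \<omega> \<Longrightarrow> add m k = add n k \<Longrightarrow> m = n"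
  by (induction rule: omega_induct) (intro dfn, auto)

lemma zero_mul [simp]: "m \<epsilon> \<omega> \<Longrightarrow> mul \<emptyset> m = \<emptyset>"
  by (induction rule: omega_induct) (intro dfn, auto)

lemma succ_mul: "n \<epsilon> \<omega> \<Longrightarrow> m \<epsilon> \<omega> \<Longrightarrow> mul (succ m) n = add (mul m n) n"
proof (induction rule: omega_induct)
  case def show ?case by (intro dfn)
next
  case (succ n)
  then have "add (add (mul m n) n) m = add (add (mul m n) m) n"
    by (simp add: add_assoc add_comm [of n m])
  with succ show ?case by simp
qed simp

lemma mul_comm: "n \<epsilon> \<omega> \<Longrightarrow> m \<epsilon> \<omega> \<Longrightarrow> mul m n = mul n m"
  by (induction rule: omega_induct) (intro dfn, auto simp: succ_mul)

lemma add_mul: "k \<epsilon> \<omega> \<Longrightarrow> m \<epsilon> \<omega> \<Longrightarrow> n \<epsilon> \<omega> \<Longrightarrow> mul (add m n) k = add (mul m k) (mul n k)"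
proof (induction rule: omega_induct)
  case def show ?case by (intro dfn)
next
  case (succ k)
  have "add (add (mul m k) (mul n k)) (add m n) = add (mul m k) (add (mul n k) (add m n))"
    using succ by (simp add: add_assoc)
  also have "add (mul n k) (add m n) = add m (add (mul n k) n)"
    using succ by (simp add: add_comm [of _ m] add_assoc add_comm [of n "mul n k"])
      (metis add_assoc add_comm add_omega mul_omega)
  finally show ?case using succ by (simp add: add_assoc)
qed simp

lemma mul_assoc: "k \<epsilon> \<omega> \<Longrightarrow> m \<epsilon> \<omega> \<Longrightarrow> n \<epsilon> \<omega> \<Longrightarrow> mul (mul m n) k = mul m (mul n k)"
proof (induction rule: omega_induct)
  case def show ?case by (intro dfn)
next
  case (succ k)
  then have "mul m (add (mul n k) n) = add (mul m (mul n k)) (mul m n)"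
    using add_mul [of m "mul n k" n] by (simp add: mul_comm [of _ m])
  with succ show ?case by simp
qed simp

text \<open>The order given by membership is thereby expressed through addition, the form in which
  it passes to the algebraic copy of \<open>\<omega>\<close>.\<close>

lemma mem_iff_add: "n \<epsilon> \<omega> \<Longrightarrow> m \<epsilon> \<omega> \<Longrightarrow> m \<epsilon> n \<longleftrightarrow> (\<exists>k. k \<epsilon> \<omega> \<and> n = add m (succ k))"
proof -
  assume m: "m \<epsilon> \<omega>" and n: "n \<epsilon> \<omega>"
  have "m \<epsilon> add m (succ k)" if "k \<epsilon> \<omega>" for k
    using that m by (induction rule: omega_induct) (intro dfn, auto)
  moreover have "m \<epsilon> n \<longrightarrow> (\<exists>k. k \<epsilon> \<omega> \<and> n = add m (succ k))"
    using n
  proof (induction rule: omega_induct)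
    case def show ?case by (intro dfn)
  next
    case (succ n)
    show ?case
    proof
      assume "m \<epsilon> succ n"
      then consider "m \<epsilon> n" | "m = n" by auto
      then show "\<exists>k. k \<epsilon> \<omega> \<and> succ n = add m (succ k)"
      proof cases
        case 1
        with succ obtain k where "k \<epsilon> \<omega>" "n = add m (succ k)" by blast
        then show ?thesis using m by (intro exI [of _ "succ k"]) simp
      next
        case 2
        then show ?thesis using m by (intro exI [of _ \<emptyset>]) simp
      qed
    qed
  qed simp
  ultimately show ?thesis by blast
qed

end

section \<open>An ordered field over the model's natural numbers\<close>

locale nat_laws =
  fixes S :: "'a set" and add mul :: "'a \<Rightarrow> 'a \<Rightarrow> 'a" and z u :: 'a
  assumes closed: "z \<in> S" "u \<in> S" "a \<in> S \<Longrightarrow> b \<in> S \<Longrightarrow> add a b \<in> S"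
      "a \<in> S \<Longrightarrow> b \<in> S \<Longrightarrow> mul a b \<in> S"
    and add_laws: "a \<in> S \<Longrightarrow> b \<in> S \<Longrightarrow> c \<in> S \<Longrightarrow> add (add a b) c = add a (add b c)"
      "a \<in> S \<Longrightarrow> b \<in> S \<Longrightarrow> add a b = add b a" "a \<in> S \<Longrightarrow> add z a = a"
      "a \<in> S \<Longrightarrow> b \<in> S \<Longrightarrow> c \<in> S \<Longrightarrow> add a c = add b c \<Longrightarrow> a = b"
    and mul_laws: "a \<in> S \<Longrightarrow> b \<in> S \<Longrightarrow> c \<in> S \<Longrightarrow> mul (mul a b) c = mul a (mul b c)"
      "a \<in> S \<Longrightarrow> b \<in> S \<Longrightarrow> mul a b = mul b a" "a \<in> S \<Longrightarrow> mul u a = a" "a \<in> S \<Longrightarrow> mul z a = z"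
      "a \<in> S \<Longrightarrow> b \<in> S \<Longrightarrow> c \<in> S \<Longrightarrow> mul (add a b) c = add (mul a c) (mul b c)"
    and order_laws: "a \<in> S \<Longrightarrow> b \<in> S \<Longrightarrow> \<exists>k\<in>S. b = add a k \<or> a = add b k"
      "a \<in> S \<Longrightarrow> b \<in> S \<Longrightarrow> add a b = z \<Longrightarrow> a = z" "u \<noteq> z"
      "a \<in> S \<Longrightarrow> b \<in> S \<Longrightarrow> mul a b = z \<Longrightarrow> a = z \<or> b = z"

lemma (in zf) nat_laws_omega: "nat_laws (El \<omega>) add mul \<emptyset> (succ \<emptyset>)"
proof
  fix a b c assume "a \<in> El \<omega>" "b \<in> El \<omega>"
  then have a: "a \<epsilon> \<omega>" and b: "b \<epsilon> \<omega>" by auto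
  show "\<exists>k\<in>El \<omega>. b = add a k \<or> a = add b k"
    using nat_linear [OF a b]
  proof (elim disjE)
    assume "a = b" then show ?thesis using a by (intro bexI [of _ \<emptyset>]) auto
  qed (use a b in \<open>auto simp: mem_iff_add\<close>)
  show "a = \<emptyset>" if "add a b = \<emptyset>"
    using that a nat_cases [OF b] by auto
  show "a = \<emptyset> \<or> b = \<emptyset>" if "mul a b = \<emptyset>"
    using that nat_cases [OF a] nat_cases [OF b] by auto
qed (auto simp: add_assoc add_mul succ_mul intro: add_comm mul_comm mul_assoc add_cancel)

lemma nat_laws_nat: "nat_laws UNIV (+) (*) 0 (1 :: nat)"
  by unfold_locales (auto simp: algebra_simps dest: le_Suc_ex, metis le_Suc_ex nat_le_linear)

text \<open>Types cannot depend on the assumption that a given structure is a model. So a model refuting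
  the theorem, if there is one, is fixed once and for all, and its natural numbers become a type.\<close>

definition refutes :: "(nat \<Rightarrow> nat \<Rightarrow> bool) \<Rightarrow> bool" where
  "refutes E \<longleftrightarrow> zf E \<and> (\<exists>\<rho>. (\<exists>s\<in>{sentence_i, sentence_ii, sentence_iii, sentence_iv, sentence_v}.
     sat UNIV E \<rho> (s 0)) \<and> \<not> sat UNIV E \<rho> (CMC_omega 0))"

definition refuting :: "nat \<Rightarrow> nat \<Rightarrow> bool" where
  "refuting = (SOME E. refutes E)"

text \<open>If no model is at hand, the standard numbers take over. The laws of
  \<open>nat_laws\<close> then hold unconditionally, as a type and its class instances
  require.\<close>

definition num_set :: "nat set" where
  "num_set = (if zf refuting then zf.El refuting (zf.omega refuting) else UNIV)"
definition num_add :: "nat \<Rightarrow> nat \<Rightarrow> nat" where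
  "num_add = (if zf refuting then zf.add refuting else (+))"
definition num_mul :: "nat \<Rightarrow> nat \<Rightarrow> nat" where
  "num_mul = (if zf refuting then zf.mul refuting else (*))"
definition num_zero :: nat where
  "num_zero = (if zf refuting then zf.Empty refuting else 0)"
definition num_one :: nat where
  "num_one = (if zf refuting then zf.succ refuting (zf.Empty refuting) else 1)"

interpretation wnat: nat_laws num_set num_add num_mul num_zero num_one
  unfolding num_set_def num_add_def num_mul_def num_zero_def num_one_def
  using nat_laws_nat zf.nat_laws_omega by (cases "zf refuting") simp_all

typedef wnat = num_set
  using wnat.closed by blast

setup_lifting type_definition_wnat

instantiation wnat :: "{comm_semiring_1, linorder}"
begin

lift_definition zero_wnat :: wnat is num_zero by (rule wnat.closed)
lift_definition one_wnat :: wnat is num_one by (rule wnat.closed)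
lift_definition plus_wnat :: "wnat \<Rightarrow> wnat \<Rightarrow> wnat" is num_add by (rule wnat.closed)
lift_definition times_wnat :: "wnat \<Rightarrow> wnat \<Rightarrow> wnat" is num_mul by (rule wnat.closed)

definition less_eq_wnat :: "wnat \<Rightarrow> wnat \<Rightarrow> bool" where "a \<le> (b :: wnat) \<longleftrightarrow> (\<exists>k. b = a + k)"
definition less_wnat :: "wnat \<Rightarrow> wnat \<Rightarrow> bool" where "a < (b :: wnat) \<longleftrightarrow> a \<le> b \<and> a \<noteq> b"

lemma wnat_cancel: "a + c = b + c \<Longrightarrow> a = b" for a b c :: wnat
  by transfer (rule wnat.add_laws)

lemma wnat_zero_sum: "a + b = 0 \<Longrightarrow> a = 0" for a b :: wnat
  by transfer (rule wnat.order_laws)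

lemma wnat_linear: "\<exists>k. b = a + k \<or> a = b + k" for a b :: wnat
  by transfer (use wnat.order_laws(1) in \<open>simp add: Bex_def\<close>)

lemma wnat_add_ac: "a + b + c = a + (b + c)" "a + b = b + a" "0 + a = a" for a b c :: wnat
  by (transfer; rule wnat.add_laws; assumption)+

lemma wnat_mul_comm: "a * b = b * a" for a b :: wnat
  by transfer (rule wnat.mul_laws)

instance
proof
  fix a b c :: wnat
  show "a + b + c = a + (b + c)" "a + b = b + a" "0 + a = a" by (fact wnat_add_ac)+
  show "a * b * c = a * (b * c)" "a * b = b * a" "1 * a = a" "0 * a = 0"
    "(a + b) * c = a * c + b * c"
    by (transfer; rule wnat.mul_laws; assumption)+
  then show "a * 0 = 0" by (metis wnat_mul_comm)
  show "0 \<noteq> (1 :: wnat)" using wnat.order_laws(3) by transfer simp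
  have anti: "a = b" if "a \<le> b" "b \<le> a" for a b :: wnat
  proof -
    from that obtain k l where kl: "b = a + k" "a = b + l" by (auto simp: less_eq_wnat_def)
    then have "(k + l) + a = 0 + a" by (metis wnat_add_ac)
    then have "k = 0" using wnat_cancel wnat_zero_sum by blast
    then show ?thesis using kl by (metis wnat_add_ac(2,3))
  qed
  show "a < b \<longleftrightarrow> a \<le> b \<and> \<not> b \<le> a"
    using anti unfolding less_wnat_def by (metis less_eq_wnat_def wnat_add_ac(2,3))
  show "a \<le> a" unfolding less_eq_wnat_def by (metis wnat_add_ac(2,3))
  show "a \<le> b \<Longrightarrow> b \<le> c \<Longrightarrow> a \<le> c" unfolding less_eq_wnat_def by (metis wnat_add_ac(1))
  show "a \<le> b \<Longrightarrow> b \<le> a \<Longrightarrow> a = b" by (rule anti)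
  show "a \<le> b \<or> b \<le> a" using wnat_linear unfolding less_eq_wnat_def by metis
qed

end

lemma wnat_no_zero_div: "a * b = 0 \<Longrightarrow> a = 0 \<or> b = 0" for a b :: wnat
  by transfer (rule wnat.order_laws)

lemma wnat_add_le: "c + a \<le> c + b \<longleftrightarrow> a \<le> b" for a b c :: wnat
  unfolding less_eq_wnat_def by (metis add.assoc add.commute wnat_cancel)

lemma wnat_add_less: "c + a < c + b \<longleftrightarrow> a < b" for a b c :: wnat
  unfolding less_wnat_def wnat_add_le by (metis add.commute wnat_cancel)

lemma wnat_mul_mono: "a < b \<Longrightarrow> c \<noteq> 0 \<Longrightarrow> c * a < c * b" for a b c :: wnat
proof -
  assume "a < b" "c \<noteq> 0"
  then obtain k where k: "b = a + k" "a \<noteq> b" by (auto simp: less_wnat_def less_eq_wnat_def)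
  then have "c * k \<noteq> 0" using \<open>c \<noteq> 0\<close> wnat_no_zero_div by fastforce
  moreover have "c * b = c * a + c * k" using k by (simp add: algebra_simps)
  ultimately show ?thesis
    unfolding less_wnat_def less_eq_wnat_def by (metis add.commute add_0 wnat_cancel)
qed

\<comment> \<open>The pair \<open>(a, b)\<close> stands for \<open>a - b\<close>; cancellation in
  the naturals makes the relation transitive.\<close>
quotient_type wint = "wnat \<times> wnat" / "\<lambda>(a, b) (c, d). a + d = c + b"
  morphisms Rep_wint Abs_wint
proof (rule equivpI)
  show "transp (\<lambda>(a :: wnat, b) (c, d). a + d = c + b)"
  proof (rule transpI, clarsimp)
    fix a b c d e f :: wnat assume "a + d = c + b" "c + f = e + d"
    then have "(a + f) + d = (e + b) + d" by (metis add.assoc add.commute)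
    then show "a + f = e + b" by (rule wnat_cancel)
  qed
qed (auto simp: reflp_def symp_def)

instantiation wint :: comm_ring_1
begin

lift_definition zero_wint :: wint is "(0, 0)" .
lift_definition one_wint :: wint is "(1, 0)" .
lift_definition plus_wint :: "wint \<Rightarrow> wint \<Rightarrow> wint" is "\<lambda>(a, b) (c, d). (a + c, b + d)"
  by (clarsimp) (metis add.assoc add.commute)
lift_definition uminus_wint :: "wint \<Rightarrow> wint" is "\<lambda>(a, b). (b, a)"
  by (clarsimp simp: add.commute)
lift_definition times_wint :: "wint \<Rightarrow> wint \<Rightarrow> wint"
  is "\<lambda>(a, b) (c, d). (a * c + b * d, a * d + b * c)"
proof (clarsimp)
  fix s t u v w x y z :: wnat
  assume "s + v = u + t" "w + z = y + x"
  \<comment> \<open>The same four products are added on both sides, so that the two hypotheses can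
    be applied under multiplication; cancellation removes the extra terms afterwards.\<close>
  then have "(s + v) * w + (u + t) * x + u * (w + z) + v * (y + x) =
      (u + t) * w + (s + v) * x + u * (y + x) + v * (w + z)" by simp
  then have "(s * w + t * x + (u * z + v * y)) + (v * w + u * x + u * w + v * x) =
      (u * y + v * z + (s * x + t * w)) + (v * w + u * x + u * w + v * x)"
    by (simp add: algebra_simps)
  then show "s * w + t * x + (u * z + v * y) = u * y + v * z + (s * x + t * w)"
    by (rule wnat_cancel)
qed

definition minus_wint :: "wint \<Rightarrow> wint \<Rightarrow> wint" where "a - b = a + - (b :: wint)"

instance
proof
  fix a b c :: wint
  show "a + b + c = a + (b + c)" "a + b = b + a" "0 + a = a" "- a + a = 0"
    by (transfer; clarsimp simp: ac_simps)+
  show "a * b * c = a * (b * c)" "a * b = b * a" "1 * a = a" "(a + b) * c = a * c + b * c"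
    by (transfer; clarsimp simp: algebra_simps)+
  show "a - b = a + - b" by (rule minus_wint_def)
  show "0 \<noteq> (1 :: wint)" by transfer simp
qed

end

instantiation wint :: linordered_idom
begin

lift_definition less_eq_wint :: "wint \<Rightarrow> wint \<Rightarrow> bool" is "\<lambda>(a, b) (c, d). a + d \<le> c + b"
proof (clarsimp)
  fix a b a' b' c d c' d' :: wnat
  assume "a + b' = a' + b" "c + d' = c' + d"
  then have "(b' + d') + (a + d) = (b + d) + (a' + d')" "(b' + d') + (c + b) = (b + d) + (c' + b')"
    by (metis add.assoc add.commute)+
  then show "a + d \<le> c + b \<longleftrightarrow> a' + d' \<le> c' + b'" by (metis wnat_add_le)
qed

definition less_wint :: "wint \<Rightarrow> wint \<Rightarrow> bool" where "a < (b :: wint) \<longleftrightarrow> a \<le> b \<and> \<not> b \<le> a"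
definition abs_wint :: "wint \<Rightarrow> wint" where "\<bar>a :: wint\<bar> = (if a < 0 then - a else a)"
definition sgn_wint :: "wint \<Rightarrow> wint" where "sgn (a :: wint) = (if a = 0 then 0 else if 0 < a then 1 else - 1)"

instance
proof
  fix a b c :: wint
  show "a < b \<longleftrightarrow> a \<le> b \<and> \<not> b \<le> a" by (rule less_wint_def)
  show "a \<le> a" by transfer auto
  show "a \<le> b \<Longrightarrow> b \<le> c \<Longrightarrow> a \<le> c"
  proof (transfer, clarsimp)
    fix a b c d e f :: wnat assume "a + d \<le> c + b" "c + f \<le> e + d"
    then have "f + (a + d) \<le> f + (c + b)" "b + (c + f) \<le> b + (e + d)" by (simp_all only: wnat_add_le)
    moreover have "f + (c + b) = b + (c + f)" "f + (a + d) = d + (a + f)" "b + (e + d) = d + (e + b)"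
      by (simp_all add: ac_simps)
    ultimately have "d + (a + f) \<le> d + (e + b)" by (metis order_trans)
    then show "a + f \<le> e + b" by (simp only: wnat_add_le)
  qed
  show "a \<le> b \<Longrightarrow> b \<le> a \<Longrightarrow> a = b" by transfer auto
  show "a \<le> b \<or> b \<le> a" by transfer auto
  show "a \<le> b \<Longrightarrow> c + a \<le> c + b"
  proof (transfer, clarsimp)
    fix a b c d e f :: wnat assume "a + d \<le> c + b"
    then have "(e + f) + (a + d) \<le> (e + f) + (c + b)" by (simp only: wnat_add_le)
    then show "e + a + (f + d) \<le> e + c + (f + b)" by (simp add: ac_simps)
  qed
  show "\<bar>a\<bar> = (if a < 0 then - a else a)" by (rule abs_wint_def)
  show "sgn a = (if a = 0 then 0 else if 0 < a then 1 else - 1)" by (rule sgn_wint_def)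
  show "a < b \<Longrightarrow> 0 < c \<Longrightarrow> c * a < c * b"
    unfolding less_wint_def
  proof (transfer, clarsimp simp: not_le)
    fix a b c d e f :: wnat assume 1: "a + d \<le> c + b" "c + b \<noteq> a + d" and 2: "f \<le> e" "e \<noteq> f"
    \<comment> \<open>The positive factor is \<open>k = e - f\<close>. Multiplying the strict
      inequality by \<open>k\<close> and adding the products with \<open>f\<close> to both sides
      gives the claim without subtraction.\<close>
    from 2 obtain k where "e = f + k" "f \<noteq> e" by (auto simp: less_eq_wnat_def)
    then have k: "e = f + k" "k \<noteq> 0" by auto
    have "k * (a + d) < k * (c + b)" using 1 k(2) by (intro wnat_mul_mono) auto
    then have "(f * a + f * b + f * c + f * d) + k * (a + d) < (f * a + f * b + f * c + f * d) + k * (c + b)"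
      by (simp only: wnat_add_less)
    then have "e * a + f * b + (e * d + f * c) < e * c + f * d + (e * b + f * a)"
      unfolding k by (simp add: algebra_simps)
    then show "e * a + f * b + (e * d + f * c) \<le> e * c + f * d + (e * b + f * a) \<and>
       e * a + f * b + (e * d + f * c) < e * c + f * d + (e * b + f * a)"
      by simp
  qed
qed

end

type_synonym wrat = "wint fract"

definition of_wnat :: "wnat \<Rightarrow> wrat" where
  "of_wnat n = Fract (Abs_wint (n, 0)) 1"

lemma of_wnat_simps:
  "of_wnat (m + n) = of_wnat m + of_wnat n" "of_wnat (m * n) = of_wnat m * of_wnat n"
  "of_wnat 0 = 0" "of_wnat 1 = 1"
proof -
  have "Abs_wint (m + n, 0) = Abs_wint (m, 0) + Abs_wint (n, 0)"
    "Abs_wint (m * n, 0) = Abs_wint (m, 0) * Abs_wint (n, 0)"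
    by (simp_all add: plus_wint.abs_eq times_wint.abs_eq)
  then show "of_wnat (m + n) = of_wnat m + of_wnat n" "of_wnat (m * n) = of_wnat m * of_wnat n"
    by (simp_all add: of_wnat_def)
  show "of_wnat 0 = 0" "of_wnat 1 = 1"
    by (simp_all add: of_wnat_def Zero_fract_def One_fract_def zero_wint_def one_wint_def)
qed

lemma of_wnat_less: "of_wnat m < of_wnat n \<longleftrightarrow> m < n"
  by (auto simp: of_wnat_def less_wint_def less_eq_wint.abs_eq not_le less_imp_le)

text \<open>Valuing the numbers of the model in an ordered field of HOL turns comparisons of
  fractions and cuts inside the model into field inequalities. The field stays abstract and need not
  be Archimedean over the standard integers.\<close>

locale zf_arith = zf E for E :: "'a \<Rightarrow> 'a \<Rightarrow> bool" (infix "\<epsilon>" 50) +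
  fixes val :: "'a \<Rightarrow> 'f :: linordered_field"
  assumes val_add: "m \<epsilon> \<omega> \<Longrightarrow> n \<epsilon> \<omega> \<Longrightarrow> val (add m n) = val m + val n"
    and val_mul: "m \<epsilon> \<omega> \<Longrightarrow> n \<epsilon> \<omega> \<Longrightarrow> val (mul m n) = val m * val n"
    and val_zero: "val \<emptyset> = 0" and val_one: "val (succ \<emptyset>) = 1"
    and val_less: "m \<epsilon> \<omega> \<Longrightarrow> n \<epsilon> \<omega> \<Longrightarrow> val m < val n \<longleftrightarrow> m \<epsilon> n"

lemma zf_arith_refuting:
  assumes "zf refuting"
  shows "zf_arith refuting (\<lambda>n. of_wnat (Abs_wnat n))"
proof -
  interpret zf refuting by fact
  have S: "num_set = El omega" "num_add = add" "num_mul = mul" "num_zero = Empty" "num_one = succ Empty"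
    by (simp_all add: num_set_def num_add_def num_mul_def num_zero_def num_one_def assms)
  have Abs: "Abs_wnat (add m n) = Abs_wnat m + Abs_wnat n" "Abs_wnat (mul m n) = Abs_wnat m * Abs_wnat n"
    if "refuting m omega" "refuting n omega" for m n
    using that by (simp_all add: plus_wnat.abs_eq times_wnat.abs_eq eq_onp_def S)
  have inj: "Abs_wnat m = Abs_wnat n \<longleftrightarrow> m = n" if "refuting m omega" "refuting n omega" for m n
    using that by (simp add: Abs_wnat_inject S)
  have A01: "Abs_wnat Empty = 0" "Abs_wnat (succ Empty) = 1"
    using S by (simp_all add: zero_wnat_def one_wnat_def)
  have less: "Abs_wnat m < Abs_wnat n \<longleftrightarrow> refuting m n" if mn: "refuting m omega" "refuting n omega" for m n
  proof
    assume "Abs_wnat m < Abs_wnat n"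
    then obtain k where k: "Abs_wnat n = Abs_wnat m + k" "m \<noteq> n"
      by (auto simp: less_wnat_def less_eq_wnat_def)
    \<comment> \<open>Every element of the type comes from a number of the model. The difference
      \<open>k\<close> is therefore such a number, and \<open>mem_iff_add\<close> turns the
      inequality into membership.\<close>
    obtain l where l: "k = Abs_wnat l" "refuting l omega"
      by (cases k) (auto simp: S)
    have "n = add m l" using k l mn by (simp flip: Abs add: inj)
    moreover have "l \<noteq> Empty" using calculation k(2) mn by auto
    ultimately show "refuting m n" using mn l nat_cases [of l] by (auto simp: mem_iff_add)
  next
    assume "refuting m n"
    then obtain k where "refuting k omega" "n = add m (succ k)" using mn mem_iff_add by blast
    then have "Abs_wnat n = Abs_wnat m + Abs_wnat (succ k)" using mn by (simp add: Abs del: add_succ)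
    moreover have "m \<noteq> n" using \<open>refuting m n\<close> mem_irrefl by blast
    ultimately show "Abs_wnat m < Abs_wnat n"
      using inj mn unfolding less_wnat_def less_eq_wnat_def by blast
  qed
  show ?thesis
    by unfold_locales (simp_all add: Abs A01 of_wnat_simps of_wnat_less less)
qed

section \<open>Reals and topological spaces in the model\<close>

context zf
begin

definition IsFrac :: "'a \<Rightarrow> 'a \<Rightarrow> 'a \<Rightarrow> 'a \<Rightarrow> bool" where
  "IsFrac q a b c \<longleftrightarrow> a \<epsilon> \<omega> \<and> b \<epsilon> \<omega> \<and> c \<epsilon> \<omega> \<and> c \<noteq> \<emptyset> \<and> q = pair a (pair b c)"

definition IsRat :: "'a \<Rightarrow> bool" where
  "IsRat q \<longleftrightarrow> (\<exists>a b c. IsFrac q a b c)"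

definition RatLess :: "'a \<Rightarrow> 'a \<Rightarrow> bool" where
  "RatLess q q' \<longleftrightarrow> (\<exists>a b c a' b' c'. IsFrac q a b c \<and> IsFrac q' a' b' c' \<and>
     add (mul a c') (mul b' c) \<epsilon> add (mul a' c) (mul b c'))"

definition RatAdd :: "'a \<Rightarrow> 'a \<Rightarrow> 'a \<Rightarrow> bool" where
  "RatAdd q q' t \<longleftrightarrow> (\<exists>a b c a' b' c'. IsFrac q a b c \<and> IsFrac q' a' b' c' \<and>
     IsFrac t (add (mul a c') (mul a' c)) (add (mul b c') (mul b' c)) (mul c c'))"

definition IsReal :: "'a \<Rightarrow> bool" where
  "IsReal D \<longleftrightarrow> (\<forall>q. q \<epsilon> D \<longrightarrow> IsRat q) \<and> D \<noteq> \<emptyset> \<and> (\<exists>q. IsRat q \<and> \<not> q \<epsilon> D) \<and>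
     (\<forall>q q'. q \<epsilon> D \<and> RatLess q' q \<longrightarrow> q' \<epsilon> D) \<and>
     (\<forall>q. q \<epsilon> D \<longrightarrow> (\<exists>q'. q' \<epsilon> D \<and> RatLess q q'))"

lemma Def_IsFrac [dfn]:
  assumes "Trm s" "Trm t" "Trm u" "Trm v" shows "Def (\<lambda>\<rho>. IsFrac (s \<rho>) (t \<rho>) (u \<rho>) (v \<rho>))"
  unfolding IsFrac_def by (intro dfn assms)

lemma Def_IsRat [dfn]: "Trm t \<Longrightarrow> Def (\<lambda>\<rho>. IsRat (t \<rho>))"
  by (rule Def_app1) (unfold IsRat_def, intro dfn)

lemma Def_RatLess [dfn]: "Trm t \<Longrightarrow> Trm u \<Longrightarrow> Def (\<lambda>\<rho>. RatLess (t \<rho>) (u \<rho>))"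
  by (rule Def_app2) (unfold RatLess_def, intro dfn)

lemma Def_RatAdd [dfn]: "Trm t \<Longrightarrow> Trm u \<Longrightarrow> Trm v \<Longrightarrow> Def (\<lambda>\<rho>. RatAdd (t \<rho>) (u \<rho>) (v \<rho>))"
  by (rule Def_app3) (unfold RatAdd_def, intro dfn)

lemma Def_IsReal [dfn]: "Trm t \<Longrightarrow> Def (\<lambda>\<rho>. IsReal (t \<rho>))"
  by (rule Def_app1) (unfold IsReal_def, intro dfn)

lemma sem_is_frac [sem_eq]:
  "q < d \<Longrightarrow> a < d \<Longrightarrow> b < d \<Longrightarrow> c < d \<Longrightarrow>
    sem \<rho> (is_frac q a b c d) \<longleftrightarrow> IsFrac (\<rho> q) (\<rho> a) (\<rho> b) (\<rho> c)"
  by (simp add: is_frac_def IsFrac_def sem_eq upd del: fun_upd_apply)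

lemma sem_is_rat [sem_eq]: "q < d \<Longrightarrow> sem \<rho> (is_rat q d) \<longleftrightarrow> IsRat (\<rho> q)"
  by (simp add: is_rat_def IsRat_def sem_eq upd del: fun_upd_apply)

lemma sem_rat_less [sem_eq]: "q < d \<Longrightarrow> q' < d \<Longrightarrow> sem \<rho> (rat_less q q' d) \<longleftrightarrow> RatLess (\<rho> q) (\<rho> q')"
  by (simp add: rat_less_def RatLess_def sem_eq upd IsFrac_def del: fun_upd_apply) (auto simp: IsFrac_def)

lemma sem_rat_add [sem_eq]:
  "q < d \<Longrightarrow> q' < d \<Longrightarrow> t < d \<Longrightarrow> sem \<rho> (rat_add q q' t d) \<longleftrightarrow> RatAdd (\<rho> q) (\<rho> q') (\<rho> t)"
  by (simp add: rat_add_def RatAdd_def sem_eq upd IsFrac_def del: fun_upd_apply) (auto simp: IsFrac_def)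

lemma sem_is_real [sem_eq]: "x < d \<Longrightarrow> sem \<rho> (is_real x d) \<longleftrightarrow> IsReal (\<rho> x)"
  by (simp add: is_real_def IsReal_def sem_eq upd del: fun_upd_apply)

definition Rats :: 'a where "Rats = Sep (prod \<omega> (prod \<omega> \<omega>)) IsRat"

lemma mem_Rats [simp]: "q \<epsilon> Rats \<longleftrightarrow> IsRat q"
proof -
  have "Def (\<lambda>\<rho>. IsRat (\<rho> 0))" by (intro dfn)
  then show ?thesis unfolding Rats_def by (subst mem_Sep) (auto simp: IsRat_def IsFrac_def)
qed

definition Reals :: 'a where "Reals = Sep (Pow Rats) IsReal"

lemma mem_Reals [simp]: "x \<epsilon> Reals \<longleftrightarrow> IsReal x"
proof -
  have "Def (\<lambda>\<rho>. IsReal (\<rho> 0))" by (intro dfn)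
  then show ?thesis unfolding Reals_def by (subst mem_Sep) (auto simp: IsReal_def Sub_def)
qed

lemma sem_is_reals [sem_eq]: "x < d \<Longrightarrow> sem \<rho> (is_reals x d) \<longleftrightarrow> \<rho> x = Reals"
  by (simp add: is_reals_def sem_eq upd del: fun_upd_apply) (auto intro: ext)

lemma eq_ext: "(\<And>z. z \<epsilon> s \<longleftrightarrow> P z) \<Longrightarrow> (\<forall>z. z \<epsilon> x \<longleftrightarrow> P z) \<longleftrightarrow> x = s"
  by (auto intro: ext)

definition RZero :: 'a where
  "RZero = Sep Rats (\<lambda>q. \<exists>a b c. IsFrac q a b c \<and> a \<epsilon> b)"

lemma mem_RZero: "q \<epsilon> RZero \<longleftrightarrow> (\<exists>a b c. IsFrac q a b c \<and> a \<epsilon> b)"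
  unfolding RZero_def by (subst mem_Sep, intro dfn) (auto simp: IsRat_def)

lemma sem_real_zero [sem_eq]: "x < d \<Longrightarrow> sem \<rho> (real_zero x d) \<longleftrightarrow> \<rho> x = RZero"
  by (simp add: real_zero_def sem_eq upd del: fun_upd_apply) (rule eq_ext, simp add: mem_RZero)

definition RLe :: "'a \<Rightarrow> 'a \<Rightarrow> bool" where
  "RLe x y \<longleftrightarrow> IsReal x \<and> IsReal y \<and> Sub x y"

definition RLess :: "'a \<Rightarrow> 'a \<Rightarrow> bool" where
  "RLess x y \<longleftrightarrow> RLe x y \<and> x \<noteq> y"

definition radd :: "'a \<Rightarrow> 'a \<Rightarrow> 'a" where
  "radd x y = Sep Rats (\<lambda>q. \<exists>q1 q2 t. q1 \<epsilon> x \<and> q2 \<epsilon> y \<and> RatAdd q1 q2 t \<and> RatLess q t)"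

lemma RatLess_IsRat: "RatLess q q' \<Longrightarrow> IsRat q" "RatLess q q' \<Longrightarrow> IsRat q'"
  by (auto simp: RatLess_def IsRat_def)

lemma mem_radd: "q \<epsilon> radd x y \<longleftrightarrow> (\<exists>q1 q2 t. q1 \<epsilon> x \<and> q2 \<epsilon> y \<and> RatAdd q1 q2 t \<and> RatLess q t)"
  unfolding radd_def by (subst mem_Sep, intro dfn) (auto dest: RatLess_IsRat)

lemma Def_RLe [dfn]: "Trm t \<Longrightarrow> Trm u \<Longrightarrow> Def (\<lambda>\<rho>. RLe (t \<rho>) (u \<rho>))"
  by (rule Def_app2) (unfold RLe_def, intro dfn)

lemma Def_RLess [dfn]: "Trm t \<Longrightarrow> Trm u \<Longrightarrow> Def (\<lambda>\<rho>. RLess (t \<rho>) (u \<rho>))"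
  by (rule Def_app2) (unfold RLess_def, intro dfn)

lemma sem_real_le [sem_eq]: "x < d \<Longrightarrow> y < d \<Longrightarrow> sem \<rho> (real_le x y d) \<longleftrightarrow> RLe (\<rho> x) (\<rho> y)"
  by (simp add: real_le_def RLe_def sem_eq upd del: fun_upd_apply)

lemma sem_real_less [sem_eq]: "x < d \<Longrightarrow> y < d \<Longrightarrow> sem \<rho> (real_less x y d) \<longleftrightarrow> RLess (\<rho> x) (\<rho> y)"
  by (simp add: real_less_def RLess_def sem_eq upd del: fun_upd_apply)

lemma sem_real_add [sem_eq]: "x < d \<Longrightarrow> y < d \<Longrightarrow> s < d \<Longrightarrow>
    sem \<rho> (real_add x y s d) \<longleftrightarrow> IsReal (\<rho> x) \<and> IsReal (\<rho> y) \<and> \<rho> s = radd (\<rho> x) (\<rho> y)"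
  by (simp add: real_add_def sem_eq upd del: fun_upd_apply)
    (intro impI conj_cong refl eq_ext, auto simp: mem_radd)

lemma sem_real_positive [sem_eq]: "x < d \<Longrightarrow> sem \<rho> (real_positive x d) \<longleftrightarrow> RLess RZero (\<rho> x)"
  by (simp add: real_positive_def sem_eq upd del: fun_upd_apply)

definition ROpen :: "'a \<Rightarrow> bool" where
  "ROpen U \<longleftrightarrow> (\<forall>x. x \<epsilon> U \<longrightarrow> IsReal x) \<and> (\<forall>x. x \<epsilon> U \<longrightarrow> (\<exists>a b. RLess a x \<and> RLess x b \<and>
     (\<forall>y. RLess a y \<and> RLess y b \<longrightarrow> y \<epsilon> U)))"

lemma Def_ROpen [dfn]: "Trm t \<Longrightarrow> Def (\<lambda>\<rho>. ROpen (t \<rho>))"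
  by (rule Def_app1) (unfold ROpen_def, intro dfn)

lemma sem_real_open [sem_eq]: "x < d \<Longrightarrow> sem \<rho> (real_open x d) \<longleftrightarrow> ROpen (\<rho> x)"
  by (simp add: real_open_def ROpen_def sem_eq upd del: fun_upd_apply)

definition IsTop :: "'a \<Rightarrow> 'a \<Rightarrow> bool" where
  "IsTop X T \<longleftrightarrow> (\<forall>U. U \<epsilon> T \<longrightarrow> Sub U X) \<and> X \<epsilon> T \<and> (\<forall>S. Sub S T \<longrightarrow> Union S \<epsilon> T) \<and>
     (\<forall>U V. U \<epsilon> T \<and> V \<epsilon> T \<longrightarrow> inter U V \<epsilon> T)"

text \<open>A formula can only say that some set with the given elements lies in \<open>T\<close>;
  extensionality turns this into membership of a set denoted by an operation.\<close>

lemma mem_ext1: "(\<exists>W. W \<epsilon> T \<and> (\<forall>x. x \<epsilon> W \<longleftrightarrow> P x)) \<longleftrightarrow> s \<epsilon> T" if "\<And>x. x \<epsilon> s \<longleftrightarrow> P x"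
  using that ext by metis

lemma sem_is_topology [sem_eq]:
  assumes "X < d" "T < d" shows "sem \<rho> (is_topology X T d) \<longleftrightarrow> IsTop (\<rho> X) (\<rho> T)"
proof -
  have "(\<exists>U. U \<epsilon> T \<and> (\<forall>x. x \<epsilon> U \<longleftrightarrow> (\<exists>V. V \<epsilon> S \<and> x \<epsilon> V))) \<longleftrightarrow> Union S \<epsilon> T" for T S
    by (rule mem_ext1) simp
  moreover have "(\<exists>W. W \<epsilon> T \<and> (\<forall>x. x \<epsilon> W \<longleftrightarrow> x \<epsilon> U \<and> x \<epsilon> V)) \<longleftrightarrow> inter U V \<epsilon> T" for T U V
    by (rule mem_ext1) simp
  ultimately show ?thesis using assms
    by (simp add: is_topology_def IsTop_def sem_eq upd del: fun_upd_apply)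
qed

definition IsBase :: "('a \<Rightarrow> bool) \<Rightarrow> 'a \<Rightarrow> 'a \<Rightarrow> bool" where
  "IsBase P X T \<longleftrightarrow> (\<forall>U. U \<epsilon> T \<longleftrightarrow> Sub U X \<and> (\<forall>x. x \<epsilon> U \<longrightarrow> (\<exists>B. P B \<and> x \<epsilon> B \<and> Sub B U)))"

text \<open>A class of sets given by a formula has up to three parameters \<open>u\<close>, \<open>v\<close>, \<open>w\<close>.\<close>

definition reads :: "(nat \<Rightarrow> form) \<Rightarrow> nat \<Rightarrow> nat \<Rightarrow> nat \<Rightarrow> ('a \<Rightarrow> 'a \<Rightarrow> 'a \<Rightarrow> 'a \<Rightarrow> bool) \<Rightarrow> bool" where
  "reads P u v w Q \<longleftrightarrow> (\<forall>\<rho> d s. u < d \<longrightarrow> v < d \<longrightarrow> w < d \<longrightarrow> s < d \<longrightarrow>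
     sem \<rho> (P s d) = Q (\<rho> u) (\<rho> v) (\<rho> w) (\<rho> s))"

lemma sem_is_base:
  "reads P u v w Q \<Longrightarrow> u < d \<Longrightarrow> v < d \<Longrightarrow> w < d \<Longrightarrow> X < d \<Longrightarrow> T < d \<Longrightarrow>
    sem \<rho> (is_base P X T d) \<longleftrightarrow> IsBase (Q (\<rho> u) (\<rho> v) (\<rho> w)) (\<rho> X) (\<rho> T)"
  unfolding reads_def by (simp add: is_base_def IsBase_def sem_eq upd del: fun_upd_apply)

definition CInt :: "('a \<Rightarrow> bool) \<Rightarrow> 'a \<Rightarrow> bool" where
  "CInt P s \<longleftrightarrow> (\<exists>U. U \<noteq> \<emptyset> \<and> Countable U \<and> (\<forall>u. u \<epsilon> U \<longrightarrow> P u) \<and>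
     (\<forall>x. x \<epsilon> s \<longleftrightarrow> (\<forall>u. u \<epsilon> U \<longrightarrow> x \<epsilon> u)))"

definition Stable :: "('a \<Rightarrow> bool) \<Rightarrow> bool" where
  "Stable P \<longleftrightarrow> (\<forall>s. CInt P s \<longrightarrow> P s)"

lemma sem_countable_inter:
  "reads P u v w Q \<Longrightarrow> u < d \<Longrightarrow> v < d \<Longrightarrow> w < d \<Longrightarrow> s < d \<Longrightarrow>
    sem \<rho> (countable_inter P s d) \<longleftrightarrow> CInt (Q (\<rho> u) (\<rho> v) (\<rho> w)) (\<rho> s)"
  unfolding reads_def by (simp add: countable_inter_def CInt_def sem_eq upd del: fun_upd_apply)

lemma sem_stable:
  "reads P u v w Q \<Longrightarrow> u < d \<Longrightarrow> v < d \<Longrightarrow> w < d \<Longrightarrow>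
    sem \<rho> (stable_countable_inter P d) \<longleftrightarrow> Stable (Q (\<rho> u) (\<rho> v) (\<rho> w))"
  using sem_countable_inter [of P u v w Q] unfolding reads_def
  by (simp add: stable_countable_inter_def Stable_def sem_eq upd del: fun_upd_apply)

lemma Def_CInt:
  assumes P: "Def (\<lambda>\<rho>. P (\<rho> 0))" and "Trm t" shows "Def (\<lambda>\<rho>. CInt P (t \<rho>))"
  by (rule Def_app1 [OF _ assms(2)]) (unfold CInt_def, intro dfn Def_app1 [OF P])

definition Closed :: "'a \<Rightarrow> 'a \<Rightarrow> 'a \<Rightarrow> bool" where
  "Closed X T A \<longleftrightarrow> Sub A X \<and> diff X A \<epsilon> T"

definition Clopen :: "'a \<Rightarrow> 'a \<Rightarrow> 'a \<Rightarrow> bool" where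
  "Clopen X T A \<longleftrightarrow> A \<epsilon> T \<and> Closed X T A"

lemma sem_is_complement [sem_eq]: "C < d \<Longrightarrow> X < d \<Longrightarrow> A < d \<Longrightarrow>
    sem \<rho> (is_complement C X A d) \<longleftrightarrow> \<rho> C = diff (\<rho> X) (\<rho> A)"
  by (simp add: is_complement_def sem_eq upd del: fun_upd_apply) (auto intro: ext)

lemma sem_is_closed [sem_eq]: "X < d \<Longrightarrow> T < d \<Longrightarrow> A < d \<Longrightarrow>
    sem \<rho> (is_closed X T A d) \<longleftrightarrow> Closed (\<rho> X) (\<rho> T) (\<rho> A)"
  by (simp add: is_closed_def Closed_def sem_eq upd del: fun_upd_apply)

lemma sem_is_clopen [sem_eq]: "X < d \<Longrightarrow> T < d \<Longrightarrow> A < d \<Longrightarrow>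
    sem \<rho> (is_clopen X T A d) \<longleftrightarrow> Clopen (\<rho> X) (\<rho> T) (\<rho> A)"
  by (simp add: is_clopen_def Clopen_def sem_eq upd del: fun_upd_apply)

definition Gdelta :: "'a \<Rightarrow> 'a \<Rightarrow> bool" where "Gdelta T = CInt (\<lambda>u. u \<epsilon> T)"
definition COdelta :: "'a \<Rightarrow> 'a \<Rightarrow> 'a \<Rightarrow> bool" where "COdelta X T = CInt (Clopen X T)"

lemma sem_G_delta [sem_eq]: "T < d \<Longrightarrow> s < d \<Longrightarrow> sem \<rho> (G_delta T s d) \<longleftrightarrow> Gdelta (\<rho> T) (\<rho> s)"
  unfolding G_delta_def Gdelta_def
  by (rule sem_countable_inter [of _ T T T]) (auto simp: reads_def sem_eq)

lemma sem_CO_delta [sem_eq]: "X < d \<Longrightarrow> T < d \<Longrightarrow> s < d \<Longrightarrow>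
    sem \<rho> (CO_delta X T s d) \<longleftrightarrow> COdelta (\<rho> X) (\<rho> T) (\<rho> s)"
  unfolding CO_delta_def COdelta_def
  by (rule sem_countable_inter [of _ X T T]) (auto simp: reads_def sem_eq)

definition Cont :: "'a \<Rightarrow> 'a \<Rightarrow> 'a \<Rightarrow> bool" where
  "Cont X T f \<longleftrightarrow> FunTo f X Reals \<and> (\<forall>U. ROpen U \<longrightarrow> Sep X (\<lambda>x. app f x \<epsilon> U) \<epsilon> T)"

lemma mem_preimage [simp]: "x \<epsilon> Sep X (\<lambda>x. app f x \<epsilon> U) \<longleftrightarrow> x \<epsilon> X \<and> app f x \<epsilon> U"
  by (rule mem_Sep) (intro dfn)

lemma sem_continuous_real [sem_eq]:
  assumes "X < d" "T < d" "f < d"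
  shows "sem \<rho> (continuous_real X T f d) \<longleftrightarrow> Cont (\<rho> X) (\<rho> T) (\<rho> f)"
proof -
  have eq: "(\<exists>V. V \<epsilon> T \<and> (\<forall>x. x \<epsilon> V \<longleftrightarrow> (\<exists>y. y \<epsilon> U \<and> pair x y \<epsilon> f))) \<longleftrightarrow>
      Sep X (\<lambda>x. app f x \<epsilon> U) \<epsilon> T" if "FunTo f X Reals" for X T f U
    by (rule mem_ext1) (use that in \<open>auto simp: FunTo_def FunOn_iff\<close>)
  show ?thesis using assms
    by (simp add: continuous_real_def Cont_def sem_eq upd eq del: fun_upd_apply cong: conj_cong)
qed

definition ZeroSet :: "'a \<Rightarrow> 'a \<Rightarrow> 'a \<Rightarrow> bool" where
  "ZeroSet X T Z \<longleftrightarrow> (\<exists>f. Cont X T f \<and> Z = Sep X (\<lambda>x. app f x = RZero))"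

lemma mem_zeros [simp]: "x \<epsilon> Sep X (\<lambda>x. app f x = y) \<longleftrightarrow> x \<epsilon> X \<and> app f x = y"
  by (rule mem_Sep) (intro dfn)

lemma sem_zero_set [sem_eq]:
  assumes "X < d" "T < d" "Z < d"
  shows "sem \<rho> (zero_set X T Z d) \<longleftrightarrow> ZeroSet (\<rho> X) (\<rho> T) (\<rho> Z)"
proof -
  have eq: "(\<forall>x. x \<epsilon> Z \<longleftrightarrow> pair x RZero \<epsilon> f) \<longleftrightarrow> Z = Sep X (\<lambda>x. app f x = RZero)"
    if "Cont X T f" for X T f Z
    using that by (auto intro!: ext simp: Cont_def FunTo_def FunOn_iff)
  show ?thesis using assms
    by (simp add: zero_set_def ZeroSet_def sem_eq upd eq del: fun_upd_apply cong: conj_cong)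
qed

definition Cozero :: "'a \<Rightarrow> 'a \<Rightarrow> 'a \<Rightarrow> bool" where
  "Cozero X T C \<longleftrightarrow> (\<exists>Z. ZeroSet X T Z \<and> C = diff X Z)"

lemma sem_cozero_set [sem_eq]: "X < d \<Longrightarrow> T < d \<Longrightarrow> C < d \<Longrightarrow>
    sem \<rho> (cozero_set X T C d) \<longleftrightarrow> Cozero (\<rho> X) (\<rho> T) (\<rho> C)"
  by (simp add: cozero_set_def Cozero_def sem_eq upd del: fun_upd_apply)

definition CReg :: "'a \<Rightarrow> 'a \<Rightarrow> bool" where
  "CReg X T \<longleftrightarrow> IsTop X T \<and> IsBase (Cozero X T) X T"

definition T1 :: "'a \<Rightarrow> 'a \<Rightarrow> bool" where
  "T1 X T \<longleftrightarrow> IsTop X T \<and> (\<forall>x. x \<epsilon> X \<longrightarrow> Closed X T (sing x))"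

definition SZD :: "'a \<Rightarrow> 'a \<Rightarrow> bool" where
  "SZD X T \<longleftrightarrow> CReg X T \<and> (\<forall>Z1 Z2. ZeroSet X T Z1 \<and> ZeroSet X T Z2 \<and>
     \<not> (\<exists>x. x \<epsilon> Z1 \<and> x \<epsilon> Z2) \<longrightarrow> (\<exists>U. Clopen X T U \<and> Sub Z1 U \<and> Sub U (diff X Z2)))"

lemma sem_completely_regular [sem_eq]:
  "X < d \<Longrightarrow> T < d \<Longrightarrow> sem \<rho> (completely_regular X T d) \<longleftrightarrow> CReg (\<rho> X) (\<rho> T)"
  using sem_is_base [of "cozero_set X T" X T T "\<lambda>X T _. Cozero X T" d X T]
  by (simp add: completely_regular_def CReg_def reads_def sem_eq)

lemma sem_T1_space [sem_eq]: "X < d \<Longrightarrow> T < d \<Longrightarrow> sem \<rho> (T1_space X T d) \<longleftrightarrow> T1 (\<rho> X) (\<rho> T)"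
  by (simp add: T1_space_def T1_def sing_def sem_eq upd del: fun_upd_apply)

lemma sem_T3_half_space [sem_eq]:
  "X < d \<Longrightarrow> T < d \<Longrightarrow> sem \<rho> (T3_half_space X T d) \<longleftrightarrow> CReg (\<rho> X) (\<rho> T) \<and> T1 (\<rho> X) (\<rho> T)"
  by (simp add: T3_half_space_def sem_eq)

lemma sem_strongly_zero_dimensional [sem_eq]:
  "X < d \<Longrightarrow> T < d \<Longrightarrow> sem \<rho> (strongly_zero_dimensional X T d) \<longleftrightarrow> SZD (\<rho> X) (\<rho> T)"
  by (simp add: strongly_zero_dimensional_def SZD_def sem_eq upd del: fun_upd_apply)

definition PSpace :: "'a \<Rightarrow> 'a \<Rightarrow> bool" where
  "PSpace X T \<longleftrightarrow> IsTop X T \<and> (\<forall>s. Gdelta T s \<longrightarrow> s \<epsilon> T)"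

lemma sem_P_space [sem_eq]: "X < d \<Longrightarrow> T < d \<Longrightarrow> sem \<rho> (P_space X T d) \<longleftrightarrow> PSpace (\<rho> X) (\<rho> T)"
  by (simp add: P_space_def PSpace_def sem_eq upd del: fun_upd_apply)

definition Compact :: "'a \<Rightarrow> 'a \<Rightarrow> bool" where
  "Compact X T \<longleftrightarrow> (\<forall>C. Sub C T \<and> (\<forall>x. x \<epsilon> X \<longrightarrow> (\<exists>U. U \<epsilon> C \<and> x \<epsilon> U)) \<longrightarrow>
     (\<exists>F. Sub F C \<and> Finite F \<and> (\<forall>x. x \<epsilon> X \<longrightarrow> (\<exists>U. U \<epsilon> F \<and> x \<epsilon> U))))"

lemma sem_is_compact [sem_eq]: "X < d \<Longrightarrow> T < d \<Longrightarrow> sem \<rho> (is_compact X T d) \<longleftrightarrow> Compact (\<rho> X) (\<rho> T)"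
  by (simp add: is_compact_def Compact_def sem_eq upd del: fun_upd_apply)

definition FirstC :: "'a \<Rightarrow> 'a \<Rightarrow> bool" where
  "FirstC X T \<longleftrightarrow> (\<forall>x. x \<epsilon> X \<longrightarrow> (\<exists>B. Countable B \<and> (\<forall>V. V \<epsilon> B \<longrightarrow> V \<epsilon> T \<and> x \<epsilon> V) \<and>
     (\<forall>U. U \<epsilon> T \<and> x \<epsilon> U \<longrightarrow> (\<exists>V. V \<epsilon> B \<and> Sub V U))))"

lemma sem_first_countable [sem_eq]:
  "X < d \<Longrightarrow> T < d \<Longrightarrow> sem \<rho> (first_countable X T d) \<longleftrightarrow> FirstC (\<rho> X) (\<rho> T)"
  by (simp add: first_countable_def FirstC_def sem_eq upd del: fun_upd_apply)

abbreviation dist :: "'a \<Rightarrow> 'a \<Rightarrow> 'a \<Rightarrow> 'a" where "dist d x y \<equiv> app d (pair x y)"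

definition IsMetric :: "'a \<Rightarrow> 'a \<Rightarrow> bool" where
  "IsMetric X d \<longleftrightarrow> FunTo d (prod X X) Reals \<and>
     (\<forall>x y. x \<epsilon> X \<and> y \<epsilon> X \<longrightarrow> RLe RZero (dist d x y) \<and> (dist d x y = RZero \<longleftrightarrow> x = y) \<and>
        dist d y x = dist d x y) \<and>
     (\<forall>x y z. x \<epsilon> X \<and> y \<epsilon> X \<and> z \<epsilon> X \<longrightarrow> RLe (dist d x z) (radd (dist d x y) (dist d y z)))"

lemma sem_maps2 [sem_eq]: "g < d \<Longrightarrow> x < d \<Longrightarrow> y < d \<Longrightarrow> r < d \<Longrightarrow>
    sem \<rho> (maps2 g x y r d) \<longleftrightarrow> pair (pair (\<rho> x) (\<rho> y)) (\<rho> r) \<epsilon> \<rho> g"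
  by (simp add: maps2_def sem_eq upd del: fun_upd_apply)

lemma pair_metric:
  "FunTo d (prod X X) Reals \<Longrightarrow> pair (pair x y) r \<epsilon> d \<longleftrightarrow> x \<epsilon> X \<and> y \<epsilon> X \<and> r = dist d x y"
  by (auto simp: FunTo_def FunOn_iff)

lemma sem_is_metric [sem_eq]:
  assumes "X < k" "d < k"
  shows "sem \<rho> (is_metric X d k) \<longleftrightarrow> IsMetric (\<rho> X) (\<rho> d)"
proof -
  have prod: "(\<forall>p. p \<epsilon> Q \<longleftrightarrow> (\<exists>x. x \<epsilon> X \<and> (\<exists>y. y \<epsilon> X \<and> p = pair x y))) \<longleftrightarrow> Q = prod X X" for Q X
    by (rule eq_ext) auto
  have eq: "FunTo d (prod X X) Reals \<and>
     (\<forall>x y r. pair (pair x y) r \<epsilon> d \<longrightarrow>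
        (RLe RZero r \<and> (r = RZero \<longleftrightarrow> x = y)) \<and> pair (pair y x) r \<epsilon> d) \<and>
     (\<forall>x y z r s t. pair (pair x y) r \<epsilon> d \<and> pair (pair y z) s \<epsilon> d \<and> pair (pair x z) t \<epsilon> d \<longrightarrow>
        IsReal r \<and> IsReal s \<and> RLe t (radd r s)) \<longleftrightarrow> IsMetric X d" for X d
  proof (cases "FunTo d (prod X X) Reals")
    case True
    have real: "x \<epsilon> X \<Longrightarrow> y \<epsilon> X \<Longrightarrow> IsReal (dist d x y)" for x y
      using True by (auto simp: FunTo_def)
    show ?thesis unfolding IsMetric_def pair_metric [OF True] using True real by (auto; metis)
  qed (simp add: IsMetric_def)
  show ?thesis using assms
    by (simp add: is_metric_def eq [symmetric] prod sem_eq upd del: fun_upd_apply)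
qed

definition Metrizable :: "'a \<Rightarrow> 'a \<Rightarrow> bool" where
  "Metrizable X T \<longleftrightarrow> (\<exists>d. IsMetric X d \<and> (\<forall>U. U \<epsilon> T \<longleftrightarrow> Sub U X \<and> (\<forall>x. x \<epsilon> U \<longrightarrow>
     (\<exists>e. RLess RZero e \<and> (\<forall>y. y \<epsilon> X \<and> RLess (dist d x y) e \<longrightarrow> y \<epsilon> U)))))"

lemma sem_metrizable [sem_eq]:
  assumes "X < d" "T < d" shows "sem \<rho> (metrizable X T d) \<longleftrightarrow> Metrizable (\<rho> X) (\<rho> T)"
proof -
  have eq: "Sub U X \<and> (\<forall>x. x \<epsilon> U \<longrightarrow> (\<exists>e. RLess RZero e \<and>
      (\<forall>y. (\<exists>r. pair (pair x y) r \<epsilon> d \<and> RLess r e) \<longrightarrow> y \<epsilon> U))) \<longleftrightarrow>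
    Sub U X \<and> (\<forall>x. x \<epsilon> U \<longrightarrow> (\<exists>e. RLess RZero e \<and> (\<forall>y. y \<epsilon> X \<and> RLess (dist d x y) e \<longrightarrow> y \<epsilon> U)))"
    if "IsMetric X d" for X d U
  proof -
    have "FunTo d (prod X X) Reals" using that by (simp add: IsMetric_def)
    from pair_metric [OF this] show ?thesis by (auto simp: Sub_def)
  qed
  show ?thesis using assms
    by (simp add: metrizable_def Metrizable_def sem_eq upd eq del: fun_upd_apply cong: conj_cong)
qed

definition Family :: "('a \<Rightarrow> 'a \<Rightarrow> bool) \<Rightarrow> 'a \<Rightarrow> 'a \<Rightarrow> bool" where
  "Family K S I \<longleftrightarrow> FunOn S I \<and>
     (\<forall>i. i \<epsilon> I \<longrightarrow> (\<exists>X T. app S i = pair X T \<and> IsTop X T \<and> K X T))"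

definition ProductSet :: "'a \<Rightarrow> 'a \<Rightarrow> 'a \<Rightarrow> bool" where
  "ProductSet P S I \<longleftrightarrow> (\<forall>f. f \<epsilon> P \<longleftrightarrow> FunOn f I \<and>
     (\<forall>i X T x. pair i (pair X T) \<epsilon> S \<and> pair i x \<epsilon> f \<longrightarrow> x \<epsilon> X))"

definition Box :: "'a \<Rightarrow> 'a \<Rightarrow> 'a \<Rightarrow> 'a \<Rightarrow> bool" where
  "Box P S I B \<longleftrightarrow> (\<exists>J V. Sub J I \<and> Finite J \<and> FunOn V J \<and>
     (\<forall>j X T v. pair j (pair X T) \<epsilon> S \<and> pair j v \<epsilon> V \<longrightarrow> v \<epsilon> T) \<and>
     (\<forall>f. f \<epsilon> B \<longleftrightarrow> f \<epsilon> P \<and> (\<forall>j v x. pair j v \<epsilon> V \<and> pair j x \<epsilon> f \<longrightarrow> x \<epsilon> v)))"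

lemma Def_Box [dfn]:
  assumes "Trm t" shows "Def (\<lambda>\<rho>. Box P S I (t \<rho>))"
  by (rule Def_app1 [OF _ assms]) (unfold Box_def, intro dfn)

lemma sem_space_at [sem_eq]: "S < d \<Longrightarrow> i < d \<Longrightarrow> X < d \<Longrightarrow> T < d \<Longrightarrow>
    sem \<rho> (space_at S i X T d) \<longleftrightarrow> pair (\<rho> i) (pair (\<rho> X) (\<rho> T)) \<epsilon> \<rho> S"
  by (simp add: space_at_def sem_eq upd del: fun_upd_apply)

lemma sem_family_of_spaces:
  assumes "\<And>\<rho> d X T. X < d \<Longrightarrow> T < d \<Longrightarrow> sem \<rho> (K X T d) \<longleftrightarrow> K' (\<rho> X) (\<rho> T)" "S < d" "I < d"
  shows "sem \<rho> (family_of_spaces K S I d) \<longleftrightarrow> Family K' (\<rho> S) (\<rho> I)"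
proof -
  have "FunOn S I \<and> (\<forall>i. i \<epsilon> I \<longrightarrow> (\<exists>X T. pair i (pair X T) \<epsilon> S \<and> IsTop X T \<and> K' X T)) \<longleftrightarrow>
      Family K' S I" for S I
    unfolding Family_def by (cases "FunOn S I") (auto simp: FunOn_iff; metis)+
  then show ?thesis using assms
    by (simp add: family_of_spaces_def sem_eq upd del: fun_upd_apply)
qed

lemma sem_is_product_set [sem_eq]: "P < d \<Longrightarrow> S < d \<Longrightarrow> I < d \<Longrightarrow>
    sem \<rho> (is_product_set P S I d) \<longleftrightarrow> ProductSet (\<rho> P) (\<rho> S) (\<rho> I)"
  by (simp add: is_product_set_def ProductSet_def sem_eq upd del: fun_upd_apply)

lemma sem_is_box [sem_eq]: "P < d \<Longrightarrow> S < d \<Longrightarrow> I < d \<Longrightarrow> B < d \<Longrightarrow>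
    sem \<rho> (is_box P S I B d) \<longleftrightarrow> Box (\<rho> P) (\<rho> S) (\<rho> I) (\<rho> B)"
  by (simp add: is_box_def Box_def sem_eq upd del: fun_upd_apply)

lemma sem_is_product_space [sem_eq]: "P < d \<Longrightarrow> TP < d \<Longrightarrow> S < d \<Longrightarrow> I < d \<Longrightarrow>
    sem \<rho> (is_product_space P TP S I d) \<longleftrightarrow>
      ProductSet (\<rho> P) (\<rho> S) (\<rho> I) \<and> IsBase (Box (\<rho> P) (\<rho> S) (\<rho> I)) (\<rho> P) (\<rho> TP)"
  using sem_is_base [of "is_box P S I" P S I Box d P TP]
  by (simp add: is_product_space_def reads_def sem_eq)

lemma sem_sentence_i: "sem \<rho> (sentence_i d) \<longleftrightarrow>
    (\<forall>X T. CReg X T \<and> T1 X T \<longrightarrow> Stable (Gdelta T) \<or> Stable (ZeroSet X T))"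
proof -
  have "sem \<rho> (stable_countable_inter (G_delta T) d) \<longleftrightarrow> Stable (Gdelta (\<rho> T))" if "T < d" for \<rho> T d
    by (rule sem_stable [of _ T T T]) (use that in \<open>auto simp: reads_def sem_eq\<close>)
  moreover have "sem \<rho> (stable_countable_inter (zero_set X T) d) \<longleftrightarrow> Stable (ZeroSet (\<rho> X) (\<rho> T))"
    if "X < d" "T < d" for \<rho> X T d
    by (rule sem_stable [of _ X T T]) (use that in \<open>auto simp: reads_def sem_eq\<close>)
  ultimately show ?thesis
    by (simp add: sentence_i_def sem_eq upd del: fun_upd_apply)
qed

lemma sem_sentence_ii: "sem \<rho> (sentence_ii d) \<longleftrightarrow>
    (\<forall>X T. SZD X T \<and> T1 X T \<longrightarrow> Stable (COdelta X T))"
proof -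
  have "sem \<rho> (stable_countable_inter (CO_delta X T) d) \<longleftrightarrow> Stable (COdelta (\<rho> X) (\<rho> T))"
    if "X < d" "T < d" for \<rho> X T d
    by (rule sem_stable [of _ X T T]) (use that in \<open>auto simp: reads_def sem_eq\<close>)
  then show ?thesis
    by (simp add: sentence_ii_def sem_eq upd del: fun_upd_apply)
qed

lemma sem_sentence_iii: "sem \<rho> (sentence_iii d) \<longleftrightarrow>
    (\<forall>X T. CReg X T \<and> T1 X T \<longrightarrow> (\<forall>D. IsBase (Gdelta T) X D \<longrightarrow> PSpace X D))"
proof -
  have "sem \<rho> (is_base (G_delta T) X D d) \<longleftrightarrow> IsBase (Gdelta (\<rho> T)) (\<rho> X) (\<rho> D)"
    if "X < d" "T < d" "D < d" for \<rho> X T D d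
    by (rule sem_is_base [of _ T T T]) (use that in \<open>auto simp: reads_def sem_eq\<close>)
  then show ?thesis
    by (simp add: sentence_iii_def sem_eq upd del: fun_upd_apply)
qed

lemma sem_sentence_iv: "sem \<rho> (sentence_iv d) \<longleftrightarrow>
    (\<forall>I S. Countable I \<and> Family (\<lambda>X T. Countable X \<and> Compact X T \<and> Metrizable X T) S I \<longrightarrow>
     (\<forall>P TP. ProductSet P S I \<and> IsBase (Box P S I) P TP \<longrightarrow> Metrizable P TP))"
proof -
  have "sem \<rho> (family_of_spaces (\<lambda>X T. is_countable X \<^bold>\<and> is_compact X T \<^bold>\<and> metrizable X T) S I d) \<longleftrightarrow>
    Family (\<lambda>X T. Countable X \<and> Compact X T \<and> Metrizable X T) (\<rho> S) (\<rho> I)"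
    if "S < d" "I < d" for \<rho> S I d
    by (rule sem_family_of_spaces) (use that in \<open>auto simp: sem_eq\<close>)
  then show ?thesis
    by (simp add: sentence_iv_def sem_eq upd del: fun_upd_apply)
qed

lemma sem_sentence_v: "sem \<rho> (sentence_v d) \<longleftrightarrow>
    (\<forall>I S. Countable I \<and> Family (\<lambda>X T. Countable X \<and> Compact X T \<and> FirstC X T \<and> CReg X T \<and> T1 X T) S I \<longrightarrow>
     (\<forall>P TP. ProductSet P S I \<and> IsBase (Box P S I) P TP \<longrightarrow> FirstC P TP))"
proof -
  have "sem \<rho> (family_of_spaces (\<lambda>X T. is_countable X \<^bold>\<and> is_compact X T \<^bold>\<and> first_countable X T \<^bold>\<and>
      T3_half_space X T) S I d) \<longleftrightarrow>
    Family (\<lambda>X T. Countable X \<and> Compact X T \<and> FirstC X T \<and> CReg X T \<and> T1 X T) (\<rho> S) (\<rho> I)"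
    if "S < d" "I < d" for \<rho> S I d
    by (rule sem_family_of_spaces) (use that in \<open>auto simp: sem_eq\<close>)
  then show ?thesis
    by (simp add: sentence_v_def sem_eq upd del: fun_upd_apply)
qed

end

section \<open>Order, addition and Archimedean property of the model's reals\<close>

context zf
begin

lemma Sub_refl [simp]: "Sub x x" by (simp add: Sub_def)
lemma Sub_trans: "Sub x y \<Longrightarrow> Sub y z \<Longrightarrow> Sub x z" by (simp add: Sub_def)
lemma Sub_antisym: "Sub x y \<Longrightarrow> Sub y x \<Longrightarrow> x = y" by (auto simp: Sub_def intro: ext)
lemma SubD: "Sub x y \<Longrightarrow> z \<epsilon> x \<Longrightarrow> z \<epsilon> y" by (simp add: Sub_def)

lemma RLess_RLe_trans: "RLess x y \<Longrightarrow> RLe y z \<Longrightarrow> RLess x z"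
  unfolding RLess_def RLe_def by (metis Sub_trans Sub_antisym)

lemma RLe_RLess_trans: "RLe x y \<Longrightarrow> RLess y z \<Longrightarrow> RLess x z"
  unfolding RLess_def RLe_def by (metis Sub_trans Sub_antisym)

lemma RLess_imp_RLe: "RLess x y \<Longrightarrow> RLe x y"
  by (simp add: RLess_def)

lemma RLess_trans: "RLess x y \<Longrightarrow> RLess y z \<Longrightarrow> RLess x z"
  using RLess_RLe_trans RLess_imp_RLe by blast

lemma RLess_real: "RLess x y \<Longrightarrow> IsReal x" "RLess x y \<Longrightarrow> IsReal y"
  by (auto simp: RLess_def RLe_def)

lemma RLess_irrefl [simp]: "\<not> RLess x x"
  by (simp add: RLess_def)

lemma RLessE: "RLess x y \<Longrightarrow> \<exists>q. q \<epsilon> y \<and> \<not> q \<epsilon> x"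
  unfolding RLess_def RLe_def using Sub_antisym [of x y] by (auto simp: Sub_def)

lemma RLessI: "IsReal x \<Longrightarrow> IsReal y \<Longrightarrow> Sub x y \<Longrightarrow> q \<epsilon> y \<Longrightarrow> \<not> q \<epsilon> x \<Longrightarrow> RLess x y"
  unfolding RLess_def RLe_def by auto

definition Cut :: "'a \<Rightarrow> 'a" where "Cut q = Sep Rats (\<lambda>r. RatLess r q)"

lemma Trm_Cut [dfn]: "Trm t \<Longrightarrow> Trm (\<lambda>\<rho>. Cut (t \<rho>))"
  by (rule Trm_app1) (unfold Cut_def, intro dfn)

text \<open>The reals 1/(k+1) and -1/(k+1); the successor keeps the denominator non-zero.\<close>

definition up :: "'a \<Rightarrow> 'a" where "up k = Cut (pair (succ \<emptyset>) (pair \<emptyset> (succ k)))"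
definition down :: "'a \<Rightarrow> 'a" where "down k = Cut (pair \<emptyset> (pair (succ \<emptyset>) (succ k)))"

lemma Trm_up [dfn]: "Trm t \<Longrightarrow> Trm (\<lambda>\<rho>. up (t \<rho>))"
  unfolding up_def by (intro dfn)
lemma Trm_down [dfn]: "Trm t \<Longrightarrow> Trm (\<lambda>\<rho>. down (t \<rho>))"
  unfolding down_def by (intro dfn)

end

lemma divide_less_divide_iff:
  fixes a b c d :: "'f :: linordered_field"
  assumes "0 < c" "0 < d" shows "a / c < b / d \<longleftrightarrow> a * d < b * c"
proof -
  have "a / c < b / d \<longleftrightarrow> a < b * c / d" using assms by (simp add: pos_divide_less_eq)
  then show ?thesis using assms by (simp add: pos_less_divide_eq)
qed

context zf_arith
begin

lemma val_nonneg: "n \<epsilon> \<omega> \<Longrightarrow> 0 \<le> val n"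
  using zero_mem_succ [of n] val_less [of \<emptyset> n] by (auto simp: val_zero)

lemma val_ge_one: "n \<epsilon> \<omega> \<Longrightarrow> n \<noteq> \<emptyset> \<Longrightarrow> 1 \<le> val n"
  using nat_linear [of "succ \<emptyset>" n] val_less [of "succ \<emptyset>" n] by (auto simp: val_one)

lemma val_succ: "n \<epsilon> \<omega> \<Longrightarrow> val (succ n) = val n + 1"
  using val_add [of n "succ \<emptyset>"] by (simp add: val_one)

text \<open>The projections make this total, but it is the value of a fraction only for those
  \<open>q\<close> that satisfy \<open>IsRat q\<close>.\<close>

definition rv :: "'a \<Rightarrow> 'f" where
  "rv q = (val (fst' q) - val (fst' (snd' q))) / val (snd' (snd' q))"

lemma rv_frac: "IsFrac q a b c \<Longrightarrow> rv q = (val a - val b) / val c"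
  by (auto simp: IsFrac_def rv_def)

lemma frac_pos: "IsFrac q a b c \<Longrightarrow> 0 < val c"
  using val_ge_one [of c] by (auto simp: IsFrac_def)

text \<open>The denominators are positive, so cross-multiplying in the field gives exactly the
  comparison of natural numbers in the definition of \<open>RatLess\<close>.\<close>

lemma RatLess_iff: "RatLess q q' \<longleftrightarrow> IsRat q \<and> IsRat q' \<and> rv q < rv q'"
proof -
  have "add (mul a c') (mul b' c) \<epsilon> add (mul a' c) (mul b c') \<longleftrightarrow> rv q < rv q'"
    if f: "IsFrac q a b c" "IsFrac q' a' b' c'" for a b c a' b' c'
  proof -
    have \<omega>: "a \<epsilon> \<omega>" "b \<epsilon> \<omega>" "c \<epsilon> \<omega>" "a' \<epsilon> \<omega>" "b' \<epsilon> \<omega>" "c' \<epsilon> \<omega>" using f by (auto simp: IsFrac_def)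
    have "add (mul a c') (mul b' c) \<epsilon> add (mul a' c) (mul b c') \<longleftrightarrow>
        val a * val c' + val b' * val c < val a' * val c + val b * val c'"
      using \<omega> by (simp flip: val_less add: val_add val_mul)
    also have "\<dots> \<longleftrightarrow> (val a - val b) * val c' < (val a' - val b') * val c"
      by (auto simp: algebra_simps)
    also have "\<dots> \<longleftrightarrow> rv q < rv q'"
      using frac_pos [OF f(1)] frac_pos [OF f(2)]
      by (simp add: rv_frac [OF f(1)] rv_frac [OF f(2)] divide_less_divide_iff)
    finally show ?thesis .
  qed
  then show ?thesis unfolding RatLess_def IsRat_def by blast
qed

lemma RatAdd_rv: "RatAdd q q' t \<Longrightarrow> IsRat t \<and> rv t = rv q + rv q'"
proof -
  assume "RatAdd q q' t"
  then obtain a b c a' b' c' where f: "IsFrac q a b c" "IsFrac q' a' b' c'"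
    and t: "IsFrac t (add (mul a c') (mul a' c)) (add (mul b c') (mul b' c)) (mul c c')"
    unfolding RatAdd_def by blast
  have \<omega>: "a \<epsilon> \<omega>" "b \<epsilon> \<omega>" "c \<epsilon> \<omega>" "a' \<epsilon> \<omega>" "b' \<epsilon> \<omega>" "c' \<epsilon> \<omega>" using f by (auto simp: IsFrac_def)
  have "rv t = rv q + rv q'"
    using frac_pos [OF f(1)] frac_pos [OF f(2)] \<omega>
    by (simp add: rv_frac [OF t] rv_frac [OF f(1)] rv_frac [OF f(2)] val_add val_mul field_simps)
  then show ?thesis using t unfolding IsRat_def by blast
qed

lemma RatAdd_ex: "IsRat q \<Longrightarrow> IsRat q' \<Longrightarrow> \<exists>t. RatAdd q q' t"
proof -
  assume "IsRat q" "IsRat q'"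
  then obtain a b c a' b' c' where f: "IsFrac q a b c" "IsFrac q' a' b' c'"
    unfolding IsRat_def by blast
  then have "mul c c' \<noteq> \<emptyset>"
    using frac_pos [OF f(1)] frac_pos [OF f(2)] val_mul [of c c'] val_zero by (auto simp: IsFrac_def)
  then have "IsFrac (pair (add (mul a c') (mul a' c)) (pair (add (mul b c') (mul b' c)) (mul c c')))
      (add (mul a c') (mul a' c)) (add (mul b c') (mul b' c)) (mul c c')"
    using f by (auto simp: IsFrac_def)
  then show ?thesis using f unfolding RatAdd_def by blast
qed

text \<open>As the field is abstract, a value computed in it need not belong to a fraction of the
  model. The closure rules below provide fractions for sums, negatives and halves.\<close>

definition Val :: "'f \<Rightarrow> bool" where "Val x \<longleftrightarrow> (\<exists>q. IsRat q \<and> rv q = x)"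

lemma Val_rv: "IsRat q \<Longrightarrow> Val (rv q)"
  by (auto simp: Val_def)

lemma Val_frac: "a \<epsilon> \<omega> \<Longrightarrow> b \<epsilon> \<omega> \<Longrightarrow> c \<epsilon> \<omega> \<Longrightarrow> c \<noteq> \<emptyset> \<Longrightarrow> Val ((val a - val b) / val c)"
proof -
  assume "a \<epsilon> \<omega>" "b \<epsilon> \<omega>" "c \<epsilon> \<omega>" "c \<noteq> \<emptyset>"
  then have f: "IsFrac (pair a (pair b c)) a b c" by (simp add: IsFrac_def)
  show ?thesis unfolding Val_def IsRat_def using f rv_frac [OF f] by blast
qed

lemma Val_add: "Val x \<Longrightarrow> Val y \<Longrightarrow> Val (x + y)"
  unfolding Val_def using RatAdd_rv RatAdd_ex by metis

lemma Val_minus: "Val x \<Longrightarrow> Val (- x)"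
proof -
  assume "Val x"
  then obtain q a b c where "IsFrac q a b c" "rv q = x" unfolding Val_def IsRat_def by blast
  then show ?thesis using Val_frac [of b a c] rv_frac [of q a b c]
    by (auto simp: IsFrac_def minus_divide_left)
qed

lemma Val_half: "Val x \<Longrightarrow> Val (x / 2)"
proof -
  assume "Val x"
  then obtain q a b c where f: "IsFrac q a b c" "rv q = x" unfolding Val_def IsRat_def by blast
  have "add c c \<noteq> \<emptyset>" using f frac_pos [OF f(1)] val_add [of c c] val_zero by (auto simp: IsFrac_def)
  then show ?thesis using f Val_frac [of a b "add c c"] rv_frac [of q a b c]
    by (auto simp: IsFrac_def val_add field_simps)
qed

lemma Val_one: "Val 1"
  using Val_frac [of "succ \<emptyset>" \<emptyset> "succ \<emptyset>"] by (simp add: val_zero val_one)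

lemma Val_zero: "Val 0"
  using Val_frac [of \<emptyset> \<emptyset> "succ \<emptyset>"] by simp

lemma Val_between:
  assumes "Val x" "Val y" "x < y" obtains q where "IsRat q" "x < rv q" "rv q < y"
proof -
  have "Val ((x + y) / 2)" using assms Val_add Val_half by blast
  then obtain q where "IsRat q" "rv q = (x + y) / 2" unfolding Val_def by blast
  then show thesis using assms(3) by (intro that [of q]) (auto simp: field_simps)
qed

lemma IsReal_iff: "IsReal D \<longleftrightarrow> (\<forall>q. q \<epsilon> D \<longrightarrow> IsRat q) \<and> (\<exists>q. q \<epsilon> D) \<and> (\<exists>q. IsRat q \<and> \<not> q \<epsilon> D) \<and>
     (\<forall>q r. q \<epsilon> D \<and> IsRat r \<and> rv r < rv q \<longrightarrow> r \<epsilon> D) \<and>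
     (\<forall>q. q \<epsilon> D \<longrightarrow> (\<exists>r. r \<epsilon> D \<and> rv q < rv r))"
  unfolding IsReal_def RatLess_iff ex_mem by blast

lemma real_rat: "IsReal x \<Longrightarrow> q \<epsilon> x \<Longrightarrow> IsRat q"
  unfolding IsReal_iff by blast

lemma real_larger: "IsReal x \<Longrightarrow> q \<epsilon> x \<Longrightarrow> \<exists>r. r \<epsilon> x \<and> rv q < rv r"
  unfolding IsReal_iff by blast

lemma real_down: "IsReal x \<Longrightarrow> q \<epsilon> x \<Longrightarrow> IsRat r \<Longrightarrow> rv r \<le> rv q \<Longrightarrow> r \<epsilon> x"
  using real_larger [of x q] unfolding IsReal_iff by (meson le_less_trans)

lemma real_upper: "IsReal x \<Longrightarrow> q \<epsilon> x \<Longrightarrow> IsRat r \<Longrightarrow> \<not> r \<epsilon> x \<Longrightarrow> rv q < rv r"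
  using real_down [of x q r] by (meson not_le)

lemma mem_Cut: "IsRat q \<Longrightarrow> r \<epsilon> Cut q \<longleftrightarrow> IsRat r \<and> rv r < rv q"
  unfolding Cut_def by (subst mem_Sep, intro dfn) (auto simp: RatLess_iff)

lemma IsReal_Cut:
  assumes q: "IsRat q" shows "IsReal (Cut q)"
proof -
  have "Val (rv q - 1)" using Val_add [OF Val_rv [OF q] Val_minus [OF Val_one]] by simp
  then obtain p where "IsRat p" "rv p = rv q - 1" unfolding Val_def by blast
  then have "\<exists>p. p \<epsilon> Cut q" using mem_Cut [OF q] by (intro exI [of _ p]) simp
  moreover have "\<not> q \<epsilon> Cut q" using mem_Cut [OF q] by simp
  moreover have "\<exists>s. s \<epsilon> Cut q \<and> rv r < rv s" if "r \<epsilon> Cut q" for r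
  proof -
    have "IsRat r" "rv r < rv q" using that mem_Cut [OF q] by auto
    then obtain s where "IsRat s" "rv r < rv s" "rv s < rv q"
      using Val_between [of "rv r" "rv q"] Val_rv q by metis
    then show ?thesis using mem_Cut [OF q] by blast
  qed
  ultimately show ?thesis unfolding IsReal_iff using q mem_Cut [OF q] by auto
qed

lemma Cut_less: "IsReal x \<Longrightarrow> q \<epsilon> x \<Longrightarrow> RLess (Cut q) x"
proof -
  assume x: "IsReal x" "q \<epsilon> x"
  then have q: "IsRat q" using real_rat by blast
  then show ?thesis
    using x IsReal_Cut [OF q] mem_Cut [OF q] real_down [OF x] by (intro RLessI [of _ _ q]) (auto simp: Sub_def)
qed

lemma Cut_ge: "IsReal x \<Longrightarrow> IsRat q \<Longrightarrow> \<not> q \<epsilon> x \<Longrightarrow> RLe x (Cut q)"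
  unfolding RLe_def Sub_def using IsReal_Cut mem_Cut real_upper real_rat by blast

lemma Cut_mono: "IsRat p \<Longrightarrow> IsRat q \<Longrightarrow> rv p < rv q \<Longrightarrow> RLess (Cut p) (Cut q)"
  by (rule Cut_less) (simp_all add: IsReal_Cut mem_Cut)

lemma RZero_iff: "q \<epsilon> RZero \<longleftrightarrow> IsRat q \<and> rv q < 0"
proof -
  have "rv q < 0 \<longleftrightarrow> a \<epsilon> b" if f: "IsFrac q a b c" for a b c
  proof -
    have "a \<epsilon> \<omega>" "b \<epsilon> \<omega>" using f by (simp_all add: IsFrac_def)
    from val_less [OF this] show ?thesis
      using frac_pos [OF f] by (auto simp: rv_frac [OF f] divide_less_0_iff)
  qed
  then show ?thesis unfolding mem_RZero IsRat_def by blast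
qed

lemma RZero_Cut: "IsRat q \<Longrightarrow> rv q = 0 \<Longrightarrow> RZero = Cut q"
  by (rule ext) (simp add: RZero_iff mem_Cut)

lemma IsReal_RZero: "IsReal RZero"
  using Val_zero RZero_Cut IsReal_Cut unfolding Val_def by metis

lemma real_linear: "IsReal x \<Longrightarrow> IsReal y \<Longrightarrow> RLess x y \<or> x = y \<or> RLess y x"
proof -
  assume x: "IsReal x" and y: "IsReal y"
  have "Sub x y \<or> Sub y x"
  proof (rule ccontr)
    assume "\<not> ?thesis"
    then obtain p q where pq: "p \<epsilon> x" "\<not> p \<epsilon> y" "q \<epsilon> y" "\<not> q \<epsilon> x" unfolding Sub_def by blast
    then have "rv p < rv q" "rv q < rv p" using real_upper real_rat x y by blast+
    then show False by simp
  qed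
  then show ?thesis using x y unfolding RLess_def RLe_def by blast
qed

lemma real_below: "IsReal x \<Longrightarrow> \<exists>a. RLess a x"
  using Cut_less unfolding IsReal_iff by blast

lemma real_above: "IsReal x \<Longrightarrow> \<exists>b. RLess x b"
proof -
  assume x: "IsReal x"
  then obtain q where q: "IsRat q" "\<not> q \<epsilon> x" unfolding IsReal_iff by blast
  have "Val (rv q + 1)" using Val_add [OF Val_rv [OF q(1)] Val_one] .
  then obtain p where "IsRat p" "rv p = rv q + 1" unfolding Val_def by blast
  then have "RLess (Cut q) (Cut p)" using Cut_mono q by simp
  then show ?thesis using Cut_ge [OF x q] RLe_RLess_trans by blast
qed

lemma mem_radd_iff:
  assumes "IsReal x" "IsReal y"
  shows "q \<epsilon> radd x y \<longleftrightarrow> IsRat q \<and> (\<exists>q1 q2. q1 \<epsilon> x \<and> q2 \<epsilon> y \<and> rv q < rv q1 + rv q2)"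
proof
  assume "q \<epsilon> radd x y"
  then obtain q1 q2 t where "q1 \<epsilon> x" "q2 \<epsilon> y" "RatAdd q1 q2 t" "RatLess q t" unfolding mem_radd by blast
  then show "IsRat q \<and> (\<exists>q1 q2. q1 \<epsilon> x \<and> q2 \<epsilon> y \<and> rv q < rv q1 + rv q2)"
    using RatAdd_rv [of q1 q2 t] RatLess_iff by auto
next
  assume "IsRat q \<and> (\<exists>q1 q2. q1 \<epsilon> x \<and> q2 \<epsilon> y \<and> rv q < rv q1 + rv q2)"
  then obtain q1 q2 where q: "IsRat q" "q1 \<epsilon> x" "q2 \<epsilon> y" "rv q < rv q1 + rv q2" by blast
  then have "IsRat q1" "IsRat q2" using assms real_rat by blast+
  then obtain t where t: "RatAdd q1 q2 t" using RatAdd_ex by blast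
  then have "RatLess q t" using RatAdd_rv [OF t] q RatLess_iff by simp
  then show "q \<epsilon> radd x y" unfolding mem_radd using q t by blast
qed

lemma IsReal_radd:
  assumes x: "IsReal x" and y: "IsReal y" shows "IsReal (radd x y)"
proof -
  note mem = mem_radd_iff [OF x y]
  obtain p q where pq: "p \<epsilon> x" "q \<epsilon> y" using x y unfolding IsReal_iff by blast
  obtain p' q' where pq': "IsRat p'" "\<not> p' \<epsilon> x" "IsRat q'" "\<not> q' \<epsilon> y" using x y unfolding IsReal_iff by blast
  have "Val (rv p + rv q + - 1)"
    using pq x y real_rat by (intro Val_add Val_minus Val_one Val_rv) auto
  then obtain s where "IsRat s" "rv s = rv p + rv q + - 1" unfolding Val_def by blast
  moreover from this have "rv s < rv p + rv q" by simp
  ultimately have "s \<epsilon> radd x y" unfolding mem using pq by blast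
  moreover have "\<exists>s. IsRat s \<and> \<not> s \<epsilon> radd x y"
  proof -
    have "Val (rv p' + rv q')" using pq' by (intro Val_add Val_rv)
    then obtain s where s: "IsRat s" "rv s = rv p' + rv q'" unfolding Val_def by blast
    have "\<not> s \<epsilon> radd x y"
    proof
      assume "s \<epsilon> radd x y"
      then obtain q1 q2 where "q1 \<epsilon> x" "q2 \<epsilon> y" "rv s < rv q1 + rv q2" unfolding mem by blast
      moreover from this have "rv q1 < rv p'" "rv q2 < rv q'" using real_upper x y pq' by blast+
      ultimately show False using s(2) by simp
    qed
    then show ?thesis using s by blast
  qed
  moreover have "\<exists>r. r \<epsilon> radd x y \<and> rv q < rv r" if s: "q \<epsilon> radd x y" for q
  proof -
    obtain q1 q2 where q: "IsRat q" "q1 \<epsilon> x" "q2 \<epsilon> y" "rv q < rv q1 + rv q2" using s unfolding mem by blast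
    then have "Val (rv q1 + rv q2)" using real_rat x y by (intro Val_add Val_rv) auto
    then obtain r where "IsRat r" "rv q < rv r" "rv r < rv q1 + rv q2"
      using Val_between [of "rv q" "rv q1 + rv q2"] Val_rv q by metis
    then show ?thesis unfolding mem using q by blast
  qed
  moreover have "r \<epsilon> radd x y" if "q \<epsilon> radd x y" "IsRat r" "rv r < rv q" for q r
    using that unfolding mem by (meson less_trans)
  moreover have "IsRat q" if "q \<epsilon> radd x y" for q using that unfolding mem by blast
  ultimately show ?thesis unfolding IsReal_iff by blast
qed

lemma radd_commute: "IsReal x \<Longrightarrow> IsReal y \<Longrightarrow> radd x y = radd y x"
  by (rule ext) (simp add: mem_radd_iff, metis add.commute)

lemma RLe_radd: "RLe RZero x \<Longrightarrow> IsReal y \<Longrightarrow> RLe y (radd x y)"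
proof -
  assume x: "RLe RZero x" and y: "IsReal y"
  then have rx: "IsReal x" by (simp add: RLe_def)
  have "q \<epsilon> radd x y" if q: "q \<epsilon> y" for q
  proof -
    obtain r where r: "r \<epsilon> y" "rv q < rv r" using real_larger [OF y q] by blast
    \<comment> \<open>Half of the negative number \<open>q - r\<close>: it belongs to every cut that
      is at least zero, and added to \<open>r\<close> it gives the midpoint of \<open>q\<close> and
      \<open>r\<close>, which is still above \<open>q\<close>.\<close>
    have "Val ((rv q + - rv r) / 2)"
      using r that real_rat y by (intro Val_half Val_add Val_minus Val_rv) auto
    then obtain p where p: "IsRat p" "rv p = (rv q + - rv r) / 2" unfolding Val_def by blast
    then have "rv p < 0" using r by (simp add: divide_less_0_iff)
    then have "p \<epsilon> x" using p x by (simp add: RLe_def Sub_def RZero_iff)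
    moreover have "rv q < rv p + rv r" using p r by (simp add: field_simps)
    ultimately show ?thesis unfolding mem_radd_iff [OF rx y] using r real_rat y that by blast
  qed
  then show ?thesis unfolding RLe_def Sub_def using y IsReal_radd rx by blast
qed

text \<open>Serves to show that balls are open without subtracting reals. For rationals
  \<open>q < q'\<close> in \<open>e\<close> with \<open>q\<close> outside \<open>r\<close>, the cut
  at \<open>q' - q\<close> can be added to \<open>r\<close> without passing the cut at
  \<open>q'\<close>.\<close>

lemma RLess_radd:
  assumes "RLess r e"
  obtains \<delta> where "RLess RZero \<delta>" "\<And>s. RLess s \<delta> \<Longrightarrow> RLess (radd r s) e"
proof -
  have r: "IsReal r" and e: "IsReal e" using assms RLess_real by auto
  obtain q where q: "q \<epsilon> e" "\<not> q \<epsilon> r" using RLessE [OF assms] by blast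
  obtain q' where q': "q' \<epsilon> e" "rv q < rv q'" using real_larger e q by blast
  have rat: "IsRat q" "IsRat q'" using q q' real_rat e by blast+
  have "Val (rv q' + - rv q)" using rat by (intro Val_add Val_minus Val_rv)
  then obtain p where p: "IsRat p" "rv p = rv q' - rv q" unfolding Val_def by auto
  obtain z where z: "IsRat z" "rv z = 0" using Val_zero unfolding Val_def by blast
  have "RLess RZero (Cut p)"
    unfolding RZero_Cut [OF z] using Cut_mono [OF z(1) p(1)] z(2) p(2) q'(2) by simp
  moreover have "RLess (radd r s) e" if "RLess s (Cut p)" for s
  proof -
    have s: "IsReal s" using that RLess_real by blast
    have "RLe (radd r s) (Cut q')"
      unfolding RLe_def Sub_def
    proof (intro conjI allI impI IsReal_radd r s IsReal_Cut rat)
      fix t assume "t \<epsilon> radd r s"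
      then obtain q1 q2 where t: "IsRat t" "q1 \<epsilon> r" "q2 \<epsilon> s" "rv t < rv q1 + rv q2"
        unfolding mem_radd_iff [OF r s] by blast
      have "rv q1 < rv q" using real_upper [OF r t(2) rat(1) q(2)] .
      moreover have "q2 \<epsilon> Cut p" using that t(3) by (auto simp: RLess_def RLe_def Sub_def)
      then have "rv q2 < rv q' - rv q" using mem_Cut [OF p(1)] p(2) by simp
      ultimately have "rv t < rv q'" using t(4) by simp
      then show "t \<epsilon> Cut q'" using t(1) mem_Cut [OF rat(2)] by simp
    qed
    then show ?thesis using Cut_less [OF e q'(1)] RLe_RLess_trans by blast
  qed
  ultimately show thesis by (rule that)
qed

lemma up_frac: "k \<epsilon> \<omega> \<Longrightarrow> IsFrac (pair (succ \<emptyset>) (pair \<emptyset> (succ k))) (succ \<emptyset>) \<emptyset> (succ k)"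
  and down_frac: "k \<epsilon> \<omega> \<Longrightarrow> IsFrac (pair \<emptyset> (pair (succ \<emptyset>) (succ k))) \<emptyset> (succ \<emptyset>) (succ k)"
  by (simp_all add: IsFrac_def)

lemma up_rat:
  assumes "k \<epsilon> \<omega>"
  shows "IsRat (pair (succ \<emptyset>) (pair \<emptyset> (succ k)))" "rv (pair (succ \<emptyset>) (pair \<emptyset> (succ k))) = 1 / (val k + 1)"
  using up_frac [OF assms] rv_frac [OF up_frac [OF assms]] assms
  by (auto simp: IsRat_def val_one val_zero val_succ)

lemma down_rat:
  assumes "k \<epsilon> \<omega>"
  shows "IsRat (pair \<emptyset> (pair (succ \<emptyset>) (succ k)))" "rv (pair \<emptyset> (pair (succ \<emptyset>) (succ k))) = - (1 / (val k + 1))"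
  using down_frac [OF assms] rv_frac [OF down_frac [OF assms]] assms
  by (auto simp: IsRat_def val_one val_zero val_succ)

lemma IsReal_up: "k \<epsilon> \<omega> \<Longrightarrow> IsReal (up k)"
  unfolding up_def using IsReal_Cut up_rat by auto

lemma up_pos: "k \<epsilon> \<omega> \<Longrightarrow> RLess RZero (up k)" and down_neg: "k \<epsilon> \<omega> \<Longrightarrow> RLess (down k) RZero"
proof -
  assume k: "k \<epsilon> \<omega>"
  obtain z where z: "IsRat z" "rv z = 0" using Val_zero unfolding Val_def by blast
  have "0 < 1 / (val k + 1)" using val_nonneg [OF k] by simp
  then show "RLess RZero (up k)" "RLess (down k) RZero"
    unfolding RZero_Cut [OF z] up_def down_def using z up_rat [OF k] down_rat [OF k] by (auto intro: Cut_mono)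
qed

lemma up_antimono: "k \<epsilon> \<omega> \<Longrightarrow> j \<epsilon> k \<Longrightarrow> RLess (up k) (up j)"
proof -
  assume k: "k \<epsilon> \<omega>" "j \<epsilon> k"
  then have j: "j \<epsilon> \<omega>" using omega_trans by blast
  have "val j < val k" using k j val_less by blast
  then have "1 / (val k + 1) < 1 / (val j + 1)" using val_nonneg [OF j] by (intro divide_strict_left_mono) auto
  then show ?thesis unfolding up_def using up_rat k j by (intro Cut_mono) auto
qed

text \<open>The numerator of a non-zero fraction is at least 1 in absolute value, so the fraction is
  at least 1/c and exceeds 1/(c+1). As \<open>c\<close> is a number of the model, this yields the
  Archimedean property relative to the model's own omega.\<close>

lemma frac_bound:
  assumes f: "IsFrac q a b c"
  shows "0 < rv q \<Longrightarrow> 1 / (val c + 1) < rv q" "rv q < 0 \<Longrightarrow> rv q < - (1 / (val c + 1))"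
proof -
  have c: "0 < val c" by (rule frac_pos [OF f])
  have *: "1 / (val c + 1) < (val x - val y) / val c" if xy: "x \<epsilon> \<omega>" "y \<epsilon> \<omega>" "val y < val x" for x y
  proof -
    have "y \<epsilon> x" using xy val_less by blast
    then obtain k where "k \<epsilon> \<omega>" "x = add y (succ k)" using xy mem_iff_add by blast
    then have "1 \<le> val x - val y" using val_add [of y "succ k"] val_succ [of k] val_nonneg [of k] xy by simp
    then have "1 / val c \<le> (val x - val y) / val c" using c by (intro divide_right_mono) auto
    moreover have "1 / (val c + 1) < 1 / val c" using c by (intro divide_strict_left_mono) auto
    ultimately show ?thesis by simp
  qed
  have ab: "a \<epsilon> \<omega>" "b \<epsilon> \<omega>" using f by (auto simp: IsFrac_def)
  show "1 / (val c + 1) < rv q" if "0 < rv q"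
    using that c ab * [of a b] by (simp add: rv_frac [OF f] zero_less_divide_iff)
  show "rv q < - (1 / (val c + 1))" if "rv q < 0"
  proof -
    have "val a < val b" using that c by (simp add: rv_frac [OF f] divide_less_0_iff)
    then have "1 / (val c + 1) < (val b - val a) / val c" using * ab by blast
    also have "\<dots> = - rv q" by (simp add: rv_frac [OF f] minus_divide_left)
    finally show ?thesis by simp
  qed
qed

lemma archimedean: "RLess RZero e \<Longrightarrow> \<exists>k. k \<epsilon> \<omega> \<and> RLess (up k) e"
proof -
  assume e: "RLess RZero e"
  then obtain p where p: "p \<epsilon> e" "\<not> p \<epsilon> RZero" using RLessE by blast
  then have re: "IsReal e" "IsRat p" using e RLess_real real_rat by blast+
  obtain q where q: "q \<epsilon> e" "rv p < rv q" using real_larger re p by blast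
  have "0 < rv q" using p q re by (simp add: RZero_iff)
  obtain a b c where f: "IsFrac q a b c" using q real_rat re IsRat_def by metis
  then have c: "c \<epsilon> \<omega>" by (simp add: IsFrac_def)
  have "RLess (up c) (Cut q)"
    unfolding up_def using up_rat [OF c] frac_bound(1) [OF f \<open>0 < rv q\<close>] q real_rat re by (intro Cut_mono) auto
  then show ?thesis using c Cut_less [OF re(1) q(1)] RLess_trans by blast
qed

lemma archimedean_neg: "RLess e RZero \<Longrightarrow> \<exists>k. k \<epsilon> \<omega> \<and> RLess e (down k)"
proof -
  assume e: "RLess e RZero"
  then obtain p where p: "p \<epsilon> RZero" "\<not> p \<epsilon> e" using RLessE by blast
  then have re: "IsReal e" "IsRat p" "rv p < 0" using e RLess_real RZero_iff by blast+
  obtain a b c where f: "IsFrac p a b c" using re IsRat_def by metis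
  then have c: "c \<epsilon> \<omega>" by (simp add: IsFrac_def)
  have "RLess (Cut p) (down c)"
    unfolding down_def using down_rat [OF c] frac_bound(2) [OF f re(3)] re by (intro Cut_mono) auto
  then show ?thesis using c Cut_ge [OF re(1,2) p(2)] RLe_RLess_trans by blast
qed

lemma ROpen_interval:
  "ROpen (Sep Reals (\<lambda>x. RLess a x \<and> RLess x b))"
proof -
  have "y \<epsilon> Sep Reals (\<lambda>x. RLess a x \<and> RLess x b) \<longleftrightarrow> RLess a y \<and> RLess y b" for y
    by (subst mem_Sep, intro dfn) (auto dest: RLess_real)
  then show ?thesis unfolding ROpen_def using RLess_real by blast
qed

lemma ROpen_nonzero: "ROpen (diff Reals (sing RZero))"
proof -
  have "\<exists>a b. RLess a x \<and> RLess x b \<and> (\<forall>y. RLess a y \<and> RLess y b \<longrightarrow> IsReal y \<and> y \<noteq> RZero)"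
    if x: "IsReal x" "x \<noteq> RZero" for x
  proof -
    obtain a b where ab: "RLess a x" "RLess x b" using real_below real_above x by blast
    consider "RLess x RZero" | "RLess RZero x" using real_linear [OF x(1) IsReal_RZero] x by blast
    then show ?thesis
    proof cases
      case 1
      then show ?thesis using ab RLess_real RLess_irrefl by blast
    next
      case 2
      then show ?thesis using ab RLess_real RLess_irrefl by blast
    qed
  qed
  then show ?thesis unfolding ROpen_def by simp
qed

end

section \<open>One-point compactifications of discrete sets\<close>

context zf
begin

text \<open>The one-point compactification of the discrete space \<open>A\<close> is \<open>A \<union> {A}\<close>: by foundation,
  \<open>A\<close> itself serves as the point at infinity.\<close>

definition Alex :: "'a \<Rightarrow> 'a" where
  "Alex A = Sep (Pow (succ A)) (\<lambda>U. A \<epsilon> U \<longrightarrow> Finite (diff A U))"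

lemma Trm_Alex [dfn]: "Trm t \<Longrightarrow> Trm (\<lambda>\<rho>. Alex (t \<rho>))"
  by (rule Trm_app1) (unfold Alex_def, intro dfn)

lemma mem_Alex: "U \<epsilon> Alex A \<longleftrightarrow> Sub U (succ A) \<and> (A \<epsilon> U \<longrightarrow> Finite (diff A U))"
  unfolding Alex_def by (subst mem_Sep, intro dfn) simp

lemma IsTop_Alex: "IsTop (succ A) (Alex A)"
  unfolding IsTop_def
proof (intro conjI allI impI)
  fix U assume "U \<epsilon> Alex A"
  then show "Sub U (succ A)" by (simp add: mem_Alex)
next
  have "diff A (succ A) = \<emptyset>" by (rule ext) simp
  then show "succ A \<epsilon> Alex A" by (simp add: mem_Alex)
next
  fix S assume S: "Sub S (Alex A)"
  have "Finite (diff A (Union S))" if "A \<epsilon> Union S"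
  proof -
    obtain U where U: "U \<epsilon> S" "A \<epsilon> U" using \<open>A \<epsilon> Union S\<close> by auto
    then have "Finite (diff A U)" using S SubD mem_Alex by blast
    then show ?thesis by (rule Finite_subset) (use U in \<open>auto simp: Sub_def\<close>)
  qed
  moreover have "Sub (Union S) (succ A)"
    unfolding Sub_def mem_Union using S SubD mem_Alex by blast
  ultimately show "Union S \<epsilon> Alex A" by (simp add: mem_Alex)
next
  fix U V assume UV: "U \<epsilon> Alex A \<and> V \<epsilon> Alex A"
  have "Finite (diff A (inter U V))" if "A \<epsilon> inter U V"
  proof -
    have "Finite (un (diff A U) (diff A V))" using UV that by (intro Finite_un) (auto simp: mem_Alex)
    then show ?thesis by (rule Finite_subset) (auto simp: Sub_def)
  qed
  then show "inter U V \<epsilon> Alex A" using UV by (auto simp: mem_Alex Sub_def)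
qed

lemma Alex_discrete: "Sub U A \<Longrightarrow> U \<epsilon> Alex A"
  using mem_irrefl [of A] by (auto simp: mem_Alex Sub_def)

lemma Alex_diff_sing: "x \<epsilon> succ A \<Longrightarrow> diff (succ A) (sing x) \<epsilon> Alex A"
proof (cases "x = A")
  case True
  then show ?thesis by (intro Alex_discrete) (auto simp: Sub_def)
next
  case False
  have "Finite (diff A (diff (succ A) (sing x)))"
    by (rule Finite_subset [of "sing x"]) (auto simp: Sub_def)
  then show ?thesis by (simp add: mem_Alex Sub_def)
qed

lemma T1_Alex: "T1 (succ A) (Alex A)"
  unfolding T1_def Closed_def
  using IsTop_Alex Alex_diff_sing by (simp add: Sub_def)

lemma Clopen_sing: "x \<epsilon> A \<Longrightarrow> Clopen (succ A) (Alex A) (sing x)"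
  unfolding Clopen_def Closed_def using Alex_diff_sing [of x A] Alex_discrete [of "sing x" A]
  by (simp add: Sub_def)

lemma Clopen_diff_sing: "x \<epsilon> A \<Longrightarrow> Clopen (succ A) (Alex A) (diff (succ A) (sing x))"
proof -
  assume x: "x \<epsilon> A"
  then have "diff (succ A) (diff (succ A) (sing x)) = sing x" by (auto intro: ext)
  then show ?thesis
    using Clopen_sing [OF x] by (simp add: Clopen_def Closed_def Sub_def)
qed

text \<open>The complement lies in \<open>A\<close>, where every subset is open.\<close>

lemma Clopen_infinity: "U \<epsilon> Alex A \<Longrightarrow> A \<epsilon> U \<Longrightarrow> Clopen (succ A) (Alex A) U"
  unfolding Clopen_def Closed_def by (auto simp: mem_Alex Sub_def intro!: Alex_discrete)

lemma Compact_Alex: "Compact (succ A) (Alex A)"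
  unfolding Compact_def
proof (intro allI impI)
  fix C assume C: "Sub C (Alex A) \<and> (\<forall>x. x \<epsilon> succ A \<longrightarrow> (\<exists>U. U \<epsilon> C \<and> x \<epsilon> U))"
  then obtain U where U: "U \<epsilon> C" "A \<epsilon> U" by (metis mem_succ)
  then have "Finite (diff A U)" using C SubD mem_Alex by blast
  \<comment> \<open>Members of the cover are found for one point at a time, by induction over the
    finite set of points left out by \<open>U\<close>; no choice function is used.\<close>
  moreover have "Sub F A \<longrightarrow> (\<exists>G. Sub G C \<and> Finite G \<and> (\<forall>x. x \<epsilon> F \<longrightarrow> (\<exists>U. U \<epsilon> G \<and> x \<epsilon> U)))"
    if "Finite F" for F
    using that
  proof (induction F rule: Finite_induct)
    case def show ?case by (intro dfn)
  next
    case empty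
    show ?case by (intro impI exI [of _ \<emptyset>]) (simp add: Sub_def)
  next
    case (ins x F)
    show ?case
    proof
      assume sub: "Sub (ins x F) A"
      then have "Sub F A" by (simp add: Sub_def)
      then obtain G where G: "Sub G C" "Finite G" "\<And>x. x \<epsilon> F \<Longrightarrow> \<exists>U. U \<epsilon> G \<and> x \<epsilon> U" using ins by blast
      obtain V where V: "V \<epsilon> C" "x \<epsilon> V" using sub C by (metis mem_ins mem_succ SubD)
      have "Sub (ins V G) C" using V G(1) by (auto simp: Sub_def)
      moreover have "\<exists>U. U \<epsilon> ins V G \<and> y \<epsilon> U" if "y \<epsilon> ins x F" for y
        using that V G(3) [of y] by auto
      ultimately show "\<exists>G. Sub G C \<and> Finite G \<and> (\<forall>y. y \<epsilon> ins x F \<longrightarrow> (\<exists>U. U \<epsilon> G \<and> y \<epsilon> U))"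
        using Finite_ins [OF G(2)] by blast
    qed
  qed
  moreover have "Sub (diff A U) A" by (simp add: Sub_def)
  ultimately obtain G where G: "Sub G C" "Finite G" "\<And>x. x \<epsilon> diff A U \<Longrightarrow> \<exists>V. V \<epsilon> G \<and> x \<epsilon> V" by blast
  have "Sub (ins U G) C" using U G(1) by (auto simp: Sub_def)
  moreover have "\<exists>V. V \<epsilon> ins U G \<and> x \<epsilon> V" if "x \<epsilon> succ A" for x
    using that U G(3) [of x] by (cases "x \<epsilon> U") auto
  ultimately show "\<exists>F. Sub F C \<and> Finite F \<and> (\<forall>x. x \<epsilon> succ A \<longrightarrow> (\<exists>U. U \<epsilon> F \<and> x \<epsilon> U))"
    using Finite_ins [OF G(2)] by blast
qed

lemma IsTop_empty: "IsTop X T \<Longrightarrow> \<emptyset> \<epsilon> T"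
proof -
  assume "IsTop X T"
  moreover have "Sub \<emptyset> T" by (simp add: Sub_def)
  moreover have "Union \<emptyset> = \<emptyset>" by (rule ext) simp
  ultimately show ?thesis unfolding IsTop_def by metis
qed

text \<open>Taking the union of all open subsets of \<open>U\<close> avoids choosing a neighbourhood
  for each point.\<close>

lemma IsTop_open: "IsTop X T \<Longrightarrow> Sub U X \<Longrightarrow> (\<And>x. x \<epsilon> U \<Longrightarrow> \<exists>B. B \<epsilon> T \<and> x \<epsilon> B \<and> Sub B U) \<Longrightarrow> U \<epsilon> T"
proof -
  assume T: "IsTop X T" and U: "\<And>x. x \<epsilon> U \<Longrightarrow> \<exists>B. B \<epsilon> T \<and> x \<epsilon> B \<and> Sub B U"
  have S: "B \<epsilon> Sep T (\<lambda>B. Sub B U) \<longleftrightarrow> B \<epsilon> T \<and> Sub B U" for B by (rule mem_Sep) (intro dfn)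
  have "(\<exists>B. (B \<epsilon> T \<and> Sub B U) \<and> z \<epsilon> B) \<longleftrightarrow> z \<epsilon> U" for z
    using U [of z] unfolding Sub_def by blast
  then have "Union (Sep T (\<lambda>B. Sub B U)) = U"
    by (intro ext) (unfold mem_Union S)
  moreover have "Sub (Sep T (\<lambda>B. Sub B U)) T" using S by (simp add: Sub_def)
  ultimately show ?thesis using T unfolding IsTop_def by metis
qed

end

context zf_arith
begin

text \<open>The indicator function is continuous, with \<open>up \<emptyset>\<close> as the real
  number 1.\<close>

lemma Clopen_Cozero:
  assumes T: "IsTop X T" and C: "Clopen X T C" shows "Cozero X T C"
proof -
  have Co: "C \<epsilon> T" "diff X C \<epsilon> T" "Sub C X" using C by (auto simp: Clopen_def Closed_def)
  define f where "f = lam X (\<lambda>x. if x \<epsilon> C then up \<emptyset> else RZero)"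
  have tf: "Trm (\<lambda>\<rho>. if \<rho> 0 \<epsilon> C then up \<emptyset> else RZero)" by (intro dfn)
  have f: "FunOn f X" unfolding f_def by (rule FunOn_lam [OF tf])
  have app: "app f x = (if x \<epsilon> C then up \<emptyset> else RZero)" if "x \<epsilon> X" for x
    unfolding f_def using app_lam [OF tf that] by simp
  have real: "IsReal (up \<emptyset>)" "IsReal RZero" by (simp_all add: IsReal_up IsReal_RZero)
  have ne: "up \<emptyset> \<noteq> RZero" using up_pos [of \<emptyset>] by auto
  have "Sep X (\<lambda>x. app f x \<epsilon> U) \<epsilon> T" for U
  proof -
    have "Sep X (\<lambda>x. app f x \<epsilon> U) =
      (if up \<emptyset> \<epsilon> U then if RZero \<epsilon> U then X else C else if RZero \<epsilon> U then diff X C else \<emptyset>)"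
      by (rule ext) (use app SubD [OF Co(3)] in auto)
    then show ?thesis using Co T IsTop_empty [OF T] by (simp add: IsTop_def)
  qed
  then have "Cont X T f" unfolding Cont_def FunTo_def using f app real by simp
  moreover have "C = diff X (Sep X (\<lambda>x. app f x = RZero))"
    by (rule ext) (use app ne SubD [OF Co(3)] in auto)
  ultimately show ?thesis unfolding Cozero_def ZeroSet_def by blast
qed

lemma Cozero_open: "Cozero X T C \<Longrightarrow> C \<epsilon> T"
proof -
  assume "Cozero X T C"
  then obtain f where f: "Cont X T f" "C = diff X (Sep X (\<lambda>x. app f x = RZero))"
    unfolding Cozero_def ZeroSet_def by blast
  have "C = Sep X (\<lambda>x. app f x \<epsilon> diff Reals (sing RZero))"
    unfolding f(2)
    by (rule ext, subst mem_preimage)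
      (use f(1) in \<open>auto simp: Cont_def FunTo_def\<close>)
  then show ?thesis using f(1) ROpen_nonzero unfolding Cont_def by metis
qed

text \<open>At a point of \<open>A\<close> the singleton serves as cozero neighbourhood, at infinity
  the given neighbourhood itself; both are clopen.\<close>

lemma CReg_Alex: "CReg (succ A) (Alex A)"
  unfolding CReg_def IsBase_def
proof (intro conjI allI iffI IsTop_Alex impI)
  fix U assume U: "U \<epsilon> Alex A"
  then show "Sub U (succ A)" by (simp add: mem_Alex)
  fix x assume x: "x \<epsilon> U"
  then have "x \<epsilon> succ A" using U SubD mem_Alex by blast
  show "\<exists>B. Cozero (succ A) (Alex A) B \<and> x \<epsilon> B \<and> Sub B U"
  proof (cases "x = A")
    case True
    then show ?thesis using x U Clopen_Cozero [OF IsTop_Alex] Clopen_infinity Sub_refl by blast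
  next
    case False
    then have "Clopen (succ A) (Alex A) (sing x)" using \<open>x \<epsilon> succ A\<close> Clopen_sing by simp
    then have "Cozero (succ A) (Alex A) (sing x)" using Clopen_Cozero [OF IsTop_Alex] by blast
    then show ?thesis using x by (intro exI [of _ "sing x"]) (simp add: Sub_def)
  qed
next
  fix U assume "Sub U (succ A) \<and> (\<forall>x. x \<epsilon> U \<longrightarrow> (\<exists>B. Cozero (succ A) (Alex A) B \<and> x \<epsilon> B \<and> Sub B U))"
  then show "U \<epsilon> Alex A" by (intro IsTop_open [OF IsTop_Alex]) (auto dest: Cozero_open)
qed

text \<open>One of two disjoint zero-sets misses infinity. Its complement is an open neighbourhood
  of infinity, hence clopen, and separates the two.\<close>

lemma SZD_Alex: "SZD (succ A) (Alex A)"
  unfolding SZD_def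
proof (intro conjI CReg_Alex allI impI)
  let ?X = "succ A"
  fix Z1 Z2
  assume Z: "ZeroSet ?X (Alex A) Z1 \<and> ZeroSet ?X (Alex A) Z2 \<and> \<not> (\<exists>x. x \<epsilon> Z1 \<and> x \<epsilon> Z2)"
  have sub: "Sub Z ?X" if "ZeroSet ?X (Alex A) Z" for Z
    using that by (auto simp: ZeroSet_def Sub_def)
  have op: "diff ?X Z \<epsilon> Alex A" if "ZeroSet ?X (Alex A) Z" for Z
    using that Cozero_open unfolding Cozero_def by blast
  have clopen: "Clopen ?X (Alex A) (diff ?X Z)" if "ZeroSet ?X (Alex A) Z" "\<not> A \<epsilon> Z" for Z
    using op [OF that(1)] that(2) by (intro Clopen_infinity) auto
  have diffdiff: "diff ?X (diff ?X Z) = Z" if "Sub Z ?X" for Z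
    using SubD [OF that] by (auto intro: ext)
  show "\<exists>U. Clopen ?X (Alex A) U \<and> Sub Z1 U \<and> Sub U (diff ?X Z2)"
  proof (cases "A \<epsilon> Z1")
    case True
    then have "\<not> A \<epsilon> Z2" using Z by blast
    then have "Clopen ?X (Alex A) (diff ?X Z2)" using clopen Z by blast
    moreover have "Sub Z1 (diff ?X Z2)" using sub [of Z1] Z by (auto simp: Sub_def)
    ultimately show ?thesis using Sub_refl by blast
  next
    case False
    then have c: "Clopen ?X (Alex A) (diff ?X Z1)" using clopen Z by blast
    have "Sub Z1 ?X" using sub Z by blast
    then have "Clopen ?X (Alex A) Z1"
      using c diffdiff [of Z1] unfolding Clopen_def Closed_def by simp
    moreover have "Sub Z1 (diff ?X Z2)" using sub [of Z1] Z by (auto simp: Sub_def)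
    ultimately show ?thesis using Sub_refl by blast
  qed
qed

lemma real_un: "IsReal x \<Longrightarrow> IsReal y \<Longrightarrow> un x y = x \<or> un x y = y"
proof -
  assume "IsReal x" "IsReal y"
  then have "Sub x y \<or> Sub y x" using real_linear [of x y] by (auto simp: RLess_def RLe_def)
  moreover have "Sub x y \<Longrightarrow> un x y = y" "Sub y x \<Longrightarrow> un x y = x"
    by (rule ext, auto dest: SubD)+
  ultimately show ?thesis by blast
qed

lemma IsReal_un: "IsReal x \<Longrightarrow> IsReal y \<Longrightarrow> IsReal (un x y)"
  using real_un [of x y] by auto

text \<open>Points of \<open>A\<close> numbered by \<open>e\<close> get weight \<open>1 / (n + 1)\<close>, the point at infinity gets weight 0,
  and the distance of two distinct points is the larger weight. As reals are cuts, the maximum of two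
  reals is their union.\<close>

lemma Metrizable_Alex:
  assumes "Countable A" shows "Metrizable (succ A) (Alex A)"
proof -
  obtain e where e: "\<And>x. x \<epsilon> A \<Longrightarrow> app e x \<epsilon> \<omega>" "\<And>x y. x \<epsilon> A \<Longrightarrow> y \<epsilon> A \<Longrightarrow> app e x = app e y \<Longrightarrow> x = y"
    using CountableE [OF assms] by blast
  define X where "X = succ A"
  have X: "x \<epsilon> X \<longleftrightarrow> x \<epsilon> A \<or> x = A" for x unfolding X_def by simp
  define w where "w x = (if x = A then RZero else up (app e x))" for x
  have tw [dfn]: "Trm t \<Longrightarrow> Trm (\<lambda>\<rho>. w (t \<rho>))" for t
    unfolding w_def by (intro dfn)
  have real_w: "IsReal (w x)" if "x \<epsilon> X" for x
    using that X e(1) IsReal_up IsReal_RZero by (auto simp: w_def)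
  have w_nonneg: "RLe RZero (w x)" if "x \<epsilon> X" for x
    using that X e(1) up_pos [THEN RLess_imp_RLe] IsReal_RZero by (auto simp: w_def RLe_def)
  have w_pos: "RLess RZero (w x)" if "x \<epsilon> X" "x \<noteq> A" for x
    using that X e(1) up_pos by (auto simp: w_def)
  define g where "g p = (if fst' p = snd' p then RZero else un (w (fst' p)) (w (snd' p)))" for p
  have tg: "Trm (\<lambda>\<rho>. g (\<rho> 0))" unfolding g_def by (intro dfn tw)
  define d where "d = lam (prod X X) g"
  have FunOn: "FunOn d (prod X X)" unfolding d_def by (rule FunOn_lam [OF tg])
  have d: "dist d x y = (if x = y then RZero else un (w x) (w y))" if "x \<epsilon> X" "y \<epsilon> X" for x y
  proof -
    have "dist d x y = g (pair x y)" unfolding d_def by (rule app_lam [OF tg]) (use that in auto)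
    then show ?thesis by (simp add: g_def)
  qed
  have real_d: "IsReal (dist d x y)" if "x \<epsilon> X" "y \<epsilon> X" for x y
    using that by (simp add: d IsReal_RZero IsReal_un real_w)
  have d_nonneg: "RLe RZero (dist d x y)" if "x \<epsilon> X" "y \<epsilon> X" for x y
  proof -
    have "Sub RZero (un (w x) (w y))" using w_nonneg [OF that(1)] by (simp add: RLe_def Sub_def)
    then show ?thesis using that real_d [OF that] IsReal_RZero by (simp add: RLe_def d)
  qed
  have w_le: "Sub (w x) (dist d x y)" "Sub (w y) (dist d x y)" if "x \<epsilon> X" "y \<epsilon> X" "x \<noteq> y" for x y
    using that by (simp_all add: d Sub_def)
  have d_zero: "dist d x y \<noteq> RZero" if xy: "x \<epsilon> X" "y \<epsilon> X" "x \<noteq> y" for x y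
  proof
    assume 0: "dist d x y = RZero"
    \<comment> \<open>Two distinct points cannot both be infinity, and infinity is the only point of
      weight zero.\<close>
    obtain z where z: "z = x \<or> z = y" "z \<noteq> A" using xy(3) by metis
    then have "Sub (w z) RZero" using w_le [OF xy] 0 by auto
    moreover have "RLess RZero (w z)" using w_pos z xy by auto
    ultimately show False using Sub_antisym unfolding RLess_def RLe_def by blast
  qed
  have sym: "dist d y x = dist d x y" if "x \<epsilon> X" "y \<epsilon> X" for x y
    using that by (auto simp: d intro: ext)
  have le_radd: "Sub r (radd r s)" "Sub s (radd r s)" if "RLe RZero r" "RLe RZero s" for r s
  proof -
    have "IsReal r" "IsReal s" using that by (auto simp: RLe_def)
    then show "Sub r (radd r s)" "Sub s (radd r s)"
      using RLe_radd [of r s] RLe_radd [of s r] that radd_commute [of r s] by (auto simp: RLe_def)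
  qed
  have tri: "RLe (dist d x z) (radd (dist d x y) (dist d y z))" if x: "x \<epsilon> X" and y: "y \<epsilon> X" and z: "z \<epsilon> X" for x y z
  proof -
    note le = le_radd [OF d_nonneg [OF x y] d_nonneg [OF y z]]
    have "Sub (dist d x z) (radd (dist d x y) (dist d y z))"
    \<comment> \<open>If \<open>y\<close> differs from both ends, the weight of each end is bounded
      by the distance from that end to \<open>y\<close>, so the larger of the two weights is bounded
      by the sum of the distances.\<close>
    proof (cases "x = y \<or> y = z")
      case True
      then show ?thesis using le by auto
    next
      case False
      then have "Sub (w x) (dist d x y)" "Sub (w z) (dist d y z)" using w_le x y z by blast+
      then have "Sub (un (w x) (w z)) (radd (dist d x y) (dist d y z))"
        using le unfolding Sub_def by auto
      moreover have "Sub RZero (radd (dist d x y) (dist d y z))"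
        using le(1) d_nonneg [OF x y] unfolding RLe_def Sub_def by blast
      ultimately show ?thesis unfolding d [OF x z] by auto
    qed
    then show ?thesis using real_d IsReal_radd x y z by (simp add: RLe_def)
  qed
  have "IsMetric X d"
    unfolding IsMetric_def FunTo_def
    using FunOn real_d d_nonneg d_zero sym tri d by auto
  moreover have "U \<epsilon> Alex A \<longleftrightarrow> Sub U X \<and> (\<forall>x. x \<epsilon> U \<longrightarrow>
      (\<exists>r. RLess RZero r \<and> (\<forall>y. y \<epsilon> X \<and> RLess (dist d x y) r \<longrightarrow> y \<epsilon> U)))" for U
  proof
    assume U: "U \<epsilon> Alex A"
    have "\<exists>r. RLess RZero r \<and> (\<forall>y. y \<epsilon> X \<and> RLess (dist d x y) r \<longrightarrow> y \<epsilon> U)" if x: "x \<epsilon> U" for x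
    proof (cases "x = A")
      case False
      have xX: "x \<epsilon> X" using U x SubD mem_Alex X_def by metis
      have "y = x" if y: "y \<epsilon> X" "RLess (dist d x y) (w x)" for y
      proof (rule ccontr)
        assume "y \<noteq> x"
        then have "Sub (w x) (dist d x y)" using w_le xX y by metis
        then show False using y(2) Sub_antisym unfolding RLess_def RLe_def by blast
      qed
      then show ?thesis using w_pos [OF xX False] x by blast
    next
      case True
      then have "Finite (diff A U)" using U x mem_Alex by blast
      \<comment> \<open>The numbers of the finitely many missing points are bounded by some
        \<open>k\<close>. Their weights then exceed 1/(k+1), which is a radius that keeps them out
        of the ball around infinity.\<close>
      moreover have "Sub F A \<longrightarrow> (\<exists>k. k \<epsilon> \<omega> \<and> (\<forall>y. y \<epsilon> F \<longrightarrow> app e y \<epsilon> k))" if "Finite F" for F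
        using that
      proof (induction F rule: Finite_induct)
        case def show ?case by (intro dfn)
      next
        case empty
        show ?case by (intro impI exI [of _ \<emptyset>]) simp
      next
        case (ins x F)
        show ?case
        proof
          assume sub: "Sub (ins x F) A"
          then have x: "app e x \<epsilon> \<omega>" using e(1) by (simp add: Sub_def)
          from sub obtain k where k: "k \<epsilon> \<omega>" "\<And>y. y \<epsilon> F \<Longrightarrow> app e y \<epsilon> k"
            using ins by (auto simp: Sub_def)
          have "\<exists>m. m \<epsilon> \<omega> \<and> app e x \<epsilon> m \<and> Sub k m"
          proof (cases "app e x \<epsilon> k")
            case True
            then show ?thesis using k Sub_refl by blast
          next
            case False
            then have "k \<epsilon> succ (app e x)" using nat_linear [OF k(1) x] by auto
            then show ?thesis using x nat_trans [of "succ (app e x)" _ k]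
              by (intro exI [of _ "succ (app e x)"]) (simp add: Sub_def)
          qed
          then show "\<exists>k. k \<epsilon> \<omega> \<and> (\<forall>y. y \<epsilon> ins x F \<longrightarrow> app e y \<epsilon> k)"
            using k(2) SubD unfolding mem_ins by metis
        qed
      qed
      moreover have "Sub (diff A U) A" by (simp add: Sub_def)
      ultimately obtain k where k: "k \<epsilon> \<omega>" "\<And>y. y \<epsilon> diff A U \<Longrightarrow> app e y \<epsilon> k" by blast
      have "y \<epsilon> U" if y: "y \<epsilon> X" "RLess (dist d x y) (up k)" for y
      proof (rule ccontr)
        assume nU: "\<not> y \<epsilon> U"
        then have yA: "y \<noteq> A" "y \<epsilon> A" using x True y X by auto
        then have "app e y \<epsilon> k" using k(2) nU by simp
        then have "RLess (up k) (w y)" using up_antimono [OF k(1)] yA by (simp add: w_def)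
        moreover have "Sub (w y) (dist d x y)" using w_le(2) [of x y] yA True y X by auto
        ultimately have "RLess (up k) (dist d x y)"
          using RLess_RLe_trans [of "up k" "w y" "dist d x y"] y real_w [of y] RLess_real(1) [OF y(2)]
          by (simp add: RLe_def)
        then show False using y(2) RLess_trans RLess_irrefl by blast
      qed
      then show ?thesis using up_pos [OF k(1)] by blast
    qed
    then show "Sub U X \<and> (\<forall>x. x \<epsilon> U \<longrightarrow>
      (\<exists>r. RLess RZero r \<and> (\<forall>y. y \<epsilon> X \<and> RLess (dist d x y) r \<longrightarrow> y \<epsilon> U)))"
      using U unfolding mem_Alex X_def by blast
  next
    assume U: "Sub U X \<and> (\<forall>x. x \<epsilon> U \<longrightarrow>
      (\<exists>r. RLess RZero r \<and> (\<forall>y. y \<epsilon> X \<and> RLess (dist d x y) r \<longrightarrow> y \<epsilon> U)))"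
    have "Finite (diff A U)" if A: "A \<epsilon> U"
    proof -
      obtain r where r: "RLess RZero r" "\<And>y. y \<epsilon> X \<Longrightarrow> RLess (dist d A y) r \<Longrightarrow> y \<epsilon> U" using U A by blast
      obtain k where k: "k \<epsilon> \<omega>" "RLess (up k) r" using archimedean [OF r(1)] by blast
      \<comment> \<open>Points numbered beyond \<open>k\<close> are closer to infinity than
        \<open>r\<close> and so lie in \<open>U\<close>. The numbering thus injects the missing
        points into \<open>succ k\<close>.\<close>
      have small: "app e y \<epsilon> succ k" if y: "y \<epsilon> diff A U" for y
      proof (rule ccontr)
        assume "\<not> app e y \<epsilon> succ k"
        moreover have yA: "y \<epsilon> A" "y \<noteq> A" "\<not> y \<epsilon> U" using y mem_irrefl by auto
        ultimately have "k \<epsilon> app e y" using nat_linear [OF k(1) e(1)] by auto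
        then have "RLess (up (app e y)) r" using up_antimono e(1) yA k(2) RLess_trans by blast
        moreover have "dist d A y = up (app e y)"
        proof -
          have "Sub RZero (w y)" using w_nonneg [of y] X yA by (simp add: RLe_def)
          then have "un RZero (w y) = w y" by (intro ext) (auto dest: SubD)
          then show ?thesis using d [of A y] X yA by (simp add: w_def)
        qed
        ultimately show False using r(2) [of y] X yA by simp
      qed
      show ?thesis
        by (rule Finite_inj [of "succ k" "app e"]) (use k(1) small e(2) in \<open>auto intro: dfn\<close>)
    qed
    then show "U \<epsilon> Alex A" using U by (simp add: mem_Alex X_def)
  qed
  ultimately show ?thesis unfolding Metrizable_def X_def by blast
qed

text \<open>The balls of radius 1/(k+1) form the neighbourhood base. They are indexed by omega
  explicitly, so their countability needs no choice.\<close>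

lemma Metrizable_FirstC: "Metrizable X T \<Longrightarrow> FirstC X T"
  unfolding FirstC_def
proof (intro allI impI)
  fix x assume "Metrizable X T" and x: "x \<epsilon> X"
  then obtain d where d: "IsMetric X d" and T: "\<And>U. U \<epsilon> T \<longleftrightarrow> Sub U X \<and> (\<forall>x. x \<epsilon> U \<longrightarrow>
     (\<exists>e. RLess RZero e \<and> (\<forall>y. y \<epsilon> X \<and> RLess (dist d x y) e \<longrightarrow> y \<epsilon> U)))"
    unfolding Metrizable_def by blast
  define Ball where "Ball k = Sep X (\<lambda>y. RLess (dist d x y) (up k))" for k
  have ball: "y \<epsilon> Ball k \<longleftrightarrow> y \<epsilon> X \<and> RLess (dist d x y) (up k)" for y k
    unfolding Ball_def by (rule mem_Sep) (intro dfn)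
  have tb: "Trm (\<lambda>\<rho>. Ball (\<rho> 0))" unfolding Ball_def by (intro dfn)
  define B where "B = RepFun \<omega> Ball"
  have B: "V \<epsilon> B \<longleftrightarrow> (\<exists>k. k \<epsilon> \<omega> \<and> V = Ball k)" for V unfolding B_def by (rule mem_RepFun [OF tb])
  have dxx: "dist d x x = RZero" using d x by (simp add: IsMetric_def)
  have "Countable B" unfolding B_def by (rule Countable_image [OF Countable_omega tb])
  moreover have "V \<epsilon> T \<and> x \<epsilon> V" if V: "V \<epsilon> B" for V
  proof
    obtain k where k: "k \<epsilon> \<omega>" "V = Ball k" using V B by blast
    show "x \<epsilon> V" using x k up_pos dxx by (simp add: ball)
    show "V \<epsilon> T"
      unfolding T k(2)
    proof (intro conjI allI impI)
      show "Sub (Ball k) X" by (simp add: Sub_def ball)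
      fix y assume "y \<epsilon> Ball k"
      then have y: "y \<epsilon> X" "RLess (dist d x y) (up k)" by (auto simp: ball)
      obtain \<delta> where \<delta>: "RLess RZero \<delta>" "\<And>s. RLess s \<delta> \<Longrightarrow> RLess (radd (dist d x y) s) (up k)"
        by (rule RLess_radd [OF y(2)]) blast
      have "z \<epsilon> Ball k" if z: "z \<epsilon> X" "RLess (dist d y z) \<delta>" for z
      proof -
        have "RLe (dist d x z) (radd (dist d x y) (dist d y z))"
          using d x y z unfolding IsMetric_def by blast
        then show ?thesis using RLe_RLess_trans \<delta>(2) z ball by blast
      qed
      then show "\<exists>e. RLess RZero e \<and> (\<forall>z. z \<epsilon> X \<and> RLess (dist d y z) e \<longrightarrow> z \<epsilon> Ball k)"
        using \<delta>(1) by blast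
    qed
  qed
  moreover have "\<exists>V. V \<epsilon> B \<and> Sub V U" if U: "U \<epsilon> T \<and> x \<epsilon> U" for U
  proof -
    obtain e where e: "RLess RZero e" "\<And>y. y \<epsilon> X \<Longrightarrow> RLess (dist d x y) e \<Longrightarrow> y \<epsilon> U" using U T by blast
    obtain k where k: "k \<epsilon> \<omega>" "RLess (up k) e" using archimedean [OF e(1)] by blast
    have "Sub (Ball k) U" unfolding Sub_def ball using e(2) k(2) RLess_trans by blast
    then show ?thesis using k(1) B by blast
  qed
  ultimately show "\<exists>B. Countable B \<and> (\<forall>V. V \<epsilon> B \<longrightarrow> V \<epsilon> T \<and> x \<epsilon> V) \<and>
     (\<forall>U. U \<epsilon> T \<and> x \<epsilon> U \<longrightarrow> (\<exists>V. V \<epsilon> B \<and> Sub V U))" by blast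
qed

end

section \<open>Multiple choice from the topological sentences\<close>

context zf
begin

definition MultipleChoice :: "'a \<Rightarrow> 'a \<Rightarrow> bool" where
  "MultipleChoice I A \<longleftrightarrow> (\<exists>f. FunOn f I \<and> (\<forall>i. i \<epsilon> I \<longrightarrow>
     Sub (app f i) (app A i) \<and> app f i \<noteq> \<emptyset> \<and> Finite (app f i)))"

lemma CMC_I:
  "(\<And>I A. Denumerable I \<Longrightarrow> FunOn A I \<Longrightarrow> (\<And>i. i \<epsilon> I \<Longrightarrow> Denumerable (app A i)) \<Longrightarrow>
    MultipleChoice I A) \<Longrightarrow> CMC"
  unfolding CMC_def MultipleChoice_def by blast

text \<open>If countably many finite subsets of each member are given uniformly, some of them non-empty,
  the first non-empty one can be chosen.\<close>

lemma MultipleChoice_I: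
  assumes "Countable B"
    and N: "Def (\<lambda>\<rho>. N (\<rho> 0) (\<rho> (Suc 0)) (\<rho> (Suc (Suc 0))))"
    and fin: "\<And>i V. i \<epsilon> I \<Longrightarrow> V \<epsilon> B \<Longrightarrow> Finite (Sep (app A i) (N i V))"
    and ex: "\<And>i. i \<epsilon> I \<Longrightarrow> \<exists>V a. V \<epsilon> B \<and> a \<epsilon> app A i \<and> N i V a"
  shows "MultipleChoice I A"
proof -
  obtain e where e: "\<And>x. x \<epsilon> B \<Longrightarrow> app e x \<epsilon> \<omega>" "\<And>x y. x \<epsilon> B \<Longrightarrow> y \<epsilon> B \<Longrightarrow> app e x = app e y \<Longrightarrow> x = y"
    using CountableE [OF assms(1)] by blast
  \<comment> \<open>The enumeration \<open>e\<close> of \<open>B\<close> is the only one used; it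
    orders the candidates for all \<open>i\<close> at once.\<close>
  define P where "P i n \<longleftrightarrow> (\<exists>V. V \<epsilon> B \<and> app e V = n \<and> (\<exists>a. a \<epsilon> app A i \<and> N i V a))" for i n
  have DP: "Def (\<lambda>\<rho>. P (\<rho> 0) (\<rho> (Suc 0)))" unfolding P_def by (intro dfn Def_app3 [OF N])
  have DP1: "Def (\<lambda>\<rho>. P i (\<rho> 0))" for i by (rule Def_app2 [OF DP]) (intro dfn)+
  define c where "c i = Sep (app A i) (\<lambda>a. \<exists>V. V \<epsilon> B \<and> app e V = Least' (P i) \<and> N i V a)" for i
  have tc: "Trm (\<lambda>\<rho>. c (\<rho> 0))" unfolding c_def by (intro dfn Def_app2 [OF DP] Def_app3 [OF N])
  have DN: "Def (\<lambda>\<rho>. N i V (\<rho> 0))" for i V by (rule Def_app3 [OF N]) (intro dfn)+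
  have c: "Sub (c i) (app A i) \<and> c i \<noteq> \<emptyset> \<and> Finite (c i)" if i: "i \<epsilon> I" for i
  proof -
    obtain V a where "V \<epsilon> B" "a \<epsilon> app A i" "N i V a" using ex [OF i] by blast
    then have "P i (app e V)" "app e V \<epsilon> \<omega>" unfolding P_def using e(1) by blast+
    from Least'_props(2) [OF DP1 this(2,1)]
    obtain W b where W: "W \<epsilon> B" "app e W = Least' (P i)" "b \<epsilon> app A i" "N i W b"
      unfolding P_def [of i "Least' (P i)"] by blast
    have D1: "Def (\<lambda>\<rho>. \<exists>V. V \<epsilon> B \<and> app e V = Least' (P i) \<and> N i V (\<rho> 0))"
      by (intro dfn Def_app3 [OF N])
    \<comment> \<open>As \<open>e\<close> is injective, a single member of \<open>B\<close> has the
      least number, so the chosen set is one of those assumed to be finite.\<close>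
    have "c i = Sep (app A i) (N i W)"
    proof (rule ext)
      fix x
      show "x \<epsilon> c i \<longleftrightarrow> x \<epsilon> Sep (app A i) (N i W)"
        unfolding c_def mem_Sep [OF D1] mem_Sep [OF DN] using W(1,2) e(2) by metis
    qed
    moreover from this have "b \<epsilon> c i" using W mem_Sep [OF DN] by simp
    moreover have "Sub (Sep (app A i) (N i W)) (app A i)" unfolding Sub_def mem_Sep [OF DN] by blast
    ultimately show ?thesis using fin [OF i W(1)] by auto
  qed
  have "FunOn (lam I c) I" by (rule FunOn_lam [OF tc])
  moreover have "app (lam I c) i = c i" if "i \<epsilon> I" for i using app_lam [OF tc that] .
  ultimately show ?thesis unfolding MultipleChoice_def using c by (intro exI [of _ "lam I c"]) simp
qed

lemma Denumerable_nonempty: "Denumerable A \<Longrightarrow> \<exists>x. x \<epsilon> A"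
  unfolding Denumerable_def using ex_mem [of A] Finite_empty by metis

text \<open>Pairing with the index makes the members disjoint; the second projection brings finite
  sets of pairs back to the original members.\<close>

definition Disj :: "'a \<Rightarrow> 'a \<Rightarrow> 'a" where
  "Disj I A = Sep (prod I (Union (RepFun I (app A)))) (\<lambda>p. snd' p \<epsilon> app A (fst' p))"

lemma mem_Disj: "p \<epsilon> Disj I A \<longleftrightarrow> (\<exists>i a. i \<epsilon> I \<and> a \<epsilon> app A i \<and> p = pair i a)"
proof -
  have "Trm (\<lambda>\<rho>. app A (\<rho> 0))" by (intro dfn)
  then show ?thesis unfolding Disj_def by (subst mem_Sep, intro dfn) (auto simp: mem_RepFun)
qed

lemma Gdelta_MultipleChoice:
  assumes G: "Gdelta (Alex (Disj I A)) (sing (Disj I A))" and ne: "\<And>i. i \<epsilon> I \<Longrightarrow> \<exists>a. a \<epsilon> app A i"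
  shows "MultipleChoice I A"
proof -
  let ?S = "Disj I A"
  obtain B where B: "Countable B" "\<And>V. V \<epsilon> B \<Longrightarrow> V \<epsilon> Alex ?S"
    "\<And>x. x = ?S \<longleftrightarrow> (\<forall>V. V \<epsilon> B \<longrightarrow> x \<epsilon> V)"
    using G unfolding Gdelta_def CInt_def by auto
  show ?thesis
  proof (rule MultipleChoice_I [OF B(1), of "\<lambda>i V a. \<not> pair i a \<epsilon> V"])
    show "Def (\<lambda>\<rho>. \<not> pair (\<rho> 0) (\<rho> (Suc (Suc 0))) \<epsilon> \<rho> (Suc 0))" by (intro dfn)
  next
    fix i V assume i: "i \<epsilon> I" and V: "V \<epsilon> B"
    have "?S \<epsilon> V" using B(3) V by blast
    then have fin: "Finite (diff ?S V)" using B(2) [OF V] mem_Alex by blast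
    have t: "Trm (\<lambda>\<rho>. snd' (\<rho> 0))" by (intro dfn)
    have "x \<epsilon> RepFun (diff ?S V) snd'" if "x \<epsilon> app A i" "\<not> pair i x \<epsilon> V" for x
    proof -
      have "pair i x \<epsilon> diff ?S V" using that i mem_Disj by auto
      then show ?thesis unfolding mem_RepFun [OF t] by (metis snd'_pair)
    qed
    moreover have "Def (\<lambda>\<rho>. \<not> pair i (\<rho> 0) \<epsilon> V)" by (intro dfn)
    note mem_Sep [OF this]
    ultimately have "Sub (Sep (app A i) (\<lambda>a. \<not> pair i a \<epsilon> V)) (RepFun (diff ?S V) snd')"
      unfolding Sub_def by blast
    then show "Finite (Sep (app A i) (\<lambda>a. \<not> pair i a \<epsilon> V))"
      by (rule Finite_subset [OF Finite_image [OF fin t]])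
  next
    fix i assume i: "i \<epsilon> I"
    then obtain a where a: "a \<epsilon> app A i" using ne by blast
    then have "pair i a \<epsilon> ?S" using i mem_Disj by blast
    \<comment> \<open>Some member of \<open>B\<close> therefore omits this pair, since infinity is
      the only point common to all of them.\<close>
    then have "pair i a \<noteq> ?S" using mem_irrefl by metis
    then show "\<exists>V a. V \<epsilon> B \<and> a \<epsilon> app A i \<and> \<not> pair i a \<epsilon> V" using B(3) a by blast
  qed
qed

definition Column :: "'a \<Rightarrow> 'a \<Rightarrow> 'a \<Rightarrow> 'a" where
  "Column I A i = Sep (Disj I A) (\<lambda>p. fst' p = i)"

lemma mem_Column: "i \<epsilon> I \<Longrightarrow> p \<epsilon> Column I A i \<longleftrightarrow> (\<exists>a. a \<epsilon> app A i \<and> p = pair i a)"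
  unfolding Column_def by (subst mem_Sep, intro dfn) (auto simp: mem_Disj)

lemma Trm_Column: "Trm (\<lambda>\<rho>. Column I A (\<rho> 0))"
  unfolding Column_def by (intro dfn)

definition Rest :: "'a \<Rightarrow> 'a \<Rightarrow> 'a \<Rightarrow> 'a" where
  "Rest I A i = diff (succ (Disj I A)) (Column I A i)"

lemma Countable_Column:
  assumes "i \<epsilon> I" "Countable (app A i)" shows "Countable (Column I A i)"
proof -
  have t: "Trm (\<lambda>\<rho>. pair i (\<rho> 0))" by (intro dfn)
  have "Column I A i = RepFun (app A i) (pair i)"
    by (rule ext) (simp add: mem_RepFun [OF t] mem_Column [OF assms(1)])
  then show ?thesis using Countable_image [OF assms(2) t] by simp
qed

text \<open>The class \<open>P\<close> is left open because the same intersection is used for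
  G-delta sets, for zero-sets, for countable intersections of clopen sets, and for open sets of the
  G-delta topology.\<close>

lemma CInt_Rest:
  assumes I: "Denumerable I" and P: "\<And>i. i \<epsilon> I \<Longrightarrow> P (Rest I A i)"
  shows "CInt P (sing (Disj I A))"
proof -
  let ?S = "Disj I A"
  have t: "Trm (\<lambda>\<rho>. Rest I A (\<rho> 0))" unfolding Rest_def by (intro dfn Trm_Column)
  note mem = mem_RepFun [OF t]
  obtain i0 where i0: "i0 \<epsilon> I" using Denumerable_nonempty [OF I] by blast
  have "RepFun I (Rest I A) \<noteq> \<emptyset>" unfolding ex_mem mem using i0 by blast
  moreover have "Countable (RepFun I (Rest I A))"
    using I Countable_image [OF _ t] unfolding Denumerable_def by blast
  moreover have "x \<epsilon> sing ?S \<longleftrightarrow> (\<forall>u. u \<epsilon> RepFun I (Rest I A) \<longrightarrow> x \<epsilon> u)" for x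
  proof -
    have "x = ?S \<longleftrightarrow> (\<forall>i. i \<epsilon> I \<longrightarrow> x \<epsilon> Rest I A i)"
    proof
      assume "x = ?S"
      then show "\<forall>i. i \<epsilon> I \<longrightarrow> x \<epsilon> Rest I A i"
        using mem_irrefl [of ?S] unfolding Rest_def Column_def
        by (simp, subst mem_Sep, intro dfn) auto
    next
      assume x: "\<forall>i. i \<epsilon> I \<longrightarrow> x \<epsilon> Rest I A i"
      have "\<not> x \<epsilon> ?S"
      proof
        assume "x \<epsilon> ?S"
        then obtain i a where "i \<epsilon> I" "a \<epsilon> app A i" "x = pair i a" using mem_Disj by blast
        then show False using x mem_Column [of i I x A] unfolding Rest_def by auto
      qed
      then show "x = ?S" using x i0 unfolding Rest_def by auto
    qed
    then show ?thesis unfolding mem mem_sing by blast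
  qed
  moreover have "P u" if "u \<epsilon> RepFun I (Rest I A)" for u using that P unfolding mem by blast
  ultimately show ?thesis unfolding CInt_def by (intro exI [of _ "RepFun I (Rest I A)"]) simp
qed

text \<open>Each point of the column is isolated and has a clopen complement; the column being
  countable, these complements form a countable family with the required intersection.\<close>

lemma COdelta_Rest:
  assumes i: "i \<epsilon> I" and A: "Denumerable (app A i)"
  shows "COdelta (succ (Disj I A)) (Alex (Disj I A)) (Rest I A i)"
proof -
  let ?S = "Disj I A"
  have t: "Trm (\<lambda>\<rho>. diff (succ ?S) (sing (\<rho> 0)))" by (intro dfn)
  let ?U = "RepFun (Column I A i) (\<lambda>p. diff (succ ?S) (sing p))"
  note mem = mem_RepFun [OF t]
  obtain a where "a \<epsilon> app A i" using Denumerable_nonempty [OF A] by blast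
  then have a: "pair i a \<epsilon> Column I A i" using mem_Column [OF i] by blast
  then have "?U \<noteq> \<emptyset>" unfolding ex_mem mem by blast
  moreover have "Countable ?U"
    using A Countable_image [OF Countable_Column [OF i] t] unfolding Denumerable_def by blast
  moreover have "Clopen (succ ?S) (Alex ?S) u" if "u \<epsilon> ?U" for u
    using that mem_Column [OF i] mem_Disj i Clopen_diff_sing unfolding mem by metis
  moreover have "x \<epsilon> Rest I A i \<longleftrightarrow> (\<forall>u. u \<epsilon> ?U \<longrightarrow> x \<epsilon> u)" for x
  proof
    assume "x \<epsilon> Rest I A i"
    then show "\<forall>u. u \<epsilon> ?U \<longrightarrow> x \<epsilon> u" unfolding Rest_def mem by auto
  next
    assume "\<forall>u. u \<epsilon> ?U \<longrightarrow> x \<epsilon> u"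
    then have "x \<epsilon> diff (succ ?S) (sing p)" if "p \<epsilon> Column I A i" for p using that unfolding mem by blast
    from this [OF a] this [of x] show "x \<epsilon> Rest I A i" unfolding Rest_def by auto
  qed
  ultimately show ?thesis unfolding COdelta_def CInt_def by (intro exI [of _ ?U]) simp
qed

lemma COdelta_Gdelta: "COdelta X T s \<Longrightarrow> Gdelta T s"
  unfolding COdelta_def Gdelta_def CInt_def Clopen_def by blast

end

context zf_arith
begin

text \<open>The function takes the value 1/(n+1) at the point of the column numbered
  \<open>n\<close> and 0 elsewhere. Only the one member \<open>app A i\<close> has to be enumerated
  for this.\<close>

lemma ZeroSet_Rest:
  assumes i: "i \<epsilon> I" and A: "Countable (app A i)"
  shows "ZeroSet (succ (Disj I A)) (Alex (Disj I A)) (Rest I A i)"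
proof -
  obtain e where e: "\<And>x. x \<epsilon> app A i \<Longrightarrow> app e x \<epsilon> \<omega>"
    "\<And>x y. x \<epsilon> app A i \<Longrightarrow> y \<epsilon> app A i \<Longrightarrow> app e x = app e y \<Longrightarrow> x = y"
    using CountableE [OF A] by blast
  define S where "S = Disj I A"
  define C where "C = Column I A i"
  have C: "p \<epsilon> C \<longleftrightarrow> (\<exists>a. a \<epsilon> app A i \<and> p = pair i a)" for p
    unfolding C_def by (rule mem_Column [OF i])
  define n where "n p = app e (snd' p)" for p
  have n: "n p \<epsilon> \<omega>" if "p \<epsilon> C" for p using that e(1) C unfolding n_def by auto
  have n_inj: "p = q" if "p \<epsilon> C" "q \<epsilon> C" "n p = n q" for p q using that e(2) C unfolding n_def by auto
  have tn: "Trm (\<lambda>\<rho>. n (\<rho> 0))" unfolding n_def by (intro dfn)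
  have SC: "\<not> S \<epsilon> C" using mem_irrefl [of S] C i mem_Disj unfolding S_def by metis
  define f where "f = lam (succ S) (\<lambda>p. if p \<epsilon> C then up (n p) else RZero)"
  have tf: "Trm (\<lambda>\<rho>. if \<rho> 0 \<epsilon> C then up (n (\<rho> 0)) else RZero)" by (intro dfn tn)
  have FunOn: "FunOn f (succ S)" unfolding f_def by (rule FunOn_lam [OF tf])
  have app: "app f p = (if p \<epsilon> C then up (n p) else RZero)" if "p \<epsilon> succ S" for p
    unfolding f_def using app_lam [OF tf that] .
  have real: "IsReal (app f p)" if "p \<epsilon> succ S" for p
    using app [OF that] IsReal_up [OF n] IsReal_RZero by simp
  have opn: "Sep (succ S) (\<lambda>x. app f x \<epsilon> U) \<epsilon> Alex S" if U: "ROpen U" for U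
  proof -
    let ?V = "Sep (succ S) (\<lambda>x. app f x \<epsilon> U)"
    have "Finite (diff S ?V)" if "S \<epsilon> ?V"
    proof -
      have "RZero \<epsilon> U" using that app [of S] SC by simp
      then obtain a b where ab: "RLess a RZero" "RLess RZero b" "\<And>y. RLess a y \<Longrightarrow> RLess y b \<Longrightarrow> y \<epsilon> U"
        using U unfolding ROpen_def by blast
      obtain k where k: "k \<epsilon> \<omega>" "RLess (up k) b" using archimedean [OF ab(2)] by blast
      \<comment> \<open>Off the column the value is 0, which lies in \<open>U\<close>; on the
        column, points numbered beyond \<open>k\<close> have values between \<open>a\<close> and
        \<open>b\<close>. What remains is finite, and this is continuity at infinity.\<close>
      have small: "p \<epsilon> C \<and> n p \<epsilon> succ k" if p: "p \<epsilon> diff S ?V" for p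
      proof -
        have pS: "p \<epsilon> succ S" "\<not> app f p \<epsilon> U" using p by auto
        then have pC: "p \<epsilon> C" "app f p = up (n p)" using app \<open>RZero \<epsilon> U\<close> by (metis)+
        have "\<not> k \<epsilon> n p"
        proof
          assume "k \<epsilon> n p"
          then have "RLess (up (n p)) b" using up_antimono n [OF pC(1)] k(2) RLess_trans by blast
          moreover have "RLess a (up (n p))" using RLess_trans ab(1) up_pos n [OF pC(1)] by blast
          ultimately show False using ab(3) pS pC by simp
        qed
        then show ?thesis using nat_linear [OF k(1) n [OF pC(1)]] pC by auto
      qed
      show ?thesis
        by (rule Finite_inj [of "succ k" n]) (use k(1) small n_inj tn in auto)
    qed
    then show ?thesis by (simp add: mem_Alex Sub_def)
  qed
  have "Cont (succ S) (Alex S) f"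
    unfolding Cont_def FunTo_def using FunOn real opn by simp
  moreover have "Rest I A i = Sep (succ S) (\<lambda>x. app f x = RZero)"
  proof (rule ext)
    fix x
    have "RLess RZero (up (n x))" if "x \<epsilon> C" using up_pos n that by blast
    then show "x \<epsilon> Rest I A i \<longleftrightarrow> x \<epsilon> Sep (succ S) (\<lambda>x. app f x = RZero)"
      unfolding Rest_def S_def [symmetric] C_def [symmetric] mem_diff mem_zeros using app [of x] by auto
  qed
  ultimately show ?thesis unfolding ZeroSet_def S_def by blast
qed

text \<open>Zero is the only real in all the intervals from -1/(k+1) to 1/(k+1), so the zero-set is
  the intersection of their open preimages.\<close>

lemma ZeroSet_Gdelta:
  assumes "ZeroSet X T Z" shows "Gdelta T Z"
proof -
  obtain f where f: "Cont X T f" and Z: "Z = Sep X (\<lambda>x. app f x = RZero)"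
    using assms unfolding ZeroSet_def by blast
  define J where "J k = Sep Reals (\<lambda>x. RLess (down k) x \<and> RLess x (up k))" for k
  have J: "y \<epsilon> J k \<longleftrightarrow> RLess (down k) y \<and> RLess y (up k)" for y k
    unfolding J_def by (subst mem_Sep, intro dfn) (auto dest: RLess_real)
  have tJ: "Trm (\<lambda>\<rho>. J (\<rho> 0))" unfolding J_def by (intro dfn)
  define V where "V k = Sep X (\<lambda>x. app f x \<epsilon> J k)" for k
  have V: "x \<epsilon> V k \<longleftrightarrow> x \<epsilon> X \<and> app f x \<epsilon> J k" for x k unfolding V_def by (rule mem_preimage)
  have tV: "Trm (\<lambda>\<rho>. V (\<rho> 0))" unfolding V_def by (intro dfn Trm_app1 [OF tJ])
  note mem = mem_RepFun [OF tV]
  have VT: "V k \<epsilon> T" for k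
    using f ROpen_interval [of "down k" "up k"] unfolding Cont_def V_def J_def by blast
  have "u \<epsilon> T" if "u \<epsilon> RepFun \<omega> V" for u using that VT unfolding mem by blast
  moreover have "RepFun \<omega> V \<noteq> \<emptyset>" unfolding ex_mem mem using zero_omega by blast
  moreover have "Countable (RepFun \<omega> V)" by (rule Countable_image [OF Countable_omega tV])
  moreover have "x \<epsilon> Z \<longleftrightarrow> (\<forall>u. u \<epsilon> RepFun \<omega> V \<longrightarrow> x \<epsilon> u)" for x
  proof -
    have "app f x = RZero \<longleftrightarrow> (\<forall>k. k \<epsilon> \<omega> \<longrightarrow> app f x \<epsilon> J k)" if x: "x \<epsilon> X"
    proof
      assume "app f x = RZero"
      then show "\<forall>k. k \<epsilon> \<omega> \<longrightarrow> app f x \<epsilon> J k" unfolding J using up_pos down_neg by simp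
    next
      assume J': "\<forall>k. k \<epsilon> \<omega> \<longrightarrow> app f x \<epsilon> J k"
      have real: "IsReal (app f x)" using f x unfolding Cont_def FunTo_def by simp
      have "\<not> RLess RZero (app f x)"
        using archimedean [of "app f x"] J' RLess_trans RLess_irrefl unfolding J by blast
      moreover have "\<not> RLess (app f x) RZero"
        using archimedean_neg [of "app f x"] J' RLess_trans RLess_irrefl unfolding J by blast
      ultimately show "app f x = RZero" using real_linear [OF real IsReal_RZero] by blast
    qed
    moreover have "(\<forall>u. u \<epsilon> RepFun \<omega> V \<longrightarrow> x \<epsilon> u) \<longleftrightarrow> (\<forall>k. k \<epsilon> \<omega> \<longrightarrow> x \<epsilon> X \<and> app f x \<epsilon> J k)"
      unfolding mem using V by blast
    ultimately show ?thesis unfolding Z mem_zeros using zero_omega by blast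
  qed
  ultimately show ?thesis unfolding Gdelta_def CInt_def by (intro exI [of _ "RepFun \<omega> V"]) simp
qed

lemma Gdelta_CMC:
  assumes "\<And>I A. Denumerable I \<Longrightarrow> FunOn A I \<Longrightarrow> (\<And>i. i \<epsilon> I \<Longrightarrow> Denumerable (app A i)) \<Longrightarrow>
    Gdelta (Alex (Disj I A)) (sing (Disj I A))"
  shows CMC
  by (rule CMC_I, rule Gdelta_MultipleChoice [OF assms]) (auto intro: Denumerable_nonempty)

text \<open>The complements of the columns are G-delta sets as well as zero-sets, so either
  alternative applies to their intersection; a zero-set being a G-delta set, infinity is a G-delta
  point in both cases.\<close>

lemma CMC_of_i:
  assumes "\<And>X T. CReg X T \<Longrightarrow> T1 X T \<Longrightarrow> Stable (Gdelta T) \<or> Stable (ZeroSet X T)"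
  shows CMC
proof (rule Gdelta_CMC)
  fix I A assume I: "Denumerable I" and A: "\<And>i. i \<epsilon> I \<Longrightarrow> Denumerable (app A i)"
  let ?S = "Disj I A"
  consider "Stable (Gdelta (Alex ?S))" | "Stable (ZeroSet (succ ?S) (Alex ?S))"
    using assms [OF CReg_Alex T1_Alex] by blast
  then show "Gdelta (Alex ?S) (sing ?S)"
  proof cases
    case 1
    have "CInt (Gdelta (Alex ?S)) (sing ?S)"
      by (rule CInt_Rest [OF I]) (use A COdelta_Rest COdelta_Gdelta in blast)
    then show ?thesis using 1 unfolding Stable_def by blast
  next
    case 2
    have "CInt (ZeroSet (succ ?S) (Alex ?S)) (sing ?S)"
      by (rule CInt_Rest [OF I]) (use A ZeroSet_Rest Denumerable_def in blast)
    then show ?thesis using 2 ZeroSet_Gdelta unfolding Stable_def by blast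
  qed
qed

lemma CMC_of_ii:
  assumes "\<And>X T. SZD X T \<Longrightarrow> T1 X T \<Longrightarrow> Stable (COdelta X T)"
  shows CMC
proof (rule Gdelta_CMC)
  fix I A assume I: "Denumerable I" and A: "\<And>i. i \<epsilon> I \<Longrightarrow> Denumerable (app A i)"
  let ?S = "Disj I A"
  have "CInt (COdelta (succ ?S) (Alex ?S)) (sing ?S)"
    by (rule CInt_Rest [OF I]) (use A COdelta_Rest in blast)
  then show "Gdelta (Alex ?S) (sing ?S)"
    using assms [OF SZD_Alex T1_Alex] COdelta_Gdelta unfolding Stable_def by blast
qed

lemma CMC_of_iii:
  assumes "\<And>X T D. CReg X T \<Longrightarrow> T1 X T \<Longrightarrow> IsBase (Gdelta T) X D \<Longrightarrow> PSpace X D"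
  shows CMC
proof (rule Gdelta_CMC)
  fix I A assume I: "Denumerable I" and A: "\<And>i. i \<epsilon> I \<Longrightarrow> Denumerable (app A i)"
  let ?S = "Disj I A"
  define T where "T = Alex ?S"
  \<comment> \<open>The G-delta topology has to exist as a set of the model, which requires
    definability of \<open>Gdelta T\<close>.\<close>
  define D where "D = Sep (Pow (succ ?S)) (\<lambda>U. \<forall>x. x \<epsilon> U \<longrightarrow> (\<exists>B. Gdelta T B \<and> x \<epsilon> B \<and> Sub B U))"
  have DG: "Def (\<lambda>\<rho>. Gdelta T (\<rho> 0))" unfolding Gdelta_def by (rule Def_CInt) (intro dfn)+
  have D: "U \<epsilon> D \<longleftrightarrow> Sub U (succ ?S) \<and> (\<forall>x. x \<epsilon> U \<longrightarrow> (\<exists>B. Gdelta T B \<and> x \<epsilon> B \<and> Sub B U))" for U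
    unfolding D_def by (subst mem_Sep, intro dfn Def_app1 [OF DG]) simp
  have "IsBase (Gdelta T) (succ ?S) D" unfolding IsBase_def using D by blast
  then have "PSpace (succ ?S) D" using assms CReg_Alex T1_Alex T_def by blast
  moreover have "Rest I A i \<epsilon> D" if i: "i \<epsilon> I" for i
  proof -
    have "Gdelta T (Rest I A i)" unfolding T_def using i A COdelta_Rest COdelta_Gdelta by blast
    moreover have "Sub (Rest I A i) (succ ?S)" by (simp add: Rest_def Sub_def)
    ultimately show ?thesis unfolding D using Sub_refl by blast
  qed
  then have "CInt (\<lambda>u. u \<epsilon> D) (sing ?S)" by (rule CInt_Rest [OF I])
  ultimately have "sing ?S \<epsilon> D" unfolding PSpace_def Gdelta_def by blast
  \<comment> \<open>The singleton of infinity is only open in the finer topology so far. A basic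
    G-delta set around infinity inside it must equal it.\<close>
  then obtain B where B: "Gdelta T B" "?S \<epsilon> B" "Sub B (sing ?S)" unfolding D by auto
  have "Sub (sing ?S) B" using B(2) by (simp add: Sub_def)
  with B(3) have "B = sing ?S" by (rule Sub_antisym)
  then show "Gdelta (Alex ?S) (sing ?S)" using B(1) T_def by simp
qed

end

section \<open>Countable products of one-point compactifications\<close>

context zf
begin

text \<open>The family \<open>A\<close>, as a function, is the point of the product of the spaces \<open>A i \<union> {A i}\<close>
  all of whose coordinates are at infinity.\<close>

lemma product_MultipleChoice:
  assumes FA: "FunOn A I" and ne: "\<And>i. i \<epsilon> I \<Longrightarrow> \<exists>a. a \<epsilon> app A i"
    and FC: "\<And>S P TP. S = lam I (\<lambda>i. pair (succ (app A i)) (Alex (app A i))) \<Longrightarrow>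
      ProductSet P S I \<Longrightarrow> IsBase (Box P S I) P TP \<Longrightarrow> FirstC P TP"
  shows "MultipleChoice I A"
proof -
  define S where "S = lam I (\<lambda>i. pair (succ (app A i)) (Alex (app A i)))"
  have tS: "Trm (\<lambda>\<rho>. pair (succ (app A (\<rho> 0))) (Alex (app A (\<rho> 0))))" by (intro dfn)
  have S: "pair i (pair X T) \<epsilon> S \<longleftrightarrow> i \<epsilon> I \<and> X = succ (app A i) \<and> T = Alex (app A i)" for i X T
    unfolding S_def pair_lam [OF tS] by simp
  define Y where "Y = Union (RepFun I (\<lambda>i. succ (app A i)))"
  have tY: "Trm (\<lambda>\<rho>. succ (app A (\<rho> 0)))" by (intro dfn)
  have Y: "x \<epsilon> Y" if "i \<epsilon> I" "x \<epsilon> succ (app A i)" for i x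
    unfolding Y_def mem_Union mem_RepFun [OF tY] using that by blast
  define P where "P = Sep (Pow (prod I Y)) (\<lambda>f. FunOn f I \<and> (\<forall>i. i \<epsilon> I \<longrightarrow> app f i \<epsilon> succ (app A i)))"
  have P: "f \<epsilon> P \<longleftrightarrow> FunOn f I \<and> (\<forall>i. i \<epsilon> I \<longrightarrow> app f i \<epsilon> succ (app A i))" for f
  proof -
    have "Sub f (prod I Y)" if f: "FunOn f I" "\<forall>i. i \<epsilon> I \<longrightarrow> app f i \<epsilon> succ (app A i)"
      unfolding Sub_def
    proof (intro allI impI)
      fix p assume p: "p \<epsilon> f"
      then obtain i x where ix: "p = pair i x" using f(1) unfolding FunOn_def by blast
      then have "i \<epsilon> I" "x = app f i" using p FunOn_iff [OF f(1)] by auto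
      then show "p \<epsilon> prod I Y" using ix f(2) Y by auto
    qed
    then show ?thesis unfolding P_def by (subst mem_Sep, intro dfn) auto
  qed
  have PS: "ProductSet P S I"
    unfolding ProductSet_def P S
  proof (intro allI conj_cong refl)
    fix f assume f: "FunOn f I"
    show "(\<forall>i. i \<epsilon> I \<longrightarrow> app f i \<epsilon> succ (app A i)) \<longleftrightarrow>
      (\<forall>i X T x. (i \<epsilon> I \<and> X = succ (app A i) \<and> T = Alex (app A i)) \<and> pair i x \<epsilon> f \<longrightarrow> x \<epsilon> X)"
      unfolding FunOn_iff [OF f] by blast
  qed
  define TP where "TP = Sep (Pow P) (\<lambda>U. \<forall>x. x \<epsilon> U \<longrightarrow> (\<exists>B. Box P S I B \<and> x \<epsilon> B \<and> Sub B U))"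
  have TP: "U \<epsilon> TP \<longleftrightarrow> Sub U P \<and> (\<forall>x. x \<epsilon> U \<longrightarrow> (\<exists>B. Box P S I B \<and> x \<epsilon> B \<and> Sub B U))" for U
    unfolding TP_def by (subst mem_Sep, intro dfn) simp
  have "IsBase (Box P S I) P TP" unfolding IsBase_def using TP by blast
  then have "FirstC P TP" using FC [OF S_def PS] by blast
  moreover have AP: "A \<epsilon> P" unfolding P using FA by simp
  ultimately obtain B where B: "Countable B" "\<And>V. V \<epsilon> B \<Longrightarrow> V \<epsilon> TP \<and> A \<epsilon> V"
    "\<And>U. U \<epsilon> TP \<Longrightarrow> A \<epsilon> U \<Longrightarrow> \<exists>V. V \<epsilon> B \<and> Sub V U"
    unfolding FirstC_def by blast
  show ?thesis
  proof (rule MultipleChoice_I [OF B(1), of "\<lambda>i V a. \<forall>f. f \<epsilon> V \<longrightarrow> app f i \<noteq> a"])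
    show "Def (\<lambda>\<rho>. \<forall>f. f \<epsilon> \<rho> (Suc 0) \<longrightarrow> app f (\<rho> 0) \<noteq> \<rho> (Suc (Suc 0)))" by (intro dfn)
  next
    fix i V assume i: "i \<epsilon> I" and V: "V \<epsilon> B"
    then obtain Bx where Bx: "Box P S I Bx" "A \<epsilon> Bx" "Sub Bx V" using B(2) TP by blast
    then obtain J W where J: "FunOn W J" "Sub J I"
      and opn: "\<And>j X T v. pair j (pair X T) \<epsilon> S \<Longrightarrow> pair j v \<epsilon> W \<Longrightarrow> v \<epsilon> T"
      and mem: "\<And>f. f \<epsilon> Bx \<longleftrightarrow> f \<epsilon> P \<and> (\<forall>j v x. pair j v \<epsilon> W \<and> pair j x \<epsilon> f \<longrightarrow> x \<epsilon> v)"
      unfolding Box_def by blast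
    have W: "f \<epsilon> Bx \<longleftrightarrow> f \<epsilon> P \<and> (\<forall>j. j \<epsilon> J \<longrightarrow> app f j \<epsilon> app W j)" for f
    proof (cases "f \<epsilon> P")
      case True
      then have "FunOn f I" using P by blast
      then show ?thesis unfolding mem FunOn_iff [OF J(1)] FunOn_iff [OF \<open>FunOn f I\<close>]
        using True SubD [OF J(2)] by blast
    qed (simp add: mem)
    have "Def (\<lambda>\<rho>. \<forall>f. f \<epsilon> V \<longrightarrow> app f i \<noteq> \<rho> 0)" by (intro dfn)
    note Sep = mem_Sep [OF this]
    \<comment> \<open>If the box leaves coordinate \<open>i\<close> free or admits \<open>a\<close>
      there, then changing the \<open>i\<close>-th coordinate of the point \<open>A\<close> to
      \<open>a\<close> stays inside the box, and \<open>a\<close> is a coordinate of a point of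
      \<open>V\<close> after all.\<close>
    have out: "i \<epsilon> J \<and> \<not> a \<epsilon> app W i" if a: "a \<epsilon> app A i" "\<forall>f. f \<epsilon> V \<longrightarrow> app f i \<noteq> a" for a
    proof (rule ccontr)
      assume H: "\<not> ?thesis"
      define f where "f = lam I (\<lambda>j. if j = i then a else app A j)"
      have tf: "Trm (\<lambda>\<rho>. if \<rho> 0 = i then a else app A (\<rho> 0))" by (intro dfn)
      have app: "app f j = (if j = i then a else app A j)" if "j \<epsilon> I" for j
        unfolding f_def using app_lam [OF tf that] .
      have "FunOn f I" unfolding f_def by (rule FunOn_lam [OF tf])
      then have "f \<epsilon> P" unfolding P using app a(1) by simp
      moreover have "app f j \<epsilon> app W j" if j: "j \<epsilon> J" for j
        using app [OF SubD [OF J(2) j]] H j W [of A] Bx(2) by auto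
      ultimately have "f \<epsilon> Bx" using W by blast
      then have "f \<epsilon> V" using Bx(3) SubD by blast
      then show False using a(2) app [OF i] by simp
    qed
    have "Finite (diff (app A i) (app W i))" if "i \<epsilon> J"
    proof -
      have "app W i \<epsilon> Alex (app A i)"
        using opn [of i "succ (app A i)" "Alex (app A i)" "app W i"] i that S FunOn_iff [OF J(1)] by simp
      moreover have "app A i \<epsilon> app W i" using W [of A] Bx(2) that by blast
      ultimately show ?thesis unfolding mem_Alex by blast
    qed
    moreover have "Sub (Sep (app A i) (\<lambda>a. \<forall>f. f \<epsilon> V \<longrightarrow> app f i \<noteq> a)) (diff (app A i) (app W i))"
      unfolding Sub_def Sep mem_diff using out by blast
    moreover have "Sep (app A i) (\<lambda>a. \<forall>f. f \<epsilon> V \<longrightarrow> app f i \<noteq> a) = \<emptyset>" if "\<not> i \<epsilon> J"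
      by (rule ext) (unfold Sep, use that out in auto)
    ultimately show "Finite (Sep (app A i) (\<lambda>a. \<forall>f. f \<epsilon> V \<longrightarrow> app f i \<noteq> a))"
      using Finite_subset Finite_empty by metis
  next
    fix i assume i: "i \<epsilon> I"
    then obtain a where a: "a \<epsilon> app A i" using ne by blast
    \<comment> \<open>The box restricts the \<open>i\<close>-th coordinate alone and excludes just
      the value \<open>a\<close>. It is a neighbourhood of \<open>A\<close>, so some member of the
      neighbourhood base lies in it and omits \<open>a\<close>.\<close>
    define W where "W = lam (sing i) (\<lambda>_. diff (succ (app A i)) (sing a))"
    have tW: "Trm (\<lambda>\<rho>. diff (succ (app A i)) (sing a))" by (intro dfn)
    define U where "U = Sep P (\<lambda>f. app f i \<noteq> a)"
    have U: "f \<epsilon> U \<longleftrightarrow> f \<epsilon> P \<and> app f i \<noteq> a" for f unfolding U_def by (rule mem_Sep) (intro dfn)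
    have W: "pair j v \<epsilon> W \<longleftrightarrow> j = i \<and> v = diff (succ (app A i)) (sing a)" for j v
      unfolding W_def pair_lam [OF tW] by simp
    have "FunOn W (sing i)" unfolding W_def by (rule FunOn_lam [OF tW])
    moreover have "Sub (sing i) I" using i by (simp add: Sub_def)
    moreover have "v \<epsilon> T" if "pair j (pair X T) \<epsilon> S" "pair j v \<epsilon> W" for j X T v
      using that Alex_diff_sing [of a "app A i"] a unfolding S W by simp
    moreover have "f \<epsilon> U \<longleftrightarrow> f \<epsilon> P \<and> (\<forall>j v x. pair j v \<epsilon> W \<and> pair j x \<epsilon> f \<longrightarrow> x \<epsilon> v)" for f
    proof (cases "f \<epsilon> P")
      case True
      then have f: "FunOn f I" "app f i \<epsilon> succ (app A i)" using P i by blast+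
      show ?thesis unfolding U W FunOn_iff [OF f(1)] using True f(2) i by auto
    qed (simp add: U)
    ultimately have "Box P S I U" unfolding Box_def using Finite_sing [of i] by blast
    then have "U \<epsilon> TP" unfolding TP using U Sub_refl by (auto simp: Sub_def)
    moreover have "A \<epsilon> U" unfolding U using AP a mem_irrefl by metis
    ultimately obtain V where "V \<epsilon> B" "Sub V U" using B(3) by blast
    then show "\<exists>V a. V \<epsilon> B \<and> a \<epsilon> app A i \<and> (\<forall>f. f \<epsilon> V \<longrightarrow> app f i \<noteq> a)"
      using a U SubD by blast
  qed
qed

lemma Family_Alex:
  assumes "\<And>i. i \<epsilon> I \<Longrightarrow> K (succ (app A i)) (Alex (app A i))"
  shows "Family K (lam I (\<lambda>i. pair (succ (app A i)) (Alex (app A i)))) I"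
proof -
  have t: "Trm (\<lambda>\<rho>. pair (succ (app A (\<rho> 0))) (Alex (app A (\<rho> 0))))" by (intro dfn)
  show ?thesis
    unfolding Family_def using FunOn_lam [OF t] app_lam [OF t] IsTop_Alex assms by blast
qed

end

context zf_arith
begin

text \<open>Common core of the two product sentences: first countability of the product is enough,
  and metrizability implies it. The parameter \<open>K\<close> stands for the properties required of
  the factors.\<close>

lemma CMC_of_product:
  assumes K: "\<And>A. Countable A \<Longrightarrow> K (succ A) (Alex A)"
    and FC: "\<And>I S P TP. Countable I \<Longrightarrow> Family K S I \<Longrightarrow> ProductSet P S I \<Longrightarrow>
      IsBase (Box P S I) P TP \<Longrightarrow> FirstC P TP"
  shows CMC
proof (rule CMC_I)
  fix I A assume I: "Denumerable I" and FA: "FunOn A I" and A: "\<And>i. i \<epsilon> I \<Longrightarrow> Denumerable (app A i)"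
  have "Family K (lam I (\<lambda>i. pair (succ (app A i)) (Alex (app A i)))) I"
    by (rule Family_Alex) (use A K Denumerable_def in blast)
  moreover have "Countable I" using I Denumerable_def by blast
  ultimately show "MultipleChoice I A"
    using product_MultipleChoice [OF FA] A Denumerable_nonempty FC by blast
qed

lemma CMC_of_iv:
  assumes "\<And>I S P TP. Countable I \<Longrightarrow> Family (\<lambda>X T. Countable X \<and> Compact X T \<and> Metrizable X T) S I \<Longrightarrow>
     ProductSet P S I \<Longrightarrow> IsBase (Box P S I) P TP \<Longrightarrow> Metrizable P TP"
  shows CMC
  by (rule CMC_of_product [of "\<lambda>X T. Countable X \<and> Compact X T \<and> Metrizable X T"])
    (use assms Countable_succ Compact_Alex Metrizable_Alex Metrizable_FirstC in blast)+

lemma CMC_of_v: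
  assumes "\<And>I S P TP. Countable I \<Longrightarrow>
     Family (\<lambda>X T. Countable X \<and> Compact X T \<and> FirstC X T \<and> CReg X T \<and> T1 X T) S I \<Longrightarrow>
     ProductSet P S I \<Longrightarrow> IsBase (Box P S I) P TP \<Longrightarrow> FirstC P TP"
  shows CMC
  by (rule CMC_of_product [of "\<lambda>X T. Countable X \<and> Compact X T \<and> FirstC X T \<and> CReg X T \<and> T1 X T"])
    (use assms Countable_succ Compact_Alex Metrizable_Alex Metrizable_FirstC CReg_Alex T1_Alex in blast)+

end

section \<open>From an arbitrary countermodel to the fixed one\<close>

lemma not_refutes_refuting: "\<not> refutes refuting"
proof
  assume r: "refutes refuting"
  then have "zf refuting" by (simp add: refutes_def)
  then interpret zf_arith refuting "\<lambda>n. of_wnat (Abs_wnat n)" by (rule zf_arith_refuting)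
  obtain \<rho> s where s: "s \<in> {sentence_i, sentence_ii, sentence_iii, sentence_iv, sentence_v}"
    "sem \<rho> (s 0)" "\<not> CMC"
    using r unfolding refutes_def sem_CMC_omega by blast
  then show False
    using CMC_of_i CMC_of_ii CMC_of_iii CMC_of_iv CMC_of_v
    unfolding insert_iff
    by (elim disjE) (auto simp: sem_sentence_i sem_sentence_ii sem_sentence_iii sem_sentence_iv sem_sentence_v)
qed

text \<open>A model of ZF is infinite, since no element contains all elements. So a countable one can be
  moved to the natural numbers.\<close>

lemma sat_transfer:
  assumes "bij_betw b UNIV U" "range \<rho> \<subseteq> U"
  shows "sat UNIV (\<lambda>x y. E (b x) (b y)) (\<lambda>n. inv b (\<rho> n)) p \<longleftrightarrow> sat U E \<rho> p"
  using assms(2)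
proof (induction p arbitrary: \<rho>)
  case (Mem x y)
  then have "\<rho> x \<in> range b" "\<rho> y \<in> range b" using assms(1) by (auto simp: bij_betw_def)
  then show ?case by (simp add: f_inv_into_f)
next
  case (Eql x y)
  then have "\<rho> x \<in> range b" "\<rho> y \<in> range b" using assms(1) by (auto simp: bij_betw_def)
  then show ?case by (auto dest: inv_into_injective)
next
  case (Forall x p)
  have b: "inj b" "range b = U" using assms(1) by (auto simp: bij_betw_def)
  have "sat UNIV (\<lambda>x y. E (b x) (b y)) ((\<lambda>n. inv b (\<rho> n))(x := a)) p \<longleftrightarrow> sat U E (\<rho>(x := b a)) p" for a
  proof -
    have "(\<lambda>n. inv b (\<rho> n))(x := a) = (\<lambda>n. inv b ((\<rho>(x := b a)) n))"
      using b(1) by (auto simp: fun_eq_iff)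
    moreover have "range (\<rho>(x := b a)) \<subseteq> U" using Forall.prems b(2) by auto
    ultimately show ?thesis using Forall.IH by metis
  qed
  then show ?case using b(2) by (auto simp del: fun_upd_apply)
qed auto

lemma model_infinite:
  assumes mod: "\<And>q \<sigma>. q \<in> ZF \<Longrightarrow> range \<sigma> \<subseteq> U \<Longrightarrow> sat U E \<sigma> q" and "c \<in> U"
  shows "infinite U"
proof
  assume "finite U"
  \<comment> \<open>Pairing and union insert one element at a time, so in a finite universe some
    element would contain everything.\<close>
  have sets: "\<exists>v\<in>U. \<forall>x\<in>F. E x v" if "finite F" "F \<subseteq> U" for F
    using that
  proof (induction F rule: finite_induct)
    case empty
    then show ?case using assms(2) by blast
  next
    case (insert x F)
    then obtain v where v: "v \<in> U" "\<forall>y\<in>F. E y v" by blast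
    have pairing: "\<exists>p\<in>U. \<forall>z\<in>U. E z p \<longleftrightarrow> z = a \<or> z = b" if "a \<in> U" "b \<in> U" for a b
      using mod [of "Pairing 0" "\<lambda>_. c"] assms(2) that
      by (auto simp: ZF_def Pairing_def is_upair_def f_all_def f_ex_def f_or_def f_iff_def f_mem_def f_eq_def)
    have union: "\<exists>u\<in>U. \<forall>z\<in>U. E z u \<longleftrightarrow> (\<exists>y\<in>U. E y a \<and> E z y)" if "a \<in> U" for a
      using mod [of "Union_Axiom 0" "\<lambda>_. c"] assms(2) that
      by (auto simp: ZF_def Union_Axiom_def f_all_def f_ex_def f_and_def f_iff_def f_mem_def)
    obtain s where s: "s \<in> U" "\<forall>z\<in>U. E z s \<longleftrightarrow> z = x" using pairing [of x x] insert by auto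
    obtain p where p: "p \<in> U" "\<forall>z\<in>U. E z p \<longleftrightarrow> z = s \<or> z = v" using pairing s v by blast
    obtain u where u: "u \<in> U" "\<forall>z\<in>U. E z u \<longleftrightarrow> (\<exists>y\<in>U. E y p \<and> E z y)" using union p by blast
    have "\<forall>y\<in>insert x F. E y u" using u p s v insert.prems by blast
    then show ?case using u by blast
  qed
  obtain v where v: "v \<in> U" "\<forall>x\<in>U. E x v" using sets [OF \<open>finite U\<close>] by blast
  \<comment> \<open>The separation instance for Russell's set: the elements that are not members of
    themselves.\<close>
  have "Forall 0 (Exists 1 (Forall 2 (Iff (Mem 2 1) (Conj (Mem 2 0) (Neg (Mem 2 2)))))) \<in> ZF"
    unfolding ZF_def Separation_def by (force simp: Neg_def)
  from mod [OF this, of "\<lambda>_. c"] assms(2)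
  obtain w where "w \<in> U" "\<forall>x\<in>U. E x w \<longleftrightarrow> E x v \<and> \<not> E x x" using v(1) by force
  then show False using v by blast
qed

theorem theorem4p10:
  "(ZF \<turnstile> sentence_i \<^bold>\<longrightarrow> CMC_omega) \<and>
   (ZF \<turnstile> sentence_ii \<^bold>\<longrightarrow> CMC_omega) \<and>
   (ZF \<turnstile> sentence_iii \<^bold>\<longrightarrow> CMC_omega) \<and>
   (ZF \<turnstile> sentence_iv \<^bold>\<longrightarrow> CMC_omega) \<and>
   (ZF \<turnstile> sentence_v \<^bold>\<longrightarrow> CMC_omega)"
proof -
  have "ZF \<turnstile> s \<^bold>\<longrightarrow> CMC_omega"
    if s: "s \<in> {sentence_i, sentence_ii, sentence_iii, sentence_iv, sentence_v}" for s
    unfolding proves_def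
  proof (rule ccontr)
    assume "\<not> derivable ZF ((s \<^bold>\<longrightarrow> CMC_omega) 0)"
    then obtain U :: "nat set set" and E \<rho> where U: "countable U"
      "\<And>q \<sigma>. q \<in> ZF \<Longrightarrow> range \<sigma> \<subseteq> U \<Longrightarrow> sat U E \<sigma> q"
      "range \<rho> \<subseteq> U" "\<not> sat U E \<rho> ((s \<^bold>\<longrightarrow> CMC_omega) 0)"
      by (rule model_existence) blast
    have "infinite U" by (rule model_infinite [OF U(2)]) (use U(3) in auto)
    then have b: "bij_betw (from_nat_into U) UNIV U" by (rule bij_betw_from_nat_into [OF U(1)])
    let ?b = "from_nat_into U"
    let ?E = "\<lambda>x y. E (?b x) (?b y)"
    have inv: "inv ?b (?b x) = x" for x using b by (simp add: bij_betw_def)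
    have "zf ?E"
    proof
      fix q and \<sigma> :: "nat \<Rightarrow> nat" assume "q \<in> ZF"
      moreover have "range (\<lambda>n. ?b (\<sigma> n)) \<subseteq> U" using b by (auto simp: bij_betw_def)
      ultimately show "sat UNIV ?E \<sigma> q"
        using U(2) sat_transfer [OF b, of "\<lambda>n. ?b (\<sigma> n)" E q] by (simp add: inv)
    qed
    moreover have "\<not> sat UNIV ?E (\<lambda>n. inv ?b (\<rho> n)) ((s \<^bold>\<longrightarrow> CMC_omega) 0)"
      using U(4) sat_transfer [OF b U(3)] by blast
    then have "sat UNIV ?E (\<lambda>n. inv ?b (\<rho> n)) (s 0) \<and> \<not> sat UNIV ?E (\<lambda>n. inv ?b (\<rho> n)) (CMC_omega 0)"
      by (simp add: f_imp_def)
    ultimately have "refutes ?E" unfolding refutes_def using s by blast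
    \<comment> \<open>One refuting relation on \<open>nat\<close> is enough: \<open>refuting\<close>
      is picked by \<open>SOME\<close> among them, so it refutes as well.\<close>
    then have "refutes refuting" unfolding refuting_def by (rule someI [of refutes])
    then show False using not_refutes_refuting by blast
  qed
  then show ?thesis by blast
qed

end
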